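(* Let $\mathsf J\subseteq[n-1]$, let $T$ be a cluster tilting object in $\mathcal F_\Delta(\mathsf J)$, $L=L_T$, and let $X,Y\in\mathcal F_\Delta(\mathsf J)$. (1) $L([X],[Y])-L([\pi X],[\pi Y])=L^{\mathrm{ad}}([X],[Y])$. (2) If $Y\in\operatorname{add}\mathbb T_{\mathsf J}$, then $L([X],[Y])=L^{\mathrm{ad}}([X],[Y])=L([\pi X],[Y])$.
   Context: Fix an integer $n>1$; $[m]=\{1,\dots,m\}$. All modules are finite dimensional left modules. $D$ is the Auslander algebra of $\mathbb C[t]/(t^n)$: the path algebra over $\mathbb C$ of the quiver with vertices $0,\dots,n-1$ and arrows $b_i\colon i-1\to i$, $a_i\colon i\to i-1$ ($1\le i\le n-1$), with relations $b_{n-1}a_{n-1}=0$ (first $a_{n-1}$, then $b_{n-1}$) and $a_ib_i=b_{i-1}a_{i-1}$ for $2\le i\le n-1$. $e_i$ is the trivial path at $i$, $D_i=De_i$. The standard module $\Delta_i$ ($1\le i\le n$) is one-dimensional at vertices $0,\dots,i-1$ and zero elsewhere, with $a_1,\dots,a_{i-1}$ acting as isomorphisms and all $b_j$ as zero. $\mathcal F_\Delta\subseteq\operatorname{mod}D$ is the full subcategory of modules with a filtration by standard modules. $\mathbb T_n=D_0$, $\mathbb T_i=D_0/D_i$ for $i<n$; $\eta M=De_0M$ for $M\in\mathcal F_\Delta$ (the trace of $\bigoplus_{i=1}^n\mathbb T_i$ in $M$); $\pi M=M/\eta M$. $\mathbb T_{\mathsf J}=\bigoplus_{j\in\mathsf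 J}\mathbb T_j$; $\mathcal F_\Delta(\mathsf J)$ is the full subcategory of $M\in\mathcal F_\Delta$ with $\eta M\in\operatorname{add}\mathbb T_{\mathsf J}$, with the exact structure $\mathcal E$ of short exact sequences that stay exact under $\eta$ and extension groups $\operatorname{ext}^1$. A basic object $T$ is cluster tilting if it is rigid and $\operatorname{ext}^1(T,M)=0$ implies $M\in\operatorname{add}T$; every cluster tilting object has $\mathbb T_{\mathsf J}$ as a summand. $K(\operatorname{add}T)$ is the (split) Grothendieck group of $\operatorname{add}T$. Each $M\in\mathcal F_\Delta(\mathsf J)$ has a sequence $0\to T''_M\to T'_M\to M\to0$ in $\mathcal E$ with $T'_M\to M$ an $\operatorname{add}T$-approximation and $T'_M,T''_M\in\operatorname{add}T$; its class in $K(\operatorname{add}T)$ is $[M]=[T'_M]-[T''_M]$. For $X\in\mathcal F_\Delta(\mathsf J)$ the class of $\pi X$ is $[\pi X]=[X]-[\eta X]\in K(\operatorname{add}T)$. $L_T$ is the bilinear form on $K(\operatorname{add}T)$ with $L_T([X],[Y])=\dim\operatorname{Hom}(X,Y)-\dim\operatorname{Hom}(Y,X)$ for $X,Y\in\operatorname{add}T$. $L^{\mathrm{ad}}$ is the bilinear form on $K(\operatorname{add}T)$ with $L^{\mathrm{ad}}([X],[Y])=\dim\operatorname{Hom}(X,\eta Y)-\dim\operatorname{Hom}(Y,\eta X)$ for $X,Y\in\operatorname{add}T$. (These forms encode quasi-commutation rules of quantum cluster variables.) *)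

theory Defs
  imports
    Complex_Main
    "HOL-Library.Function_Algebras"
    "HOL-Algebra.Free_Abelian_Groups"
begin

section \<open>Free complex vector spaces and spaces of maps between them\<close>

definition scl :: "complex \<Rightarrow> ('a \<Rightarrow>\<^sub>0 complex) \<Rightarrow> ('a \<Rightarrow>\<^sub>0 complex)"
  where "scl c x = Poly_Mapping.map (\<lambda>z. c * z) x"

definition fscl :: "complex \<Rightarrow> ('b \<Rightarrow> 'a \<Rightarrow>\<^sub>0 complex) \<Rightarrow> ('b \<Rightarrow> 'a \<Rightarrow>\<^sub>0 complex)"
  where "fscl c f = (\<lambda>v. scl c (f v))"

lemma lookup_scl: "Poly_Mapping.lookup (scl c x) k = c * Poly_Mapping.lookup x k"
  unfolding scl_def by (simp add: Poly_Mapping.map.rep_eq when_def)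

interpretation free: vector_space scl
  by unfold_locales
    (auto intro!: poly_mapping_eqI simp: lookup_scl lookup_add algebra_simps)

interpretation maps: vector_space fscl
  by unfold_locales
    (auto simp: fscl_def fun_eq_iff free.scale_right_distrib free.scale_left_distrib)


section \<open>The path algebra and the relations\<close>

text \<open>\<open>Aarr i\<close> stands for the arrow $a_i$ from \<open>i\<close> to \<open>i - 1\<close> and \<open>Barr i\<close> for the arrow
  $b_i$ from \<open>i - 1\<close> to \<open>i\<close>.\<close>
datatype arrow = Aarr nat | Barr nat

text \<open>A path is its starting vertex together with its arrows in the order of composition: the
  head of the list is traversed last, so that paths act on left modules from the left.\<close>
type_synonym path = "nat \<times> arrow list"

fun walk :: "nat \<Rightarrow> nat \<Rightarrow> arrow list \<Rightarrow> nat \<Rightarrow> bool" where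
  "walk n i [] j \<longleftrightarrow> i < n \<and> j = i"
| "walk n i (Aarr k # w) j \<longleftrightarrow> 1 \<le> k \<and> k < n \<and> j = k - 1 \<and> walk n i w k"
| "walk n i (Barr k # w) j \<longleftrightarrow> 1 \<le> k \<and> k < n \<and> j = k \<and> walk n i w (k - 1)"

definition paths :: "nat \<Rightarrow> path set"
  where "paths n = {(i, w) | i w. \<exists>j. walk n i w j}"

fun path_end :: "path \<Rightarrow> nat" where
  "path_end (i, []) = i"
| "path_end (i, Aarr k # w) = k - 1"
| "path_end (i, Barr k # w) = k"

type_synonym path_elt = "path \<Rightarrow>\<^sub>0 complex"

definition path_alg :: "nat \<Rightarrow> path_elt set"
  where "path_alg n = {x. Poly_Mapping.keys x \<subseteq> paths n}"

definition pmult :: "path_elt \<Rightarrow> path_elt \<Rightarrow> path_elt"  (infixl \<open>\<star>\<close> 70)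
  where "x \<star> y = (\<Sum>p\<in>Poly_Mapping.keys x. \<Sum>q\<in>Poly_Mapping.keys y.
     if path_end q = fst p
     then Poly_Mapping.single (fst q, snd p @ snd q)
            (Poly_Mapping.lookup x p * Poly_Mapping.lookup y q)
     else 0)"

definition vtx :: "nat \<Rightarrow> path_elt" where "vtx i = Poly_Mapping.single (i, []) 1"
definition arr_a :: "nat \<Rightarrow> path_elt" where "arr_a i = Poly_Mapping.single (i, [Aarr i]) 1"
definition arr_b :: "nat \<Rightarrow> path_elt" where "arr_b i = Poly_Mapping.single (i - 1, [Barr i]) 1"

definition path_one :: "nat \<Rightarrow> path_elt" where "path_one n = (\<Sum>i<n. vtx i)"

definition relations :: "nat \<Rightarrow> path_elt set"
  where "relations n = {arr_b (n - 1) \<star> arr_a (n - 1)} \<union>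
     {arr_a i \<star> arr_b i - arr_b (i - 1) \<star> arr_a (i - 1) | i. 2 \<le> i \<and> i \<le> n - 1}"

text \<open>The two-sided ideal generated by the relations; $D$ is \<open>path_alg n\<close> modulo this ideal.\<close>
definition rel_ideal :: "nat \<Rightarrow> path_elt set"
  where "rel_ideal n = free.span {x \<star> r \<star> y | x r y.
     x \<in> path_alg n \<and> r \<in> relations n \<and> y \<in> path_alg n}"


section \<open>Finite dimensional left modules over D\<close>

text \<open>A left $D$-module is a left module over the path algebra that is annihilated by the
  relations. The underlying vector space of a module is taken to be a finite dimensional subspace
  of the complex vector space with basis \<open>nat\<close>; every finite dimensional module is isomorphic to
  one of this kind.\<close>
type_synonym vec = "nat \<Rightarrow>\<^sub>0 complex"

record dmod =
  und :: "vec set"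
  act :: "path_elt \<Rightarrow> vec \<Rightarrow> vec"

definition is_module :: "nat \<Rightarrow> dmod \<Rightarrow> bool"
  where "is_module n M \<longleftrightarrow>
     free.subspace (und M) \<and>
     (\<exists>S. finite S \<and> free.span S = und M) \<and>
     (\<forall>x\<in>path_alg n. \<forall>v\<in>und M. act M x v \<in> und M) \<and>
     (\<forall>x\<in>path_alg n. \<forall>y\<in>path_alg n. \<forall>v\<in>und M. act M (x + y) v = act M x v + act M y v) \<and>
     (\<forall>x\<in>path_alg n. \<forall>v\<in>und M. \<forall>w\<in>und M. act M x (v + w) = act M x v + act M x w) \<and>
     (\<forall>c. \<forall>x\<in>path_alg n. \<forall>v\<in>und M.
        act M (scl c x) v = scl c (act M x v) \<and> act M x (scl c v) = scl c (act M x v)) \<and>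
     (\<forall>x\<in>path_alg n. \<forall>y\<in>path_alg n. \<forall>v\<in>und M. act M (x \<star> y) v = act M x (act M y v)) \<and>
     (\<forall>v\<in>und M. act M (path_one n) v = v) \<and>
     (\<forall>r\<in>rel_ideal n. \<forall>v\<in>und M. act M r v = 0)"

text \<open>The value outside the source is normalised to 0, so that a homomorphism is determined by its
  values on the source and \<open>Hom n M N\<close> is a vector space of the right dimension.\<close>
definition Hom :: "nat \<Rightarrow> dmod \<Rightarrow> dmod \<Rightarrow> (vec \<Rightarrow> vec) set"
  where "Hom n M N = {f.
     (\<forall>v. v \<notin> und M \<longrightarrow> f v = 0) \<and>
     (\<forall>v\<in>und M. f v \<in> und N) \<and>
     (\<forall>v\<in>und M. \<forall>w\<in>und M. f (v + w) = f v + f w) \<and>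
     (\<forall>c. \<forall>v\<in>und M. f (scl c v) = scl c (f v)) \<and>
     (\<forall>x\<in>path_alg n. \<forall>v\<in>und M. f (act M x v) = act N x (f v))}"

definition hom_dim :: "nat \<Rightarrow> dmod \<Rightarrow> dmod \<Rightarrow> int"
  where "hom_dim n M N = int (maps.dim (Hom n M N))"

definition iso_mod :: "nat \<Rightarrow> dmod \<Rightarrow> dmod \<Rightarrow> bool"
  where "iso_mod n M N \<longleftrightarrow> (\<exists>f\<in>Hom n M N. bij_betw f (und M) (und N))"

definition short_exact ::
  "nat \<Rightarrow> dmod \<Rightarrow> (vec \<Rightarrow> vec) \<Rightarrow> dmod \<Rightarrow> (vec \<Rightarrow> vec) \<Rightarrow> dmod \<Rightarrow> bool"
  where "short_exact n L f M g N \<longleftrightarrow>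
     is_module n L \<and> is_module n M \<and> is_module n N \<and> f \<in> Hom n L M \<and> g \<in> Hom n M N \<and>
     inj_on f (und L) \<and> f ` und L = {v \<in> und M. g v = 0} \<and> g ` und M = und N"

text \<open>\<open>Z\<close> is a direct sum of the modules \<open>X s\<close>, for \<open>s\<close> in the finite index set \<open>S\<close>.\<close>
definition direct_sum :: "nat \<Rightarrow> dmod \<Rightarrow> 's set \<Rightarrow> ('s \<Rightarrow> dmod) \<Rightarrow> bool"
  where "direct_sum n Z S X \<longleftrightarrow> finite S \<and> is_module n Z \<and> (\<forall>s\<in>S. is_module n (X s)) \<and>
     (\<exists>inc prj. (\<forall>s\<in>S. inc s \<in> Hom n (X s) Z \<and> prj s \<in> Hom n Z (X s)) \<and>
        (\<forall>s\<in>S. \<forall>t\<in>S. \<forall>v\<in>und (X s). prj t (inc s v) = (if t = s then v else 0)) \<and>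
        (\<forall>v\<in>und Z. (\<Sum>s\<in>S. inc s (prj s v)) = v))"

definition direct_sum2 :: "nat \<Rightarrow> dmod \<Rightarrow> dmod \<Rightarrow> dmod \<Rightarrow> bool"
  where "direct_sum2 n Z M N \<longleftrightarrow> direct_sum n Z (UNIV :: bool set) (\<lambda>s. if s then M else N)"

text \<open>Membership in add T: direct summands of finite direct sums of copies of T.\<close>
definition in_add :: "nat \<Rightarrow> dmod \<Rightarrow> dmod \<Rightarrow> bool"
  where "in_add n T M \<longleftrightarrow>
     (\<exists>(m::nat) Z N. direct_sum n Z {..<m} (\<lambda>_. T) \<and> direct_sum2 n Z M N)"

definition indecomposable :: "nat \<Rightarrow> dmod \<Rightarrow> bool"
  where "indecomposable n M \<longleftrightarrow> is_module n M \<and> und M \<noteq> {0} \<and>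
     (\<forall>K N. direct_sum2 n M K N \<longrightarrow> und K = {0} \<or> und N = {0})"

definition basic :: "nat \<Rightarrow> dmod \<Rightarrow> bool"
  where "basic n T \<longleftrightarrow> (\<exists>(m::nat) X. direct_sum n T {..<m} X \<and>
     (\<forall>s<m. indecomposable n (X s)) \<and>
     (\<forall>s<m. \<forall>t<m. s \<noteq> t \<longrightarrow> \<not> iso_mod n (X s) (X t)))"


section \<open>Standard modules, the modules $T_i$ and the functor $\eta$\<close>

definition standard :: "nat \<Rightarrow> nat \<Rightarrow> dmod \<Rightarrow> bool"
  where "standard n i M \<longleftrightarrow> is_module n M \<and>
     (\<forall>j<n. free.dim (act M (vtx j) ` und M) = (if j < i then 1 else 0)) \<and>
     (\<forall>j. 1 \<le> j \<and> j \<le> i - 1 \<longrightarrow>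
        bij_betw (act M (arr_a j)) (act M (vtx j) ` und M) (act M (vtx (j - 1)) ` und M)) \<and>
     (\<forall>j. 1 \<le> j \<and> j \<le> n - 1 \<longrightarrow> (\<forall>v\<in>und M. act M (arr_b j) v = 0))"

inductive_set F_Delta :: "nat \<Rightarrow> dmod set" for n :: nat where
  zero: "is_module n M \<Longrightarrow> und M = {0} \<Longrightarrow> M \<in> F_Delta n"
| step: "N \<in> F_Delta n \<Longrightarrow> 1 \<le> i \<Longrightarrow> i \<le> n \<Longrightarrow> standard n i S \<Longrightarrow> short_exact n N f M g S
     \<Longrightarrow> M \<in> F_Delta n"

text \<open>The path $b_i \cdots b_1$ from 0 to \<open>i\<close>.\<close>
definition b_path :: "nat \<Rightarrow> path_elt"
  where "b_path i = Poly_Mapping.single (0, map Barr (rev [1..<Suc i])) 1"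

text \<open>\<open>M\<close> is isomorphic to $D_0/D_i$ for $1 \le i < n$, where $D_i = De_i$ is embedded into
  $D_0 = De_0$ by right multiplication with $b_i \cdots b_1$. Writing $P$ for the path algebra and
  $I$ for the ideal of relations, this quotient is $Pe_0 / (Ie_0 + P\,b_i \cdots b_1)$, and the
  isomorphism is given by an epimorphism from $Pe_0$ onto \<open>M\<close> with the corresponding kernel.\<close>
definition is_T :: "nat \<Rightarrow> nat \<Rightarrow> dmod \<Rightarrow> bool"
  where "is_T n i M \<longleftrightarrow> is_module n M \<and>
     (\<exists>\<phi> :: path_elt \<Rightarrow> vec. let P0 = (\<lambda>x. x \<star> vtx 0) ` path_alg n in
        (\<forall>x\<in>P0. \<forall>y\<in>P0. \<phi> (x + y) = \<phi> x + \<phi> y) \<and>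
        (\<forall>c. \<forall>x\<in>P0. \<phi> (scl c x) = scl c (\<phi> x)) \<and>
        (\<forall>x\<in>path_alg n. \<forall>y\<in>P0. \<phi> (x \<star> y) = act M x (\<phi> y)) \<and>
        \<phi> ` P0 = und M \<and>
        {x \<in> P0. \<phi> x = 0} =
          {r \<star> vtx 0 + y \<star> b_path i | r y. r \<in> rel_ideal n \<and> y \<in> path_alg n})"

definition is_TJ :: "nat \<Rightarrow> nat set \<Rightarrow> dmod \<Rightarrow> bool"
  where "is_TJ n J M \<longleftrightarrow> (\<exists>X. (\<forall>j\<in>J. is_T n j (X j)) \<and> direct_sum n M J X)"

definition in_add_TJ :: "nat \<Rightarrow> nat set \<Rightarrow> dmod \<Rightarrow> bool"
  where "in_add_TJ n J M \<longleftrightarrow> (\<exists>TJ. is_TJ n J TJ \<and> in_add n TJ M)"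

text \<open>$\eta M = De_0M$ and, on homomorphisms, restriction.\<close>
definition eta :: "nat \<Rightarrow> dmod \<Rightarrow> dmod"
  where "eta n M =
     M\<lparr>und := free.span {act M x (act M (vtx 0) v) | x v. x \<in> path_alg n \<and> v \<in> und M}\<rparr>"

definition eta_map :: "nat \<Rightarrow> dmod \<Rightarrow> (vec \<Rightarrow> vec) \<Rightarrow> (vec \<Rightarrow> vec)"
  where "eta_map n M f = (\<lambda>v. if v \<in> und (eta n M) then f v else 0)"


section \<open>The exact category $F_\Delta(J)$ and cluster tilting objects\<close>

definition F_DeltaJ :: "nat \<Rightarrow> nat set \<Rightarrow> dmod set"
  where "F_DeltaJ n J = {M \<in> F_Delta n. in_add_TJ n J (eta n M)}"

definition conflation ::
  "nat \<Rightarrow> nat set \<Rightarrow> dmod \<Rightarrow> (vec \<Rightarrow> vec) \<Rightarrow> dmod \<Rightarrow> (vec \<Rightarrow> vec) \<Rightarrow> dmod \<Rightarrow> bool"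
  where "conflation n J L f M g N \<longleftrightarrow>
     L \<in> F_DeltaJ n J \<and> M \<in> F_DeltaJ n J \<and> N \<in> F_DeltaJ n J \<and>
     short_exact n L f M g N \<and>
     short_exact n (eta n L) (eta_map n L f) (eta n M) (eta_map n M g) (eta n N)"

text \<open>\<open>ext1_zero n J N L\<close> says ext\<open>\<^sup>1\<close>(N, L) = 0: the zero class of the Yoneda extension group
  consists of the split sequences.\<close>
definition ext1_zero :: "nat \<Rightarrow> nat set \<Rightarrow> dmod \<Rightarrow> dmod \<Rightarrow> bool"
  where "ext1_zero n J N L \<longleftrightarrow>
     (\<forall>f M g. conflation n J L f M g N \<longrightarrow> (\<exists>s\<in>Hom n N M. \<forall>v\<in>und N. g (s v) = v))"

definition cluster_tilting :: "nat \<Rightarrow> nat set \<Rightarrow> dmod \<Rightarrow> bool"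
  where "cluster_tilting n J T \<longleftrightarrow> T \<in> F_DeltaJ n J \<and> basic n T \<and> ext1_zero n J T T \<and>
     (\<forall>M\<in>F_DeltaJ n J. ext1_zero n J T M \<longrightarrow> in_add n T M)"


section \<open>The split Grothendieck group and bilinear forms on it\<close>

definition add_free :: "nat \<Rightarrow> dmod \<Rightarrow> (dmod \<Rightarrow>\<^sub>0 int) monoid"
  where "add_free n T = free_Abelian_group {M. in_add n T M}"

text \<open>The relations identify isomorphic objects: if \<open>Z\<close> is isomorphic to \<open>M\<close> then it is a direct
  sum of \<open>M\<close> and a zero module, and zero modules have class 0.\<close>
definition split_rels :: "nat \<Rightarrow> dmod \<Rightarrow> (dmod \<Rightarrow>\<^sub>0 int) set"
  where "split_rels n T = generate (add_free n T)
     {frag_of Z - frag_of M - frag_of N | Z M N.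
        in_add n T Z \<and> in_add n T M \<and> in_add n T N \<and> direct_sum2 n Z M N}"

definition K_add :: "nat \<Rightarrow> dmod \<Rightarrow> (dmod \<Rightarrow>\<^sub>0 int) set monoid"
  where "K_add n T = add_free n T Mod split_rels n T"

definition K_diff ::
  "nat \<Rightarrow> dmod \<Rightarrow> (dmod \<Rightarrow>\<^sub>0 int) set \<Rightarrow> (dmod \<Rightarrow>\<^sub>0 int) set \<Rightarrow> (dmod \<Rightarrow>\<^sub>0 int) set"
  where "K_diff n T x y = x \<otimes>\<^bsub>K_add n T\<^esub> inv\<^bsub>K_add n T\<^esub> y"

text \<open>The class of an object \<open>M\<close> of add T.\<close>
definition K_obj :: "nat \<Rightarrow> dmod \<Rightarrow> dmod \<Rightarrow> (dmod \<Rightarrow>\<^sub>0 int) set"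
  where "K_obj n T M = split_rels n T #>\<^bsub>add_free n T\<^esub> frag_of M"

text \<open>\<open>c\<close> is the class \<open>[M]\<close> of an object \<open>M\<close> of $F_\Delta(J)$: it is read off from an exact
  sequence \<open>0 \<rightarrow> T2 \<rightarrow> T1 \<rightarrow> M \<rightarrow> 0\<close> whose map from \<open>T1\<close> to \<open>M\<close> is a right add T-approximation. This is a
  relation because no particular sequence is singled out.\<close>
definition has_class ::
  "nat \<Rightarrow> nat set \<Rightarrow> dmod \<Rightarrow> dmod \<Rightarrow> (dmod \<Rightarrow>\<^sub>0 int) set \<Rightarrow> bool"
  where "has_class n J T M c \<longleftrightarrow> (\<exists>T2 f T1 g.
     in_add n T T1 \<and> in_add n T T2 \<and> conflation n J T2 f T1 g M \<and>
     (\<forall>N h. in_add n T N \<and> h \<in> Hom n N M \<longrightarrow>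
        (\<exists>k\<in>Hom n N T1. \<forall>v\<in>und N. g (k v) = h v)) \<and>
     c = K_diff n T (K_obj n T T1) (K_obj n T T2))"

text \<open>\<open>[\<pi> X] = [X] - [\<eta> X]\<close>, where \<open>x = [X]\<close>; note that \<open>\<eta> X\<close> lies in add T.\<close>
definition pi_class ::
  "nat \<Rightarrow> dmod \<Rightarrow> dmod \<Rightarrow> (dmod \<Rightarrow>\<^sub>0 int) set \<Rightarrow> (dmod \<Rightarrow>\<^sub>0 int) set"
  where "pi_class n T X x = K_diff n T x (K_obj n T (eta n X))"

text \<open>The biadditive extension to the Grothendieck group of a function of two objects; it is
  independent of representatives whenever the function respects \<open>split_rels\<close> in both arguments.\<close>
definition bilinear_ext :: "(dmod \<Rightarrow> dmod \<Rightarrow> int) \<Rightarrow>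
    (dmod \<Rightarrow>\<^sub>0 int) set \<Rightarrow> (dmod \<Rightarrow>\<^sub>0 int) set \<Rightarrow> int"
  where "bilinear_ext \<beta> x y = the_elem {(\<Sum>M\<in>Poly_Mapping.keys p. \<Sum>N\<in>Poly_Mapping.keys q.
     Poly_Mapping.lookup p M * Poly_Mapping.lookup q N * \<beta> M N) | p q. p \<in> x \<and> q \<in> y}"

definition L_form :: "nat \<Rightarrow> (dmod \<Rightarrow>\<^sub>0 int) set \<Rightarrow> (dmod \<Rightarrow>\<^sub>0 int) set \<Rightarrow> int"
  where "L_form n = bilinear_ext (\<lambda>M N. hom_dim n M N - hom_dim n N M)"

definition Lad_form :: "nat \<Rightarrow> (dmod \<Rightarrow>\<^sub>0 int) set \<Rightarrow> (dmod \<Rightarrow>\<^sub>0 int) set \<Rightarrow> int"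
  where "Lad_form n = bilinear_ext (\<lambda>M N. hom_dim n M (eta n N) - hom_dim n N (eta n M))"

end

theory Submission
  imports Defs
begin

text \<open>
  Write \<open>h(A, B)\<close> for the dimension of \<open>Hom(A, \<eta> B)\<close>, so that
  \<open>L\<^sup>a\<^sup>d(A, B) = h(A, B) - h(B, A)\<close>. Two observations give the first identity.

  A homomorphism from a module generated at vertex 0 takes values in the part of the target that
  is generated at vertex 0. Hence \<open>Hom(\<eta> Z, A) = Hom(\<eta> Z, \<eta> A)\<close>, and the two forms agree as soon
  as one argument is the class of some \<open>\<eta> Z\<close>. Furthermore \<open>\<eta>\<close> is idempotent and turns the
  conflation that defines \<open>[Y]\<close> into a split sequence, so that \<open>h(A, [Y]) = h(A, [\<eta> Y])\<close>, that is,
  \<open>h(A, [\<pi> Y]) = 0\<close> for all \<open>A\<close>. Therefore \<open>L\<^sup>a\<^sup>d([\<pi> X], [\<pi> Y]) = 0\<close>. Now expand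
  \<open>L([\<pi> X], [\<pi> Y])\<close> bilinearly and replace \<open>L\<close> by \<open>L\<^sup>a\<^sup>d\<close> in the three terms that involve
  \<open>[\<eta> X]\<close> or \<open>[\<eta> Y]\<close>.

  For the second identity, \<open>Y \<in> add T\<^sub>J\<close> gives \<open>\<eta> Y = Y\<close>, and this module lies in \<open>add T\<close>. The
  identity of \<open>Y\<close> then factors through the approximation, so \<open>[Y]\<close> is the class of the object \<open>Y\<close>,
  where both forms agree. What remains is \<open>L([\<eta> X], [\<eta> Y]) = 0\<close>.

  Three facts about $D$-modules carry the argument.

  \<^item> A module lies in $F_\Delta$ if and only if all arrows $a_j$ act injectively
    (\<open>F_Delta_a_injective\<close>, \<open>F_Delta_if_a_injective\<close>). In particular \<open>\<eta> X\<close> lies in $F_\Delta$.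

  \<^item> A short exact sequence whose right end lies in $F_\Delta$ splits if its left end \<open>E\<close> lies in
    $F_\Delta$ and is generated at vertex 0 (\<open>generated_submodule_splits\<close>). It is enough to extend
    homomorphisms into \<open>E\<close> along an extension by $\Delta_i$; the obstruction is the class of a vector
    at vertex \<open>i\<close> modulo the image of $b_i$, and $b_i$ is onto in \<open>E\<close>. It follows
    that \<open>ext\<^sup>1(T, \<eta> X) = 0\<close>, so \<open>\<eta> X\<close> lies in \<open>add T\<close>, and that \<open>\<eta>\<close> turns conflations into split
    sequences.

  \<^item> If \<open>M\<close> and \<open>N\<close> lie in $F_\Delta$ and are generated at vertex 0, then \<open>Hom(M, N)\<close> and \<open>Hom(N, M)\<close>
    have the same dimension (\<open>hom_dim_commute\<close>): both are spaces of maps commuting with the action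
    of $a_1b_1$ at vertex 0, hence null spaces of two square matrices that are transposes of each
    other up to sign.
\<close>

section \<open>Rank, nullity and transposition\<close>

abbreviation (input) "lookup \<equiv> Poly_Mapping.lookup"
abbreviation (input) "single \<equiv> Poly_Mapping.single"

lemma (in vector_space) span_disjoint_zero:
  assumes "independent B" "B0 \<subseteq> B" "u \<in> span B0" "u \<in> span (B - B0)"
  shows "u = 0"
proof -
  have 1: "representation B u b = 0" if "b \<notin> B0" for b
    using representation_extend[OF assms(1,3,2)] representation_ne_zero that by metis
  have 2: "representation B u b = 0" if "b \<in> B0" for b
    using representation_extend[OF assms(1,4)] representation_ne_zero that by (metis Diff_subset DiffD2)
  have "u \<in> span B" using assms span_mono by blast
  then have "u = (\<Sum>b | representation B u b \<noteq> 0. scale (representation B u b) b)"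
    using assms(1) sum_nonzero_representation_eq by simp
  also have "\<dots> = 0" using 1 2 by (metis (mono_tags, lifting) mem_Collect_eq scale_zero_left sum.neutral)
  finally show ?thesis .
qed

text \<open>Linearity is required on \<open>A\<close> only: taking coordinates of a homomorphism with respect to bases is
  linear on a space of homomorphisms, but not on the space of all functions.\<close>
lemma (in vector_space_pair) rank_nullity:
  assumes A: "vs1.subspace A" and fin: "A \<subseteq> vs1.span S" "finite S"
    and add: "\<And>u v. u \<in> A \<Longrightarrow> v \<in> A \<Longrightarrow> F (u + v) = F u + F v"
    and scale: "\<And>c u. u \<in> A \<Longrightarrow> F (s1 c u) = s2 c (F u)"
  shows "vs1.dim A = vs1.dim {u \<in> A. F u = 0} + vs2.dim (F ` A)"
proof -
  let ?K = "{u \<in> A. F u = 0}"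
  obtain B0 where B0: "B0 \<subseteq> ?K" "vs1.independent B0" "?K \<subseteq> vs1.span B0"
    using vs1.maximal_independent_subset by blast
  obtain B where B: "B0 \<subseteq> B" "B \<subseteq> A" "vs1.independent B" "A \<subseteq> vs1.span B"
    using vs1.maximal_independent_subset_extend[of B0 A] B0 by auto
  have finB: "finite B"
    using vs1.independent_span_bound[OF fin(2) B(3)] B(2) fin(1) by auto
  have spB: "vs1.span B = A" using B A by (simp add: vs1.span_subspace)
  obtain g where g: "Vector_Spaces.linear s1 s2 g" "\<And>x. x \<in> B \<Longrightarrow> g x = F x"
    using linear_independent_extend[OF B(3)] by metis
  interpret g: Vector_Spaces.linear s1 s2 g by (rule g(1))
  have "vs1.subspace {u \<in> A. g u = F u}"
    using A scale[of _ 0] by (auto simp: vs1.subspace_def g.add add scale g.scale)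
  then have "vs1.span B \<subseteq> {u \<in> A. g u = F u}"
    using g(2) B(2) by (intro vs1.span_minimal) auto
  then have gF: "g u = F u" if "u \<in> A" for u using that spB by auto
  have inj: "inj_on g (vs1.span (B - B0))"
  proof (subst g.inj_on_iff_eq_0[OF vs1.subspace_span], intro ballI impI)
    fix u assume u: "u \<in> vs1.span (B - B0)" "g u = 0"
    have "u \<in> A" using u(1) spB vs1.span_mono[of "B - B0" B] by auto
    then have "u \<in> vs1.span B0" using B0(3) gF u(2) by auto
    then show "u = 0" using vs1.span_disjoint_zero[OF B(3,1)] u(1) by blast
  qed
  have ind: "vs2.independent (g ` (B - B0))"
    using g.independent_injective_image[OF vs1.independent_mono[OF B(3)] inj] by auto
  have "F ` A = g ` vs1.span B" using gF spB by auto
  also have "\<dots> = vs2.span (g ` B)" using g.span_image by simp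
  also have "\<dots> = vs2.span (g ` (B - B0))"
  proof -
    have "g ` B \<subseteq> insert 0 (g ` (B - B0))" using B0(1) gF by force
    then have "vs2.span (g ` B) \<subseteq> vs2.span (g ` (B - B0))"
      using vs2.span_mono vs2.span_insert_0 by metis
    then show ?thesis using vs2.span_mono[of "g ` (B - B0)" "g ` B"] by auto
  qed
  finally have "vs2.dim (F ` A) = card (g ` (B - B0))"
    using ind vs2.dim_span_eq_card_independent by simp
  also have "\<dots> = card (B - B0)"
    by (rule card_image[OF inj_on_subset[OF inj vs1.span_superset]])
  finally have 1: "vs2.dim (F ` A) = card B - card B0" using B(1) finB by (simp add: card_Diff_subset finite_subset)
  have 2: "vs1.dim A = card B" using B vs1.basis_card_eq_dim by metis
  have 3: "vs1.dim ?K = card B0" using B0 vs1.basis_card_eq_dim by metis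
  show ?thesis using 1 2 3 card_mono[OF finB B(1)] by simp
qed

interpretation free_pair: vector_space_pair scl scl ..
interpretation maps_pair: vector_space_pair fscl fscl ..
interpretation maps_free: vector_space_pair fscl scl ..

definition coords :: "'i set \<Rightarrow> ('i \<Rightarrow>\<^sub>0 complex) set"
  where "coords I = {x. Poly_Mapping.keys x \<subseteq> I}"

lemma subspace_coords: "free.subspace (coords I)"
  unfolding free.subspace_def coords_def
  by (auto simp: in_keys_iff lookup_add lookup_scl subset_iff) (metis add_0)

lemma scl_single: "scl c (single i d) = single i (c * d)"
  by (rule poly_mapping_eqI) (simp add: lookup_scl lookup_single when_def)

lemma lookup_sum: "lookup (\<Sum>a\<in>A. f a) k = (\<Sum>a\<in>A. lookup (f a) k)"
  by (induction A rule: infinite_finite_induct) (auto simp: lookup_add)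

lemma sum_singles:
  assumes "finite I" "Poly_Mapping.keys x \<subseteq> I"
  shows "x = (\<Sum>i\<in>I. single i (lookup x i))"
proof (rule poly_mapping_eqI)
  fix k
  show "lookup x k = lookup (\<Sum>i\<in>I. single i (lookup x i)) k"
    using assms by (auto simp: lookup_sum lookup_single when_def sum.delta in_keys_iff subset_iff)
qed

lemma span_singles: "coords I = free.span ((\<lambda>i. single i 1) ` I)"
proof
  show "free.span ((\<lambda>i. single i 1) ` I) \<subseteq> coords I"
    by (rule free.span_minimal) (auto simp: subspace_coords, auto simp: coords_def)
  show "coords I \<subseteq> free.span ((\<lambda>i. single i 1) ` I)"
  proof
    fix x assume x: "x \<in> coords I"
    have "x = (\<Sum>i\<in>Poly_Mapping.keys x. scl (lookup x i) (single i 1))"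
      using sum_singles[of "Poly_Mapping.keys x" x] by (simp add: scl_single)
    also have "\<dots> \<in> free.span ((\<lambda>i. single i 1) ` I)"
      using x by (intro free.span_sum free.span_scale free.span_base) (auto simp: coords_def)
    finally show "x \<in> free.span ((\<lambda>i. single i 1) ` I)" .
  qed
qed

lemma independent_singles:
  "free.independent ((\<lambda>i. single i (1 :: complex)) ` I)"
proof
  assume "free.dependent ((\<lambda>i. single i (1 :: complex)) ` I)"
  then obtain i where i: "i \<in> I" "single i (1 :: complex) \<in>
      free.span ((\<lambda>i. single i 1) ` I - {single i 1})"
    unfolding free.dependent_def by auto
  have "(\<lambda>i. single i (1 :: complex)) ` I - {single i 1} \<subseteq>
      (\<lambda>i. single i 1) ` (I - {i})" by auto
  then have "single i (1 :: complex) \<in> coords (I - {i})"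
    using i(2) free.span_mono unfolding span_singles by blast
  then show False by (auto simp: coords_def)
qed

lemma dim_coords: "free.dim (coords I) = card I"
proof -
  have "card ((\<lambda>i. single i (1 :: complex)) ` I) = card I"
    by (rule card_image) (auto simp: inj_on_def, metis lookup_single_eq lookup_single_not_eq zero_neq_one)
  then show ?thesis
    using free.dim_span_eq_card_independent[OF independent_singles, of I] span_singles by metis
qed

text \<open>The bilinear (not Hermitian) product: annihilators with respect to it describe null spaces of
  transposed matrices.\<close>
definition dot :: "('i \<Rightarrow>\<^sub>0 complex) \<Rightarrow> ('i \<Rightarrow>\<^sub>0 complex) \<Rightarrow> complex"
  where "dot x y = (\<Sum>i\<in>Poly_Mapping.keys x. lookup x i * lookup y i)"

lemma dot_eq: "finite I \<Longrightarrow> Poly_Mapping.keys x \<subseteq> I \<Longrightarrow>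
    dot x y = (\<Sum>i\<in>I. lookup x i * lookup y i)"
  unfolding dot_def by (rule sum.mono_neutral_left) (auto simp: in_keys_iff)

lemma dot_add_right: "dot x (y + z) = dot x y + dot x z"
  by (simp add: dot_def lookup_add distrib_left sum.distrib)

lemma dot_scl_right: "dot x (scl c y) = c * dot x y"
  by (simp add: dot_def lookup_scl sum_distrib_left mult_ac)

text \<open>Orthogonality to \<open>W\<close> amounts to one linear equation for each member of a basis of \<open>W\<close>, and each
  equation lowers the dimension by at most one.\<close>
lemma dim_annihilator:
  assumes I: "finite I" and W: "W \<subseteq> coords I"
  shows "card I \<le> free.dim {y \<in> coords I. \<forall>w\<in>W. dot w y = 0} + free.dim W"
proof -
  have fin: "coords I \<subseteq> free.span ((\<lambda>i. single i 1) ` I)"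
    "finite ((\<lambda>i. single i (1::complex)) ` I)"
    using span_singles[of I] I by auto
  obtain B where B: "B \<subseteq> W" "free.independent B" "W \<subseteq> free.span B"
    using free.maximal_independent_subset by blast
  have finB: "finite B"
    using free.independent_span_bound[OF fin(2) B(2)] B(1) W fin(1) by auto
  define F where "F y = (\<Sum>w\<in>B. single w (dot w y))" for y :: "'a \<Rightarrow>\<^sub>0 complex"
  have lF: "lookup (F y) w = (if w \<in> B then dot w y else 0)" for y w
    using finB by (simp add: F_def lookup_sum lookup_single when_def)
  have "free.dim (coords I) = free.dim {y \<in> coords I. F y = 0} + free.dim (F ` coords I)"
  proof (rule free_pair.rank_nullity[OF subspace_coords fin])
    show "F (u + v) = F u + F v" for u v
      by (rule poly_mapping_eqI) (simp add: lF lookup_add dot_add_right)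
    show "F (scl c u) = scl c (F u)" for c u
      by (rule poly_mapping_eqI) (simp add: lF lookup_scl dot_scl_right)
  qed
  moreover have "{y \<in> coords I. F y = 0} = {y \<in> coords I. \<forall>w\<in>W. dot w y = 0}"
  proof (intro Collect_cong conj_cong refl)
    fix y
    have *: "F y = 0 \<longleftrightarrow> (\<forall>w\<in>B. dot w y = 0)"
      by (auto simp: poly_mapping_eq_iff fun_eq_iff lF)
    have "free.subspace {w \<in> coords I. dot w y = 0}"
      using subspace_coords[of I]
      by (auto simp: free.subspace_def coords_def dot_eq[OF I] lookup_add lookup_scl
          distrib_right sum.distrib mult.assoc simp flip: sum_distrib_left)
    then have "free.span B \<subseteq> {w \<in> coords I. dot w y = 0}" if "\<forall>w\<in>B. dot w y = 0"
      using that B(1) W by (intro free.span_minimal) auto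
    then show "F y = 0 \<longleftrightarrow> (\<forall>w\<in>W. dot w y = 0)" using B(1,3) * by blast
  qed
  moreover have "free.dim (F ` coords I) \<le> card B"
  proof -
    have "F ` coords I \<subseteq> coords B" using lF by (auto simp: coords_def in_keys_iff split: if_splits)
    then have "free.dim (F ` coords I) \<le> card ((\<lambda>i. single i (1::complex)) ` B)"
      using finB by (intro free.dim_le_card) (auto simp: span_singles)
    then show ?thesis using card_image_le[OF finB] le_trans by blast
  qed
  moreover have "card B = free.dim W" using B free.basis_card_eq_dim by metis
  ultimately show ?thesis by (simp add: dim_coords)
qed

definition null_space :: "'i set \<Rightarrow> 'j set \<Rightarrow> ('i \<Rightarrow> 'j \<Rightarrow> complex) \<Rightarrow> ('j \<Rightarrow>\<^sub>0 complex) set"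
  where "null_space I J K =
    {x \<in> coords J. \<forall>i\<in>I. (\<Sum>j\<in>J. K i j * lookup x j) = 0}"

text \<open>The null space of the transposed matrix is the annihilator of the column space, whose dimension is
  known from the nullity of the matrix itself.\<close>
lemma nullity_transpose_le:
  assumes I: "finite I" and J: "finite J" and IJ: "card I = card J"
  shows "free.dim (null_space I J K) \<le> free.dim (null_space J I (\<lambda>j i. K i j))"
proof -
  define F where "F x = (\<Sum>i\<in>I. single i (\<Sum>j\<in>J. K i j * lookup x j))" for x
  have lF: "lookup (F x) i = (if i \<in> I then \<Sum>j\<in>J. K i j * lookup x j else 0)" for x i
    using I by (simp add: F_def lookup_sum lookup_single when_def)
  have fin: "coords J \<subseteq> free.span ((\<lambda>i. single i 1) ` J)"
    "finite ((\<lambda>i. single i (1::complex)) ` J)"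
    using span_singles[of J] J by auto
  have "free.dim (coords J) = free.dim {y \<in> coords J. F y = 0} + free.dim (F ` coords J)"
  proof (rule free_pair.rank_nullity[OF subspace_coords fin])
    show "F (u + v) = F u + F v" for u v
      by (rule poly_mapping_eqI) (simp add: lF lookup_add distrib_left sum.distrib)
    show "F (scl c u) = scl c (F u)" for c u
      by (rule poly_mapping_eqI) (simp add: lF lookup_scl sum_distrib_left mult_ac)
  qed
  moreover have "{y \<in> coords J. F y = 0} = null_space I J K"
    by (auto simp: null_space_def poly_mapping_eq_iff fun_eq_iff lF)
  moreover have FI: "F ` coords J \<subseteq> coords I"
    using lF by (auto simp: coords_def in_keys_iff split: if_splits)
  moreover have "{y \<in> coords I. \<forall>w\<in>F ` coords J. dot w y = 0} = null_space J I (\<lambda>j i. K i j)"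
  proof safe
    fix y assume y: "y \<in> coords I" "\<forall>w\<in>F ` coords J. dot w y = 0"
    have "(\<Sum>i\<in>I. K i j * lookup y i) = 0" if j: "j \<in> J" for j
    proof -
      let ?e = "single j (1 :: complex)"
      have e: "?e \<in> coords J" using j by (simp add: coords_def)
      then have "F ?e \<in> coords I" using FI by blast
      then have "dot (F ?e) y = (\<Sum>i\<in>I. lookup (F ?e) i * lookup y i)"
        by (intro dot_eq[OF I]) (simp add: coords_def)
      also have "\<dots> = (\<Sum>i\<in>I. K i j * lookup y i)"
        using j J by (auto intro!: sum.cong simp: lF lookup_single when_def if_distrib[of "\<lambda>z. _ * z"] cong: if_cong)
      finally show ?thesis using y e by auto
    qed
    then show "y \<in> null_space J I (\<lambda>j i. K i j)" using y by (auto simp: null_space_def)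
  next
    fix y x assume y: "y \<in> null_space J I (\<lambda>j i. K i j)" and x: "x \<in> coords J"
    have "F x \<in> coords I" using FI x by blast
    then have "dot (F x) y = (\<Sum>i\<in>I. lookup (F x) i * lookup y i)"
      by (intro dot_eq[OF I]) (simp add: coords_def)
    also have "\<dots> = (\<Sum>j\<in>J. \<Sum>i\<in>I. K i j * lookup x j * lookup y i)"
      by (subst sum.swap) (simp add: lF sum_distrib_right)
    also have "\<dots> = (\<Sum>j\<in>J. lookup x j * (\<Sum>i\<in>I. K i j * lookup y i))"
      by (simp add: sum_distrib_left mult_ac)
    also have "\<dots> = 0" using y by (simp add: null_space_def)
    finally show "dot (F x) y = 0" .
  qed (auto simp: null_space_def)
  moreover note dim_annihilator[OF I FI]
  ultimately show ?thesis using IJ by (simp add: dim_coords)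
qed

lemma nullity_transpose:
  assumes "finite I" "finite J" "card I = card J"
  shows "free.dim (null_space I J K) = free.dim (null_space J I (\<lambda>j i. K i j))"
  using nullity_transpose_le[of I J K] nullity_transpose_le[of J I "\<lambda>j i. K i j"] assms by simp

section \<open>The path algebra\<close>

lemma path_alg_coords: "path_alg n = coords (paths n)"
  by (simp add: path_alg_def coords_def)

lemma walk_path_end: "walk n i w j \<Longrightarrow> path_end (i, w) = j"
  by (induction n i w j rule: walk.induct) auto

lemma walk_append: "walk n j w' k \<Longrightarrow> walk n i w j \<Longrightarrow> walk n i (w' @ w) k"
  by (induction n j w' k rule: walk.induct) auto

lemma single_in_path_alg: "walk n i w j \<Longrightarrow> single (i, w) c \<in> path_alg n"
  by (auto simp: path_alg_def paths_def)

lemma pmult_single: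
  "single p c \<star> single q d =
    (if path_end q = fst p then single (fst q, snd p @ snd q) (c * d) else 0)"
  by (auto simp: pmult_def)

lemma path_alg_zero: "0 \<in> path_alg n"
  and path_alg_add: "x \<in> path_alg n \<Longrightarrow> y \<in> path_alg n \<Longrightarrow> x + y \<in> path_alg n"
  and path_alg_scl: "x \<in> path_alg n \<Longrightarrow> scl c x \<in> path_alg n"
  and path_alg_diff: "x \<in> path_alg n \<Longrightarrow> y \<in> path_alg n \<Longrightarrow> x - y \<in> path_alg n"
  and path_alg_sum: "(\<And>i. i \<in> I \<Longrightarrow> f i \<in> path_alg n) \<Longrightarrow> sum f I \<in> path_alg n"
  unfolding path_alg_coords using subspace_coords
  by (blast intro: free.subspace_0 free.subspace_add free.subspace_scale free.subspace_diff
      free.subspace_sum)+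

lemma vtx_in: "i < n \<Longrightarrow> vtx i \<in> path_alg n"
  unfolding vtx_def by (rule single_in_path_alg[of _ _ _ i]) simp

lemma arr_a_in: "1 \<le> k \<Longrightarrow> k < n \<Longrightarrow> arr_a k \<in> path_alg n"
  unfolding arr_a_def by (rule single_in_path_alg[of _ _ _ "k - 1"]) simp

lemma arr_b_in: "1 \<le> k \<Longrightarrow> k < n \<Longrightarrow> arr_b k \<in> path_alg n"
  unfolding arr_b_def by (rule single_in_path_alg[of _ _ _ "k"]) auto

lemma path_one_in: "path_one n \<in> path_alg n"
  unfolding path_one_def by (rule path_alg_sum) (simp add: vtx_in)

lemma pmult_in:
  assumes "x \<in> path_alg n" "y \<in> path_alg n"
  shows "x \<star> y \<in> path_alg n"
  unfolding pmult_def
proof (intro path_alg_sum)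
  fix p q assume p: "p \<in> Poly_Mapping.keys x" and q: "q \<in> Poly_Mapping.keys y"
  obtain i w j where p': "p = (i, w)" "walk n i w j"
    using p assms(1) by (auto simp: path_alg_def paths_def)
  obtain i' w' j' where q': "q = (i', w')" "walk n i' w' j'"
    using q assms(2) by (auto simp: path_alg_def paths_def)
  show "(if path_end q = fst p then single (fst q, snd p @ snd q)
      (lookup x p * lookup y q) else 0) \<in> path_alg n"
    using p' q' walk_path_end[OF q'(2)] by (auto intro!: single_in_path_alg[OF walk_append] path_alg_zero)
qed

lemma arr_a_single: "walk n i w k \<Longrightarrow>
    single (i, Aarr k # w) 1 = arr_a k \<star> single (i, w) 1"
  by (simp add: arr_a_def pmult_single walk_path_end)

lemma arr_b_single: "walk n i w (k - 1) \<Longrightarrow>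
    single (i, Barr k # w) 1 = arr_b k \<star> single (i, w) 1"
  by (simp add: arr_b_def pmult_single walk_path_end)

lemma path_alg_linear_induct [consumes 1, case_names zero add scl path]:
  assumes "x \<in> path_alg n"
    and zero: "P 0"
    and add: "\<And>x y. x \<in> path_alg n \<Longrightarrow> y \<in> path_alg n \<Longrightarrow> P x \<Longrightarrow> P y \<Longrightarrow> P (x + y)"
    and scl: "\<And>c x. x \<in> path_alg n \<Longrightarrow> P x \<Longrightarrow> P (scl c x)"
    and path: "\<And>i w j. walk n i w j \<Longrightarrow> P (single (i, w) 1)"
  shows "P x"
proof -
  have "x \<in> free.span ((\<lambda>p. single p 1) ` paths n)"
    using assms(1) span_singles unfolding path_alg_coords by blast
  then have "x \<in> path_alg n \<and> P x"
  proof (induction rule: free.span_induct_alt)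
    case base
    show ?case using zero path_alg_zero by simp
  next
    case (step c p y)
    then obtain i w j where w: "p = single (i, w) 1" "walk n i w j"
      by (auto simp: paths_def)
    then have "p \<in> path_alg n" "P p" using path single_in_path_alg by auto
    then show ?case using step by (auto intro: add scl path_alg_add path_alg_scl)
  qed
  then show ?thesis by simp
qed

section \<open>Modules\<close>

locale dmodule =
  fixes n :: nat and M :: dmod
  assumes module: "is_module n M"
begin

lemma sub: "free.subspace (und M)"
  and fin: "\<exists>S. finite S \<and> free.span S = und M"
  and act_in: "x \<in> path_alg n \<Longrightarrow> v \<in> und M \<Longrightarrow> act M x v \<in> und M"
  and act_add_left: "x \<in> path_alg n \<Longrightarrow> y \<in> path_alg n \<Longrightarrow> v \<in> und M \<Longrightarrow>
    act M (x + y) v = act M x v + act M y v"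
  and act_add: "x \<in> path_alg n \<Longrightarrow> v \<in> und M \<Longrightarrow> w \<in> und M \<Longrightarrow>
    act M x (v + w) = act M x v + act M x w"
  and act_scl_left: "x \<in> path_alg n \<Longrightarrow> v \<in> und M \<Longrightarrow> act M (scl c x) v = scl c (act M x v)"
  and act_scl: "x \<in> path_alg n \<Longrightarrow> v \<in> und M \<Longrightarrow> act M x (scl c v) = scl c (act M x v)"
  and act_mult: "x \<in> path_alg n \<Longrightarrow> y \<in> path_alg n \<Longrightarrow> v \<in> und M \<Longrightarrow>
    act M (x \<star> y) v = act M x (act M y v)"
  and act_one: "v \<in> und M \<Longrightarrow> act M (path_one n) v = v"
  and act_rel_ideal: "r \<in> rel_ideal n \<Longrightarrow> v \<in> und M \<Longrightarrow> act M r v = 0"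
  using module unfolding is_module_def by blast+

lemmas zero_in = free.subspace_0[OF sub]
lemmas add_in = free.subspace_add[OF sub]
lemmas scl_in = free.subspace_scale[OF sub]
lemmas diff_in = free.subspace_diff[OF sub]
lemmas sum_in = free.subspace_sum[OF sub]

lemma act_zero: "x \<in> path_alg n \<Longrightarrow> act M x 0 = 0"
  using act_scl[of x 0 0] zero_in by simp

lemma act_zero_left: "v \<in> und M \<Longrightarrow> act M 0 v = 0"
  using act_scl_left[of 0 v 0] path_alg_zero by simp

lemma act_diff: "x \<in> path_alg n \<Longrightarrow> v \<in> und M \<Longrightarrow> w \<in> und M \<Longrightarrow>
    act M x (v - w) = act M x v - act M x w"
  using act_add[of x "v - w" w] diff_in by (simp add: algebra_simps)

lemma act_diff_left: "x \<in> path_alg n \<Longrightarrow> y \<in> path_alg n \<Longrightarrow> v \<in> und M \<Longrightarrow>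
    act M (x - y) v = act M x v - act M y v"
  using act_add_left[of "x - y" y v] path_alg_diff by (simp add: algebra_simps)

lemma act_sum_left: "finite I \<Longrightarrow> (\<And>i. i \<in> I \<Longrightarrow> f i \<in> path_alg n) \<Longrightarrow> v \<in> und M \<Longrightarrow>
    act M (\<Sum>i\<in>I. f i) v = (\<Sum>i\<in>I. act M (f i) v)"
  by (induction I rule: finite_induct) (auto simp: act_add_left path_alg_sum act_zero_left)

lemma vertex_decomp: "v \<in> und M \<Longrightarrow> (\<Sum>i<n. act M (vtx i) v) = v"
  using act_sum_left[of "{..<n}" vtx v] act_one by (simp add: path_one_def vtx_in)

lemma act_vtx_vtx: "i < n \<Longrightarrow> j < n \<Longrightarrow> v \<in> und M \<Longrightarrow>
    act M (vtx i) (act M (vtx j) v) = (if i = j then act M (vtx i) v else 0)"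
  using act_mult[of "vtx i" "vtx j" v]
  by (simp add: vtx_in) (auto simp: vtx_def pmult_single act_zero_left)

lemma act_vtx_path: "walk n i w j \<Longrightarrow> k < n \<Longrightarrow> v \<in> und M \<Longrightarrow>
    act M (vtx k) (act M (single (i, w) c) v) =
    (if k = j then act M (single (i, w) c) v else 0)"
  using act_mult[of "vtx k" "single (i, w) c" v]
  by (simp add: vtx_in single_in_path_alg) (auto simp: vtx_def pmult_single act_zero_left walk_path_end)

lemma act_path_vtx: "walk n i w j \<Longrightarrow> k < n \<Longrightarrow> v \<in> und M \<Longrightarrow>
    act M (single (i, w) c) (act M (vtx k) v) =
    (if k = i then act M (single (i, w) c) v else 0)"
  using act_mult[of "single (i, w) c" "vtx k" v]
  by (simp add: vtx_in single_in_path_alg) (auto simp: vtx_def pmult_single act_zero_left)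

lemma act_vtx_a: "1 \<le> k \<Longrightarrow> k < n \<Longrightarrow> i < n \<Longrightarrow> v \<in> und M \<Longrightarrow>
    act M (vtx i) (act M (arr_a k) v) = (if i = k - 1 then act M (arr_a k) v else 0)"
  unfolding arr_a_def by (rule act_vtx_path) auto

lemma act_a_vtx: "1 \<le> k \<Longrightarrow> k < n \<Longrightarrow> i < n \<Longrightarrow> v \<in> und M \<Longrightarrow>
    act M (arr_a k) (act M (vtx i) v) = (if i = k then act M (arr_a k) v else 0)"
  unfolding arr_a_def by (rule act_path_vtx[of k _ "k - 1"]) auto

lemma act_vtx_b: "1 \<le> k \<Longrightarrow> k < n \<Longrightarrow> i < n \<Longrightarrow> v \<in> und M \<Longrightarrow>
    act M (vtx i) (act M (arr_b k) v) = (if i = k then act M (arr_b k) v else 0)"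
  unfolding arr_b_def by (rule act_vtx_path) auto

lemma act_b_vtx: "1 \<le> k \<Longrightarrow> k < n \<Longrightarrow> i < n \<Longrightarrow> v \<in> und M \<Longrightarrow>
    act M (arr_b k) (act M (vtx i) v) = (if i = k - 1 then act M (arr_b k) v else 0)"
  unfolding arr_b_def by (rule act_path_vtx[of "k - 1" _ "k"]) auto

text \<open>Multiplying a relation by the unit element on both sides gives a generator of the ideal, and the
  unit element acts as the identity.\<close>
lemma act_relation:
  assumes r: "r \<in> relations n" "r \<in> path_alg n" and v: "v \<in> und M"
  shows "act M r v = 0"
proof -
  have "path_one n \<star> r \<star> path_one n \<in> rel_ideal n"
    unfolding rel_ideal_def using r path_one_in by (intro free.span_base) blast
  then have "act M (path_one n \<star> r \<star> path_one n) v = 0" using v act_rel_ideal by blast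
  then show ?thesis using r v by (simp add: act_mult act_one path_one_in pmult_in act_in)
qed

lemma act_ba_last:
  assumes "n > 1" "v \<in> und M"
  shows "act M (arr_b (n - 1)) (act M (arr_a (n - 1)) v) = 0"
proof -
  have *: "arr_b (n - 1) \<in> path_alg n" "arr_a (n - 1) \<in> path_alg n"
    using assms by (auto intro: arr_a_in arr_b_in)
  then have "act M (arr_b (n - 1) \<star> arr_a (n - 1)) v = 0"
    using assms by (intro act_relation pmult_in) (auto simp: relations_def)
  then show ?thesis using * assms by (simp add: act_mult)
qed

lemma act_ab_ba:
  assumes "2 \<le> i" "i < n" "v \<in> und M"
  shows "act M (arr_a i) (act M (arr_b i) v) = act M (arr_b (i - 1)) (act M (arr_a (i - 1)) v)"
proof -
  have *: "arr_b i \<in> path_alg n" "arr_a i \<in> path_alg n" "arr_b (i - 1) \<in> path_alg n"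
      "arr_a (i - 1) \<in> path_alg n"
    using assms by (auto intro: arr_a_in arr_b_in)
  have "arr_a i \<star> arr_b i - arr_b (i - 1) \<star> arr_a (i - 1) \<in> relations n"
    using assms by (auto simp: relations_def)
  then have "act M (arr_a i \<star> arr_b i - arr_b (i - 1) \<star> arr_a (i - 1)) v = 0"
    using assms * by (intro act_relation path_alg_diff pmult_in) auto
  then show ?thesis using * assms by (simp add: act_mult act_diff_left pmult_in)
qed

lemma act_path_a: "walk n i w k \<Longrightarrow> 1 \<le> k \<Longrightarrow> k < n \<Longrightarrow> v \<in> und M \<Longrightarrow>
    act M (single (i, Aarr k # w) 1) v =
    act M (arr_a k) (act M (single (i, w) 1) v)"
  by (simp add: arr_a_single act_mult arr_a_in single_in_path_alg)

lemma act_path_b: "walk n i w (k - 1) \<Longrightarrow> 1 \<le> k \<Longrightarrow> k < n \<Longrightarrow> v \<in> und M \<Longrightarrow>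
    act M (single (i, Barr k # w) 1) v =
    act M (arr_b k) (act M (single (i, w) 1) v)"
  by (simp add: arr_b_single act_mult arr_b_in single_in_path_alg)

lemma closed_if_generators:
  assumes U: "free.subspace U" "U \<subseteq> und M"
    and vtx: "\<And>i v. i < n \<Longrightarrow> v \<in> U \<Longrightarrow> act M (vtx i) v \<in> U"
    and a: "\<And>k v. 1 \<le> k \<Longrightarrow> k < n \<Longrightarrow> v \<in> U \<Longrightarrow> act M (arr_a k) v \<in> U"
    and b: "\<And>k v. 1 \<le> k \<Longrightarrow> k < n \<Longrightarrow> v \<in> U \<Longrightarrow> act M (arr_b k) v \<in> U"
    and x: "x \<in> path_alg n" and v: "v \<in> U"
  shows "act M x v \<in> U"
proof -
  have vM: "v \<in> und M" using U v by auto
  have path: "act M (single (i, w) 1) v \<in> U" if "walk n i w j" for i w j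
    using that
  proof (induction w arbitrary: j)
    case Nil
    then show ?case using vtx[of i v] v by (simp add: vtx_def)
  next
    case (Cons r w)
    then show ?case using vM a b by (cases r) (auto simp: act_path_a act_path_b)
  qed
  show ?thesis
    using x
    by (induction rule: path_alg_linear_induct)
      (use U vM path in \<open>auto simp: act_zero_left act_add_left act_scl_left
        intro: free.subspace_0 free.subspace_add free.subspace_scale\<close>)
qed

lemma finite_dim_subset: "U \<subseteq> und M \<Longrightarrow> \<exists>S. finite S \<and> U \<subseteq> free.span S"
  using fin by blast

lemma submodule:
  assumes U: "free.subspace U" "U \<subseteq> und M"
    and act: "\<And>x v. x \<in> path_alg n \<Longrightarrow> v \<in> U \<Longrightarrow> act M x v \<in> U"
  shows "is_module n (M\<lparr>und := U\<rparr>)"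
proof -
  obtain B where B: "B \<subseteq> U" "free.independent B" "U \<subseteq> free.span B"
    using free.maximal_independent_subset by blast
  obtain S where "finite S" "U \<subseteq> free.span S" using U(2) finite_dim_subset by blast
  then have "finite B" using free.independent_span_bound[OF _ B(2)] B(1) by (meson subset_trans)
  moreover have "free.span B = U" using B U(1) by (simp add: free.span_subspace)
  ultimately have "\<exists>S. finite S \<and> free.span S = U" by blast
  moreover have "v \<in> und M" if "v \<in> U" for v using that U by auto
  ultimately show ?thesis unfolding is_module_def
    using U act by (simp add: act_add_left act_add act_scl_left act_scl act_mult act_one act_rel_ideal)
qed

end

section \<open>Paths ending at vertex 0\<close>

text \<open>The action of the path $a_1 \cdots a_j$ from vertex \<open>j\<close> to vertex 0.\<close>
fun down :: "dmod \<Rightarrow> nat \<Rightarrow> vec \<Rightarrow> vec" where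
  "down M 0 v = act M (vtx 0) v"
| "down M (Suc j) v = down M j (act M (arr_a (Suc j)) v)"

text \<open>The action of $t = a_1b_1$, which generates $e_0De_0 = \<complex>[t]/(t^n)$.\<close>
definition loop :: "dmod \<Rightarrow> vec \<Rightarrow> vec"
  where "loop M v = act M (arr_a 1) (act M (arr_b 1) v)"

context dmodule
begin

lemma down_as_act: "j < n \<Longrightarrow> \<exists>y\<in>path_alg n. \<forall>v\<in>und M. down M j v = act M (vtx 0) (act M y v)"
proof (induction j)
  case 0
  then show ?case by (auto intro!: bexI[of _ "vtx 0"] simp: vtx_in act_vtx_vtx)
next
  case (Suc j)
  then obtain y where "y \<in> path_alg n" "\<forall>v\<in>und M. down M j v = act M (vtx 0) (act M y v)" by auto
  with Suc.prems show ?case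
    by (intro bexI[of _ "y \<star> arr_a (Suc j)"]) (auto simp: act_mult arr_a_in act_in pmult_in)
qed

lemma down_in: "j < n \<Longrightarrow> v \<in> und M \<Longrightarrow> down M j v \<in> und M"
  by (induction j arbitrary: v) (auto simp: act_in vtx_in arr_a_in)

lemma down_zero: "j < n \<Longrightarrow> down M j 0 = 0"
  by (induction j) (auto simp: act_zero vtx_in arr_a_in)

lemma down_add: "j < n \<Longrightarrow> v \<in> und M \<Longrightarrow> w \<in> und M \<Longrightarrow> down M j (v + w) = down M j v + down M j w"
  by (induction j arbitrary: v w) (auto simp: act_add vtx_in arr_a_in act_in)

lemma down_scl: "j < n \<Longrightarrow> v \<in> und M \<Longrightarrow> down M j (scl c v) = scl c (down M j v)"
  by (induction j arbitrary: v) (auto simp: act_scl vtx_in arr_a_in act_in)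

lemma down_vtx: "j < n \<Longrightarrow> i < n \<Longrightarrow> v \<in> und M \<Longrightarrow>
    down M j (act M (vtx i) v) = (if i = j then down M j v else 0)"
  by (cases j) (auto simp: act_vtx_vtx act_a_vtx down_zero)

lemma down_a: "j < n \<Longrightarrow> 1 \<le> k \<Longrightarrow> k < n \<Longrightarrow> v \<in> und M \<Longrightarrow>
    down M j (act M (arr_a k) v) = (if k = Suc j then down M k v else 0)"
  using down_vtx[of j "k - 1" "act M (arr_a k) v"] act_vtx_a[of k "k - 1" v]
  by (cases k) (auto simp: act_in arr_a_in split: if_splits)

lemma down_b_other: "j < n \<Longrightarrow> 1 \<le> k \<Longrightarrow> k < n \<Longrightarrow> v \<in> und M \<Longrightarrow> k \<noteq> j \<Longrightarrow>
    down M j (act M (arr_b k) v) = 0"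
  using down_vtx[of j "k" "act M (arr_b k) v"] act_vtx_b[of k "k" v]
  by (auto simp: act_in arr_b_in split: if_splits)

lemma loop_in: "n > 1 \<Longrightarrow> v \<in> und M \<Longrightarrow> loop M v \<in> und M"
  by (simp add: loop_def act_in arr_a_in arr_b_in)

lemma loop_add: "n > 1 \<Longrightarrow> v \<in> und M \<Longrightarrow> w \<in> und M \<Longrightarrow> loop M (v + w) = loop M v + loop M w"
  by (simp add: loop_def act_add act_in arr_a_in arr_b_in)

lemma loop_scl: "n > 1 \<Longrightarrow> v \<in> und M \<Longrightarrow> loop M (scl c v) = scl c (loop M v)"
  by (simp add: loop_def act_scl act_in arr_a_in arr_b_in)

lemma loop_zero: "n > 1 \<Longrightarrow> loop M 0 = 0"
  by (simp add: loop_def act_zero arr_a_in arr_b_in)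

lemma loop_sum: "finite I \<Longrightarrow> n > 1 \<Longrightarrow> (\<And>i. i \<in> I \<Longrightarrow> f i \<in> und M) \<Longrightarrow>
    loop M (\<Sum>i\<in>I. f i) = (\<Sum>i\<in>I. loop M (f i))"
  by (induction I rule: finite_induct) (auto simp: loop_add loop_zero sum_in)

text \<open>The relations $a_ib_i = b_{i-1}a_{i-1}$ move the loop from vertex 0 up along the path until it
  becomes the arrow $b_{j+1}$ followed by $a_{j+1}$; at the top vertex the relation $b_{n-1}a_{n-1} = 0$
  kills it.\<close>
lemma loop_down:
  assumes "n > 1" "j < n" "v \<in> und M"
  shows "loop M (down M j v) = (if Suc j < n then down M (Suc j) (act M (arr_b (Suc j)) v) else 0)"
  using assms(2,3)
proof (induction j arbitrary: v)
  case 0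
  then show ?case using assms(1)
    by (simp add: loop_def act_b_vtx act_vtx_a act_in arr_b_in)
next
  case (Suc j)
  have "loop M (down M (Suc j) v) = down M (Suc j) (act M (arr_b (Suc j)) (act M (arr_a (Suc j)) v))"
    using Suc by (simp add: act_in arr_a_in)
  moreover have "\<dots> = (if Suc (Suc j) < n then
      down M (Suc (Suc j)) (act M (arr_b (Suc (Suc j))) v) else 0)"
  proof (cases "Suc (Suc j) < n")
    case True
    then show ?thesis using Suc.prems act_ab_ba[of "Suc (Suc j)" v] by simp
  next
    case False
    then have "Suc j = n - 1" using Suc.prems by simp
    then show ?thesis using Suc.prems act_ba_last[of v] assms(1) down_zero[of "n - 1"] False by simp
  qed
  ultimately show ?case by simp
qed

lemma loop_range: "n > 1 \<Longrightarrow> v \<in> und M \<Longrightarrow> act M (vtx 0) (loop M v) = loop M v"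
  by (simp add: loop_def act_vtx_a act_in arr_b_in)

lemma loop_pow_in: "n > 1 \<Longrightarrow> v \<in> und M \<Longrightarrow> (loop M ^^ k) v \<in> und M"
  by (induction k) (auto simp: loop_in)

text \<open>Appending an arrow $a_k$ to a path continues the descent to vertex 0, and appending an arrow $b_k$
  contributes one loop. Hence the paths from \<open>i\<close> to 0 act as the descent from \<open>i\<close> followed by
  powers of the loop.\<close>
lemma down_path:
  assumes "n > 1" "walk n i w j" "v \<in> und M"
  shows "down M j (act M (single (i, w) 1) v) =
    (loop M ^^ (length (filter (\<lambda>r. \<exists>k. r = Barr k) w))) (down M i v)"
  using assms(2)
proof (induction w arbitrary: j)
  case Nil
  then show ?case using assms by (simp add: down_vtx flip: vtx_def)
next
  case (Cons r w)
  show ?case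
  proof (cases r)
    case (Aarr k)
    then have k: "1 \<le> k" "k < n" "j = k - 1" "walk n i w k" using Cons.prems by auto
    then show ?thesis using Cons.IH[OF k(4)] assms Aarr
      by (simp add: act_path_a down_a act_in single_in_path_alg)
  next
    case (Barr k)
    then have k: "1 \<le> k" "k < n" "j = k" "walk n i w (k - 1)" using Cons.prems by auto
    let ?u = "act M (single (i, w) 1) v"
    have "loop M (down M (k - 1) ?u) = down M k (act M (arr_b k) ?u)"
      using k assms by (subst loop_down) (auto simp: act_in single_in_path_alg simp del: down.simps)
    then show ?thesis using Cons.IH[OF k(4)] k assms Barr
      by (simp add: act_path_b)
  qed
qed

end

text \<open>It turns out that this condition characterizes $F_\Delta$.\<close>
definition a_injective :: "nat \<Rightarrow> dmod \<Rightarrow> bool"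
  where "a_injective n M \<longleftrightarrow> (\<forall>k. 1 \<le> k \<longrightarrow> k < n \<longrightarrow>
    (\<forall>v\<in>und M. act M (vtx k) v = v \<longrightarrow> act M (arr_a k) v = 0 \<longrightarrow> v = 0))"

context dmodule
begin

lemma down_injective:
  assumes "a_injective n M" "j < n" "v \<in> und M" "act M (vtx j) v = v" "down M j v = 0"
  shows "v = 0"
  using assms(2-)
proof (induction j arbitrary: v)
  case 0
  then show ?case by simp
next
  case (Suc j)
  have "act M (arr_a (Suc j)) v = 0"
  proof (rule Suc.IH)
    show "j < n" "act M (arr_a (Suc j)) v \<in> und M" "down M j (act M (arr_a (Suc j)) v) = 0"
      using Suc.prems by (simp_all add: act_in arr_a_in)
    show "act M (vtx j) (act M (arr_a (Suc j)) v) = act M (arr_a (Suc j)) v"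
      using Suc.prems(1,2) by (simp add: act_vtx_a)
  qed
  then show ?case using assms(1) Suc.prems(1-3) unfolding a_injective_def
    by (metis One_nat_def Suc_le_mono le0)
qed

text \<open>A nonzero vector has a nonzero component at some vertex, and the descent from there to vertex 0
  is injective.\<close>
lemma zero_if_no_vertex0_part:
  assumes inj: "a_injective n M" and v: "v \<in> und M"
    and 0: "\<And>y. y \<in> path_alg n \<Longrightarrow> act M (vtx 0) (act M y v) = 0"
  shows "v = 0"
proof -
  have "act M (vtx j) v = 0" if j: "j < n" for j
  proof (rule down_injective[OF inj j])
    show "down M j (act M (vtx j) v) = 0"
      using down_as_act[OF j] 0 v j by (auto simp: down_vtx)
  qed (use v j in \<open>auto simp: act_in vtx_in act_vtx_vtx\<close>)
  then show ?thesis using vertex_decomp[OF v] by simp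
qed

end

lemma a_injective_sub: "a_injective n M \<Longrightarrow> U \<subseteq> und M \<Longrightarrow> a_injective n (M\<lparr>und := U\<rparr>)"
  by (auto simp: a_injective_def)

section \<open>Homomorphisms\<close>

lemma HomI:
  assumes "\<And>v. v \<notin> und M \<Longrightarrow> f v = 0" "\<And>v. v \<in> und M \<Longrightarrow> f v \<in> und N"
    "\<And>v w. v \<in> und M \<Longrightarrow> w \<in> und M \<Longrightarrow> f (v + w) = f v + f w"
    "\<And>c v. v \<in> und M \<Longrightarrow> f (scl c v) = scl c (f v)"
    "\<And>x v. x \<in> path_alg n \<Longrightarrow> v \<in> und M \<Longrightarrow> f (act M x v) = act N x (f v)"
  shows "f \<in> Hom n M N"
  using assms by (auto simp: Hom_def)

lemma hom_out: "f \<in> Hom n M N \<Longrightarrow> v \<notin> und M \<Longrightarrow> f v = 0"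
  and hom_in: "f \<in> Hom n M N \<Longrightarrow> v \<in> und M \<Longrightarrow> f v \<in> und N"
  and hom_add: "f \<in> Hom n M N \<Longrightarrow> v \<in> und M \<Longrightarrow> w \<in> und M \<Longrightarrow> f (v + w) = f v + f w"
  and hom_scl: "f \<in> Hom n M N \<Longrightarrow> v \<in> und M \<Longrightarrow> f (scl c v) = scl c (f v)"
  and hom_act: "f \<in> Hom n M N \<Longrightarrow> x \<in> path_alg n \<Longrightarrow> v \<in> und M \<Longrightarrow> f (act M x v) = act N x (f v)"
  by (auto simp: Hom_def)

lemma hom_zero: "f \<in> Hom n M N \<Longrightarrow> f 0 = 0"
  using hom_out[of f n M N 0] hom_scl[of f n M N 0 0] by (cases "0 \<in> und M") auto

context dmodule
begin

lemma hom_diff: "f \<in> Hom n M N \<Longrightarrow> v \<in> und M \<Longrightarrow> w \<in> und M \<Longrightarrow> f (v - w) = f v - f w"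
  using hom_add[of f n M N "v - w" w] diff_in by (simp add: algebra_simps)

lemma hom_sum: "f \<in> Hom n M N \<Longrightarrow> finite I \<Longrightarrow> (\<And>i. i \<in> I \<Longrightarrow> g i \<in> und M) \<Longrightarrow>
    f (\<Sum>i\<in>I. g i) = (\<Sum>i\<in>I. f (g i))"
  by (induction I rule: infinite_finite_induct) (auto simp: hom_zero hom_add sum_in)

lemma hom_down: "f \<in> Hom n M N \<Longrightarrow> j < n \<Longrightarrow> v \<in> und M \<Longrightarrow> f (down M j v) = down N j (f v)"
  by (induction j arbitrary: v) (auto simp: hom_act act_in vtx_in arr_a_in)

lemma hom_loop: "f \<in> Hom n M N \<Longrightarrow> n > 1 \<Longrightarrow> v \<in> und M \<Longrightarrow> f (loop M v) = loop N (f v)"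
  by (auto simp: loop_def hom_act act_in arr_b_in arr_a_in)

lemma hom_comp: "f \<in> Hom n L M \<Longrightarrow> g \<in> Hom n M N \<Longrightarrow> (\<lambda>v. g (f v)) \<in> Hom n L N"
  by (rule HomI) (auto simp: hom_zero hom_out hom_in hom_add hom_scl hom_act)

lemma hom_id: "(\<lambda>v. if v \<in> und M then v else 0) \<in> Hom n M M"
  by (rule HomI) (auto simp: add_in scl_in act_in)

text \<open>The homomorphisms needed later are prescribed on generators, in terms of presentations of elements
  that are far from unique. It is therefore convenient to give them by their graphs; by linearity it is enough
  to check single-valuedness over 0.\<close>
lemma hom_of_graph:
  assumes N: "is_module n N"
    and sub: "R \<subseteq> und M \<times> und N" and total: "\<And>u. u \<in> und M \<Longrightarrow> \<exists>w. (u, w) \<in> R"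
    and add: "\<And>u w u' w'. (u, w) \<in> R \<Longrightarrow> (u', w') \<in> R \<Longrightarrow> (u + u', w + w') \<in> R"
    and scl: "\<And>c u w. (u, w) \<in> R \<Longrightarrow> (scl c u, scl c w) \<in> R"
    and act: "\<And>x u w. x \<in> path_alg n \<Longrightarrow> (u, w) \<in> R \<Longrightarrow> (act M x u, act N x w) \<in> R"
    and single: "\<And>w. (0, w) \<in> R \<Longrightarrow> w = 0"
  shows "\<exists>f\<in>Hom n M N. \<forall>(u, w)\<in>R. f u = w"
proof -
  have uniq: "w = w'" if "(u, w) \<in> R" "(u, w') \<in> R" for u w w'
    using single[of "w - w'"] add[OF that(1) scl[OF that(2), of "-1"]] by (simp add: free.scale_minus_left)
  define f where "f u = (if u \<in> und M then THE w. (u, w) \<in> R else 0)" for u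
  have f: "f u = w" if "(u, w) \<in> R" for u w
    using that sub uniq unfolding f_def by (auto intro!: the_equality)
  have fR: "(u, f u) \<in> R" if "u \<in> und M" for u using total[OF that] f by auto
  have "f \<in> Hom n M N"
  proof (rule HomI)
    show "f v \<in> und N" if "v \<in> und M" for v using fR[OF that] sub by auto
    show "f v = 0" if "v \<notin> und M" for v using that by (simp add: f_def)
    show "f (v + w) = f v + f w" if "v \<in> und M" "w \<in> und M" for v w
      by (rule f[OF add[OF fR fR]]) fact+
    show "f (scl c v) = scl c (f v)" if "v \<in> und M" for c v
      by (rule f[OF scl[OF fR]]) fact
    show "f (act M x v) = act N x (f v)" if "x \<in> path_alg n" "v \<in> und M" for x v
      by (rule f[OF act[OF _ fR]]) fact+
  qed
  then show ?thesis using f by auto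
qed

end

section \<open>The submodule generated at vertex 0\<close>

lemma act_eta [simp]: "act (eta n M) = act M"
  by (simp add: eta_def)

context dmodule
begin

lemma eta_gen_in: "x \<in> path_alg n \<Longrightarrow> v \<in> und M \<Longrightarrow> act M x (act M (vtx 0) v) \<in> und (eta n M)"
  unfolding eta_def by (auto intro!: free.span_base)

lemma eta_subspace: "free.subspace (und (eta n M))"
  by (simp add: eta_def)

lemma eta_sub: "n > 0 \<Longrightarrow> und (eta n M) \<subseteq> und M"
  by (simp add: eta_def, rule free.span_minimal[OF _ sub]) (auto simp: act_in vtx_in)

lemma eta_induct [consumes 2, case_names zero add gen]:
  assumes "n > 0" "v \<in> und (eta n M)" and zero: "P 0"
    and add: "\<And>u w. u \<in> und M \<Longrightarrow> w \<in> und M \<Longrightarrow> P u \<Longrightarrow> P w \<Longrightarrow> P (u + w)"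
    and gen: "\<And>x w. x \<in> path_alg n \<Longrightarrow> w \<in> und M \<Longrightarrow> P (act M x (act M (vtx 0) w))"
  shows "P v"
proof -
  have "v \<in> free.span {act M x (act M (vtx 0) v) | x v. x \<in> path_alg n \<and> v \<in> und M}"
    using assms(2) by (simp add: eta_def)
  then have "v \<in> und M \<and> P v"
  proof (induction rule: free.span_induct_alt)
    case (step c g y)
    then obtain x u where g: "g = act M x (act M (vtx 0) u)" "x \<in> path_alg n" "u \<in> und M" by blast
    then have "scl c g = act M (scl c x) (act M (vtx 0) u)"
      using assms(1) by (simp add: act_scl_left act_in vtx_in)
    then have "scl c g \<in> und M" "P (scl c g)"
      using gen[of "scl c x" u] g assms(1) by (auto simp: path_alg_scl act_in vtx_in)
    then show ?case using step add add_in by blast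
  qed (auto simp: zero zero_in)
  then show ?thesis by simp
qed

lemma eta_closed:
  assumes n: "n > 0" and x: "x \<in> path_alg n" and v: "v \<in> und (eta n M)"
  shows "act M x v \<in> und (eta n M)"
  using n v
proof (induction rule: eta_induct)
  case zero
  then show ?case using eta_subspace x by (simp add: act_zero free.subspace_0)
next
  case (add u w)
  then show ?case using eta_subspace x by (simp add: act_add free.subspace_add)
next
  case (gen y w)
  have "act M x (act M y (act M (vtx 0) w)) = act M (x \<star> y) (act M (vtx 0) w)"
    using gen x n by (simp add: act_mult act_in vtx_in)
  then show ?case using eta_gen_in gen x pmult_in by simp
qed

lemma eta_module: "n > 0 \<Longrightarrow> is_module n (eta n M)"
  using submodule[OF eta_subspace eta_sub eta_closed] by (simp add: eta_def)

lemma eta_eqI: "n > 0 \<Longrightarrow> und M \<subseteq> und (eta n M) \<Longrightarrow> eta n M = M"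
  using eta_sub by (intro dmod.equality) (auto simp: eta_def)

lemma eta_eta:
  assumes "n > 0"
  shows "eta n (eta n M) = eta n M"
proof -
  interpret e: dmodule n "eta n M" using eta_module[OF assms] by unfold_locales
  have "v \<in> und (eta n (eta n M))" if "v \<in> und (eta n M)" for v
    using assms that
  proof (induction rule: eta_induct)
    case (gen x w)
    have "act M (vtx 0) w \<in> und (eta n M)"
      using eta_gen_in[of "vtx 0" w] gen assms by (simp add: vtx_in act_vtx_vtx)
    from e.eta_gen_in[OF gen(1) this] show ?case
      using gen assms by (simp add: act_vtx_vtx)
  qed (use e.eta_subspace in \<open>auto intro: free.subspace_0 free.subspace_add\<close>)
  then show ?thesis using e.eta_eqI assms by blast
qed

lemma hom_eta:
  assumes n: "n > 0" and N: "is_module n N" and f: "f \<in> Hom n M N" and v: "v \<in> und (eta n M)"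
  shows "f v \<in> und (eta n N)"
proof -
  interpret N: dmodule n N using N by unfold_locales
  show ?thesis using n v
  proof (induction rule: eta_induct)
    case (gen x w)
    then show ?case using N.eta_gen_in[of x "f w"] f n
      by (simp add: hom_act[OF f] hom_in[OF f] act_in vtx_in)
  qed (use N.eta_subspace f in \<open>auto simp: hom_zero hom_add[OF f] intro: free.subspace_0 free.subspace_add\<close>)
qed

lemma eta_map_hom:
  assumes n: "n > 0" and N: "is_module n N" and f: "f \<in> Hom n M N"
  shows "eta_map n M f \<in> Hom n (eta n M) (eta n N)"
proof -
  interpret e: dmodule n "eta n M" using eta_module[OF n] by unfold_locales
  have *: "v \<in> und (eta n M) \<Longrightarrow> v \<in> und M" for v using eta_sub[OF n] by auto
  show ?thesis
    by (rule HomI) (auto simp: eta_map_def hom_eta[OF n N f] hom_add[OF f] hom_scl[OF f] hom_act[OF f]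
      e.add_in e.scl_in * dest: e.act_in)
qed

text \<open>The image of a module generated at vertex 0 is generated at vertex 0. The two sets of homomorphisms
  are equal, not just isomorphic, since \<open>\<eta>\<close> keeps the action.\<close>
lemma Hom_eta_right:
  assumes n: "n > 0" and gen: "eta n M = M" and N: "is_module n N"
  shows "Hom n M (eta n N) = Hom n M N"
proof -
  interpret N: dmodule n N using N by unfold_locales
  have "f v \<in> und (eta n N)" if "f \<in> Hom n M N" "v \<in> und M" for f v
    using hom_eta[OF n N that(1)] that(2) gen by simp
  moreover have "u \<in> und N" if "u \<in> und (eta n N)" for u using N.eta_sub[OF n] that by auto
  ultimately show ?thesis unfolding set_eq_iff Hom_def by auto
qed

end

lemma hom_dim_eta_right:
  "n > 0 \<Longrightarrow> is_module n M \<Longrightarrow> eta n M = M \<Longrightarrow> is_module n N \<Longrightarrow> hom_dim n M (eta n N) = hom_dim n M N"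
  unfolding hom_dim_def by (simp add: dmodule.Hom_eta_right dmodule.intro)

section \<open>Direct sums\<close>

lemma direct_sum2E:
  assumes "direct_sum2 n Z M N"
  obtains i1 i2 p1 p2 where "is_module n Z" "is_module n M" "is_module n N"
    "i1 \<in> Hom n M Z" "i2 \<in> Hom n N Z" "p1 \<in> Hom n Z M" "p2 \<in> Hom n Z N"
    "\<And>v. v \<in> und M \<Longrightarrow> p1 (i1 v) = v" "\<And>v. v \<in> und M \<Longrightarrow> p2 (i1 v) = 0"
    "\<And>v. v \<in> und N \<Longrightarrow> p2 (i2 v) = v" "\<And>v. v \<in> und N \<Longrightarrow> p1 (i2 v) = 0"
    "\<And>v. v \<in> und Z \<Longrightarrow> i1 (p1 v) + i2 (p2 v) = v"
proof -
  let ?X = "\<lambda>s. if s then M else N"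
  obtain inc prj where Z: "is_module n Z" "\<forall>s\<in>(UNIV :: bool set). is_module n (?X s)"
    and h: "\<forall>s\<in>UNIV. inc s \<in> Hom n (?X s) Z \<and> prj s \<in> Hom n Z (?X s)"
    and i: "\<forall>s\<in>UNIV. \<forall>t\<in>UNIV. \<forall>v\<in>und (?X s). prj t (inc s v) = (if t = s then v else 0)"
    and d: "\<forall>v\<in>und Z. (\<Sum>s\<in>UNIV. inc s (prj s v)) = v"
    using assms unfolding direct_sum2_def direct_sum_def by blast
  show ?thesis
    by (rule that[of "inc True" "inc False" "prj True" "prj False"])
      (use Z(1) Z(2)[rule_format, of True] Z(2)[rule_format, of False]
        h[rule_format, of True] h[rule_format, of False]
        i[rule_format, of True] i[rule_format, of _ False] i[rule_format, of _ True] i[rule_format, of False]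
        d in \<open>auto simp: UNIV_bool add.commute\<close>)
qed

lemma direct_sum2I:
  assumes "is_module n Z" "is_module n M" "is_module n N"
    "i1 \<in> Hom n M Z" "i2 \<in> Hom n N Z" "p1 \<in> Hom n Z M" "p2 \<in> Hom n Z N"
    "\<And>v. v \<in> und M \<Longrightarrow> p1 (i1 v) = v" "\<And>v. v \<in> und M \<Longrightarrow> p2 (i1 v) = 0"
    "\<And>v. v \<in> und N \<Longrightarrow> p2 (i2 v) = v" "\<And>v. v \<in> und N \<Longrightarrow> p1 (i2 v) = 0"
    "\<And>v. v \<in> und Z \<Longrightarrow> i1 (p1 v) + i2 (p2 v) = v"
  shows "direct_sum2 n Z M N"
  unfolding direct_sum2_def direct_sum_def
  by (intro conjI exI[of _ "\<lambda>s. if s then i1 else i2"] exI[of _ "\<lambda>s. if s then p1 else p2"])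
    (use assms in \<open>auto simp: UNIV_bool add.commute\<close>)

lemma eta_direct_sum2:
  assumes n: "n > 0" and "direct_sum2 n Z M N"
  shows "direct_sum2 n (eta n Z) (eta n M) (eta n N)"
  using assms(2)
proof (rule direct_sum2E)
  fix i1 i2 p1 p2
  assume m: "is_module n Z" "is_module n M" "is_module n N"
    and h: "i1 \<in> Hom n M Z" "i2 \<in> Hom n N Z" "p1 \<in> Hom n Z M" "p2 \<in> Hom n Z N"
    and e: "\<And>v. v \<in> und M \<Longrightarrow> p1 (i1 v) = v" "\<And>v. v \<in> und M \<Longrightarrow> p2 (i1 v) = 0"
      "\<And>v. v \<in> und N \<Longrightarrow> p2 (i2 v) = v" "\<And>v. v \<in> und N \<Longrightarrow> p1 (i2 v) = 0"
      "\<And>v. v \<in> und Z \<Longrightarrow> i1 (p1 v) + i2 (p2 v) = v"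
  interpret Z: dmodule n Z using m by unfold_locales
  interpret M: dmodule n M using m by unfold_locales
  interpret N: dmodule n N using m by unfold_locales
  have sub: "v \<in> und (eta n M) \<Longrightarrow> v \<in> und M" "v \<in> und (eta n N) \<Longrightarrow> v \<in> und N"
      "v \<in> und (eta n Z) \<Longrightarrow> v \<in> und Z" for v
    using Z.eta_sub[OF n] M.eta_sub[OF n] N.eta_sub[OF n] by auto
  note E = M.hom_eta[OF n m(1) h(1)] N.hom_eta[OF n m(1) h(2)]
    Z.hom_eta[OF n m(2) h(3)] Z.hom_eta[OF n m(3) h(4)]
  show "direct_sum2 n (eta n Z) (eta n M) (eta n N)"
    by (rule direct_sum2I[OF Z.eta_module[OF n] M.eta_module[OF n] N.eta_module[OF n]
          M.eta_map_hom[OF n m(1) h(1)] N.eta_map_hom[OF n m(1) h(2)]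
          Z.eta_map_hom[OF n m(2) h(3)] Z.eta_map_hom[OF n m(3) h(4)]])
      (simp_all add: eta_map_def E e sub)
qed

lemma eta_direct_sum:
  assumes n: "n > 0" and Z: "direct_sum n Z S X" and X: "\<And>s. s \<in> S \<Longrightarrow> eta n (X s) = X s"
  shows "eta n Z = Z"
proof -
  obtain inc prj where m: "finite S" "is_module n Z" "\<forall>s\<in>S. is_module n (X s)"
    and h: "\<forall>s\<in>S. inc s \<in> Hom n (X s) Z \<and> prj s \<in> Hom n Z (X s)"
    and d: "\<forall>v\<in>und Z. (\<Sum>s\<in>S. inc s (prj s v)) = v"
    using Z unfolding direct_sum_def by blast
  interpret Z: dmodule n Z using m by unfold_locales
  show ?thesis
  proof (rule Z.eta_eqI[OF n], rule)
    fix v assume v: "v \<in> und Z"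
    have "inc s (prj s v) \<in> und (eta n Z)" if s: "s \<in> S" for s
    proof -
      interpret X: dmodule n "X s" using m s by unfold_locales auto
      show ?thesis using X.hom_eta[OF n m(2), of "inc s" "prj s v"] h s X[OF s] v hom_in by metis
    qed
    then have "(\<Sum>s\<in>S. inc s (prj s v)) \<in> und (eta n Z)"
      using Z.eta_subspace by (intro free.subspace_sum) auto
    then show "v \<in> und (eta n Z)" using d v by simp
  qed
qed

lemma eta_summand:
  assumes n: "n > 0" and "direct_sum2 n Z M N" and Z: "eta n Z = Z"
  shows "eta n M = M"
  using assms(2)
proof (rule direct_sum2E)
  fix i1 i2 p1 p2
  assume m: "is_module n Z" "is_module n M" "is_module n N"
    and h: "i1 \<in> Hom n M Z" "i2 \<in> Hom n N Z" "p1 \<in> Hom n Z M" "p2 \<in> Hom n Z N"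
    and e: "\<And>v. v \<in> und M \<Longrightarrow> p1 (i1 v) = v"
  interpret Z: dmodule n Z using m by unfold_locales
  interpret M: dmodule n M using m by unfold_locales
  show "eta n M = M"
    by (rule M.eta_eqI[OF n]) (metis Z.hom_eta[OF n m(2) h(3)] Z e h(1) hom_in subsetI)
qed

lemma in_add_module: "in_add n T M \<Longrightarrow> is_module n M"
  unfolding in_add_def by (blast elim: direct_sum2E)

lemma eta_in_add: "n > 0 \<Longrightarrow> eta n T = T \<Longrightarrow> in_add n T M \<Longrightarrow> eta n M = M"
  unfolding in_add_def using eta_direct_sum eta_summand by metis

text \<open>The defining epimorphism onto \<open>M\<close> sends $e_0$ to a generator at vertex 0.\<close>
lemma eta_is_T:
  assumes n: "n > 0" and "is_T n i M"
  shows "eta n M = M"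
proof -
  define P0 where "P0 = (\<lambda>x. x \<star> vtx 0) ` path_alg n"
  have m: "is_module n M" using assms(2) by (simp add: is_T_def)
  have "\<exists>\<phi>. (\<forall>x\<in>path_alg n. \<forall>y\<in>P0. \<phi> (x \<star> y) = act M x (\<phi> y)) \<and> \<phi> ` P0 = und M"
    using assms(2) unfolding is_T_def Let_def P0_def[symmetric] by (elim conjE exE) (intro exI conjI)
  then obtain \<phi> where a: "\<forall>x\<in>path_alg n. \<forall>y\<in>P0. \<phi> (x \<star> y) = act M x (\<phi> y)"
    and s: "\<phi> ` P0 = und M" by (elim exE conjE)
  interpret dmodule n M using m by unfold_locales
  have e: "vtx 0 \<star> vtx 0 = vtx 0" by (simp add: vtx_def pmult_single)
  have 0: "vtx 0 \<in> P0" unfolding P0_def using vtx_in[OF n] e by (metis image_eqI)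
  then have \<phi>0: "\<phi> (vtx 0) \<in> und M" using s by auto
  have *: "act M (vtx 0) (\<phi> (vtx 0)) = \<phi> (vtx 0)" using bspec[OF bspec[OF a vtx_in[OF n]] 0] e by simp
  show ?thesis
  proof (rule eta_eqI[OF n], rule)
    fix v assume "v \<in> und M"
    then have "v \<in> \<phi> ` P0" using s by simp
    then obtain x where x: "x \<in> path_alg n" "v = \<phi> (x \<star> vtx 0)" by (auto simp: P0_def)
    then have "v = act M x (\<phi> (vtx 0))" using a 0 by blast
    then have "v = act M x (act M (vtx 0) (\<phi> (vtx 0)))" by (simp only: *)
    then show "v \<in> und (eta n M)" using eta_gen_in[OF x(1) \<phi>0] by simp
  qed
qed

lemma eta_in_add_TJ: "n > 0 \<Longrightarrow> in_add_TJ n J M \<Longrightarrow> eta n M = M"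
  unfolding in_add_TJ_def is_TJ_def
  by (blast intro: eta_in_add eta_direct_sum eta_is_T)

section \<open>Split sequences\<close>

lemma short_exact_split:
  assumes se: "short_exact n L f M g N" and s: "s \<in> Hom n N M" "\<And>v. v \<in> und N \<Longrightarrow> g (s v) = v"
  shows "direct_sum2 n M L N"
proof -
  have m: "is_module n L" "is_module n M" "is_module n N" and f: "f \<in> Hom n L M" and g: "g \<in> Hom n M N"
    and inj: "inj_on f (und L)" and ker: "f ` und L = {v \<in> und M. g v = 0}" and surj: "g ` und M = und N"
    using se by (auto simp: short_exact_def)
  interpret L: dmodule n L using m by unfold_locales
  interpret M: dmodule n M using m by unfold_locales
  interpret N: dmodule n N using m by unfold_locales
  define p where "p v = (if v \<in> und M then inv_into (und L) f (v - s (g v)) else 0)" for v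
  have im: "v - s (g v) \<in> f ` und L" if "v \<in> und M" for v
    using that s g ker by (auto simp: M.hom_diff[OF g] hom_in[OF g] hom_in[OF s(1)] M.diff_in)
  have pL: "p v \<in> und L" "f (p v) = v - s (g v)" if "v \<in> und M" for v
    using im[OF that] that by (auto simp: p_def inv_into_into f_inv_into_f)
  have eqI: "u = w" if "u \<in> und L" "w \<in> und L" "f u = f w" for u w
    using inj that by (auto simp: inj_on_def)
  have p: "p \<in> Hom n M L"
  proof (rule HomI)
    show "p v = 0" if "v \<notin> und M" for v using that by (simp add: p_def)
    show "p v \<in> und L" if "v \<in> und M" for v using pL that by simp
    show "p (v + w) = p v + p w" if "v \<in> und M" "w \<in> und M" for v w
      by (rule eqI) (use that in \<open>auto simp: pL L.add_in M.add_in hom_add[OF f] hom_add[OF g]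
        hom_add[OF s(1)] hom_in[OF g]\<close>)
    show "p (scl c v) = scl c (p v)" if "v \<in> und M" for c v
      by (rule eqI) (use that in \<open>auto simp: pL L.scl_in M.scl_in hom_scl[OF f] hom_scl[OF g]
        hom_scl[OF s(1)] hom_in[OF g] free.scale_right_diff_distrib\<close>)
    show "p (act M x v) = act L x (p v)" if "x \<in> path_alg n" "v \<in> und M" for x v
      by (rule eqI) (use that in \<open>auto simp: pL L.act_in M.act_in hom_act[OF f] hom_act[OF g]
        hom_act[OF s(1)] hom_in[OF g] hom_in[OF s(1)] M.act_diff\<close>)
  qed
  have gf: "g (f v) = 0" if "v \<in> und L" for v using ker that by auto
  show ?thesis
  proof (rule direct_sum2I[OF m(2,1,3) f s(1) p g])
    show "p (f v) = v" if "v \<in> und L" for v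
      by (rule eqI) (use that in \<open>auto simp: pL hom_in[OF f] gf hom_zero[OF s(1)]\<close>)
    show "p (s v) = 0" if "v \<in> und N" for v
      by (rule eqI) (use that in \<open>auto simp: pL hom_in[OF s(1)] s(2) hom_zero[OF f] L.zero_in\<close>)
    show "f (p v) + s (g v) = v" if "v \<in> und M" for v using that by (simp add: pL)
  qed (use gf s in auto)
qed

section \<open>Injectivity of the arrows $a_j$ on filtered modules\<close>

lemma free_dim_0: "U \<subseteq> free.span S \<Longrightarrow> finite S \<Longrightarrow> free.dim U = 0 \<Longrightarrow> U \<subseteq> {0}"
proof -
  assume a: "U \<subseteq> free.span S" "finite S" "free.dim U = 0"
  obtain B where B: "B \<subseteq> U" "free.independent B" "U \<subseteq> free.span B" "card B = free.dim U"
    using free.basis_exists by blast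
  then have "finite B" using free.independent_span_bound[OF a(2) B(2)] a(1) by auto
  then have "B = {}" using B a by simp
  then show ?thesis using B by simp
qed

lemma free_dim_1: "free.dim U = 1 \<Longrightarrow> u \<in> U \<Longrightarrow> u \<noteq> 0 \<Longrightarrow> U \<subseteq> free.span {u}"
proof -
  assume a: "free.dim U = 1" "u \<in> U" "u \<noteq> 0"
  obtain B where B: "B \<subseteq> U" "free.independent B" "U \<subseteq> free.span B" "card B = free.dim U"
    using free.basis_exists by blast
  then obtain b where b: "B = {b}" using a by (metis card_1_singletonE)
  then obtain c where c: "u = scl c b" using B a by (auto simp: free.span_singleton)
  then have "c \<noteq> 0" using a by auto
  then have "b = scl (inverse c) u" using c by simp
  then have "b \<in> free.span {u}" by (metis free.span_base free.span_scale singletonI)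
  then have "free.span B \<subseteq> free.span {u}" using b by (intro free.span_minimal) auto
  then show ?thesis using B by auto
qed

lemma F_Delta_module: "M \<in> F_Delta n \<Longrightarrow> is_module n M"
  by (induction rule: F_Delta.induct) (auto simp: short_exact_def)

lemma standard_a_injective:
  assumes n: "n > 0" and S: "standard n i S"
  shows "a_injective n S"
proof -
  have m: "is_module n S" using S by (simp add: standard_def)
  interpret dmodule n S using m by unfold_locales
  have "v = 0" if k: "1 \<le> k" "k < n" and v: "v \<in> und S" "act S (vtx k) v = v" "act S (arr_a k) v = 0" for k v
  proof (cases "k \<le> i - 1")
    have vk: "v \<in> act S (vtx k) ` und S" using v(1,2) by (metis imageI)
    have 0: "0 \<in> act S (vtx k) ` und S"
      using zero_in act_zero[OF vtx_in[OF k(2)]] by (metis imageI)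
    case True
    then have "inj_on (act S (arr_a k)) (act S (vtx k) ` und S)"
      using S k by (auto simp: standard_def bij_betw_def)
    moreover have "act S (arr_a k) 0 = 0" using k by (simp add: act_zero arr_a_in)
    ultimately show ?thesis using v(3) vk 0 unfolding inj_on_def by metis
  next
    have vk: "v \<in> act S (vtx k) ` und S" using v(1,2) by (metis imageI)
    case False
    then have d: "free.dim (act S (vtx k) ` und S) = 0" using S k by (auto simp: standard_def)
    have "act S (vtx k) ` und S \<subseteq> und S" using k by (auto simp: act_in vtx_in)
    then obtain B where "finite B" "act S (vtx k) ` und S \<subseteq> free.span B"
      using finite_dim_subset by blast
    then have "act S (vtx k) ` und S \<subseteq> {0}" using free_dim_0 d by blast
    then show ?thesis using vk by auto
  qed
  then show ?thesis unfolding a_injective_def by blast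
qed

text \<open>Standard modules have this property, and it is inherited by extensions.\<close>
lemma F_Delta_a_injective: "M \<in> F_Delta n \<Longrightarrow> n > 0 \<Longrightarrow> a_injective n M"
proof (induction rule: F_Delta.induct)
  case (zero M)
  then show ?case by (auto simp: a_injective_def)
next
  case (step N i S f M g)
  have m: "is_module n N" "is_module n M" "is_module n S" and f: "f \<in> Hom n N M" and g: "g \<in> Hom n M S"
    and inj: "inj_on f (und N)" and ker: "f ` und N = {v \<in> und M. g v = 0}"
    using step by (auto simp: short_exact_def)
  interpret N: dmodule n N using m by unfold_locales
  interpret M: dmodule n M using m by unfold_locales
  have "v = 0" if k: "1 \<le> k" "k < n" and v: "v \<in> und M" "act M (vtx k) v = v" "act M (arr_a k) v = 0" for k v
  proof -
    have "act S (vtx k) (g v) = g v" "act S (arr_a k) (g v) = 0" "g v \<in> und S"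
      using hom_act[OF g vtx_in[OF k(2)] v(1)] hom_act[OF g arr_a_in[OF k] v(1)]
        hom_in[OF g v(1)] hom_zero[OF g] v(2,3) by simp_all
    then have "g v = 0" using standard_a_injective[OF \<open>n > 0\<close> step(4)] k unfolding a_injective_def by blast
    then obtain u where u: "u \<in> und N" "v = f u" using ker v by blast
    have "f (act N (vtx k) u) = f u" "f (act N (arr_a k) u) = f 0"
      using hom_act[OF f vtx_in[OF k(2)] u(1)] hom_act[OF f arr_a_in[OF k] u(1)]
        hom_zero[OF f] v(2,3) u(2) by simp_all
    then have "act N (vtx k) u = u" "act N (arr_a k) u = 0"
      using inj u(1) N.act_in[OF vtx_in[OF k(2)] u(1)] N.act_in[OF arr_a_in[OF k] u(1)] N.zero_in
      unfolding inj_on_def by blast+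
    then have "u = 0" using step.IH[OF \<open>n > 0\<close>] u k unfolding a_injective_def by blast
    then show ?thesis using u hom_zero[OF f] by simp
  qed
  then show ?case unfolding a_injective_def by blast
qed

section \<open>Splitting of sequences that start with a module generated at vertex 0\<close>

context dmodule
begin

text \<open>A nontrivial path from 0 to \<open>i\<close> ends with $b_i$ or with $a_{i+1}$. In the second case, by induction
  on the length, its initial part already produces a value of $b_{i+1}$, and
  $a_{i+1}b_{i+1} = b_ia_i$.\<close>
lemma b_surjective:
  assumes gen: "eta n M = M" and i: "1 \<le> i" "i < n" and v: "v \<in> und M"
  shows "\<exists>l\<in>und M. act M (vtx i) v = act M (arr_b i) l"
proof -
  have n: "n > 0" using i by simp
  have from0: "\<exists>l\<in>und M. act M (single (0, w) 1) u = act M (arr_b k) l"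
    if "walk n 0 w k" "u \<in> und M" "1 \<le> k" for w k u
    using that(1,3)
  proof (induction w arbitrary: k)
    case Nil
    then show ?case by simp
  next
    case (Cons r w)
    let ?p = "act M (single (0, w) 1) u"
    show ?case
    proof (cases r)
      case (Barr k')
      then show ?thesis using Cons.prems that(2)
        by (intro bexI[of _ ?p]) (auto simp: act_path_b act_in single_in_path_alg)
    next
      case (Aarr k')
      then have k': "1 \<le> k'" "k' < n" "k = k' - 1" "walk n 0 w k'" using Cons.prems by auto
      obtain l where l: "l \<in> und M" "?p = act M (arr_b k') l" using Cons.IH[OF k'(4,1)] by blast
      have "act M (single (0, r # w) 1) u = act M (arr_a k') (act M (arr_b k') l)"
        using Aarr k' l that(2) by (simp add: act_path_a)
      also have "\<dots> = act M (arr_b k) (act M (arr_a k) l)"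
        using k' l(1) Cons.prems(2) act_ab_ba[of k' l] by simp
      finally show ?thesis
        using k' Cons.prems(2) l(1) by (intro bexI[of _ "act M (arr_a k) l"]) (simp_all add: act_in arr_a_in)
    qed
  qed
  have "v \<in> und (eta n M)" using v gen by simp
  with n show ?thesis
  proof (induction rule: eta_induct)
    case zero
    show ?case using i n by (intro bexI[of _ 0]) (auto simp: act_zero vtx_in arr_b_in zero_in)
  next
    case (add u w)
    then obtain l l' where l: "l \<in> und M" "l' \<in> und M" "act M (vtx i) u = act M (arr_b i) l"
      "act M (vtx i) w = act M (arr_b i) l'" by blast
    show ?case using add(1,2) l i
      by (intro bexI[of _ "l + l'"]) (simp_all add: act_add vtx_in arr_b_in add_in)
  next
    case (gen x u)
    have u: "act M (vtx 0) u \<in> und M" using gen n by (simp add: act_in vtx_in)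
    from gen(1) show ?case
    proof (induction rule: path_alg_linear_induct)
      case zero
      show ?case using u i n
        by (intro bexI[of _ 0]) (auto simp: act_zero act_zero_left vtx_in arr_b_in zero_in)
    next
      case (add x y)
      then obtain l l' where l: "l \<in> und M" "l' \<in> und M"
        "act M (vtx i) (act M x (act M (vtx 0) u)) = act M (arr_b i) l"
        "act M (vtx i) (act M y (act M (vtx 0) u)) = act M (arr_b i) l'" by blast
      show ?case using add(1,2) l i u
        by (intro bexI[of _ "l + l'"])
          (simp_all add: act_add act_add_left vtx_in arr_b_in add_in act_in)
    next
      case (scl c x)
      then obtain l where l: "l \<in> und M" 
        "act M (vtx i) (act M x (act M (vtx 0) u)) = act M (arr_b i) l" by blast
      show ?case using scl(1) l i u
        by (intro bexI[of _ "scl c l"])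
          (simp_all add: act_scl act_scl_left vtx_in arr_b_in scl_in act_in)
    next
      case (path i0 w j)
      have eq: "act M (vtx i) (act M (single (i0, w) 1) (act M (vtx 0) u)) =
          (if i = j \<and> i0 = 0 then act M (single (i0, w) 1) (act M (vtx 0) u) else 0)"
        using act_vtx_path[OF path i(2) u] act_path_vtx[OF path n gen(2)] act_zero[OF vtx_in[OF i(2)]]
        by auto
      show ?case
      proof (cases "i = j \<and> i0 = 0")
        case True
        then show ?thesis using from0[of w j "act M (vtx 0) u"] eq path u i by simp
      next
        case False
        then show ?thesis using eq act_zero[OF arr_b_in[OF i]] zero_in by (intro bexI[of _ 0]) auto
      qed
    qed
  qed
qed

end

lemma b_surjective_at_vertex:
  assumes "is_module n M" "eta n M = M" "1 \<le> i" "i < n" "v \<in> und M" "act M (vtx i) v = v"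
  obtains l where "l \<in> und M" "act M (vtx (i - 1)) l = l" "act M (arr_b i) l = v"
proof -
  interpret dmodule n M using assms by unfold_locales
  obtain l where l: "l \<in> und M" "v = act M (arr_b i) l" using b_surjective[OF assms(2-5)] assms(6) by auto
  show ?thesis
    by (rule that[of "act M (vtx (i - 1)) l"])
      (use l assms(3,4) in \<open>simp_all add: act_in vtx_in act_vtx_vtx act_b_vtx\<close>)
qed

text \<open>A nonzero vector at the top vertex \<open>i - 1\<close> is moved by the isomorphisms $a_j$ to nonzero vectors at
  all lower vertices, and these span the one-dimensional spaces there.\<close>
lemma standard_cyclic:
  assumes S: "standard n i S" and i: "1 \<le> i" "i \<le> n"
  obtains s where "s \<in> und S" "s \<noteq> 0" "act S (vtx (i - 1)) s = s"
    "\<And>u. u \<in> und S \<Longrightarrow> \<exists>x\<in>path_alg n. u = act S x s"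
proof -
  have m: "is_module n S" and dim: "\<And>j. j < n \<Longrightarrow> free.dim (act S (vtx j) ` und S) = (if j < i then 1 else 0)"
    and bij: "\<And>j. 1 \<le> j \<Longrightarrow> j \<le> i - 1 \<Longrightarrow>
      bij_betw (act S (arr_a j)) (act S (vtx j) ` und S) (act S (vtx (j - 1)) ` und S)"
    using S by (auto simp: standard_def)
  interpret dmodule n S using m by unfold_locales
  let ?E = "\<lambda>j. act S (vtx j) ` und S"
  have E: "u \<in> und S" "act S (vtx j) u = u" if "u \<in> ?E j" "j < n" for u j
    using that by (auto simp: act_in vtx_in act_vtx_vtx)
  have E0: "0 \<in> ?E j" if "j < n" for j
    using zero_in act_zero[OF vtx_in[OF that]] by (metis imageI)
  have "\<not> ?E (i - 1) \<subseteq> {0}"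
  proof
    assume "?E (i - 1) \<subseteq> {0}"
    then have "free.dim (?E (i - 1)) \<le> card ({} :: vec set)" by (intro free.dim_le_card) auto
    moreover have "i - 1 < n" using i by simp
    ultimately show False using dim[of "i - 1"] i by simp
  qed
  then obtain s where s: "s \<in> ?E (i - 1)" "s \<noteq> 0" by blast
  have sS: "s \<in> und S" "act S (vtx (i - 1)) s = s" using E[OF s(1)] i by auto
  have gen: "\<exists>x\<in>path_alg n. act S x s \<in> ?E j \<and> act S x s \<noteq> 0" if "j \<le> i - 1" for j
    using that
  proof (induction j rule: inc_induct)
    case base
    then show ?case using s sS i by (intro bexI[of _ "vtx (i - 1)"]) (auto simp: vtx_in)
  next
    case (step j)
    then obtain x where x: "x \<in> path_alg n" "act S x s \<in> ?E (Suc j)" "act S x s \<noteq> 0" by blast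
    have j: "1 \<le> Suc j" "Suc j \<le> i - 1" "Suc j < n" using step i by auto
    have "act S (arr_a (Suc j)) (act S x s) \<in> ?E j"
      using bij[OF j(1,2)] x(2) by (auto simp: bij_betw_def)
    moreover have "act S (arr_a (Suc j)) (act S x s) \<noteq> 0"
    proof
      assume "act S (arr_a (Suc j)) (act S x s) = 0"
      then have "act S (arr_a (Suc j)) (act S x s) = act S (arr_a (Suc j)) 0"
        using act_zero[OF arr_a_in[OF j(1,3)]] by simp
      then show False using bij[OF j(1,2)] x(2,3) E0[OF j(3)] unfolding bij_betw_def inj_on_def by blast
    qed
    ultimately show ?case using x j sS
      by (intro bexI[of _ "arr_a (Suc j) \<star> x"]) (simp_all add: act_mult arr_a_in pmult_in)
  qed
  have comp: "\<exists>x\<in>path_alg n. act S (vtx j) u = act S x s" if j: "j < n" and u: "u \<in> und S" for j u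
  proof (cases "j < i")
    case True
    then have "j \<le> i - 1" by simp
    from gen[OF this] obtain x where x: "x \<in> path_alg n" "act S x s \<in> ?E j" "act S x s \<noteq> 0" by blast
    have "free.dim (?E j) = 1" using dim[OF j] True by simp
    from free_dim_1[OF this x(2,3)] have "?E j \<subseteq> free.span {act S x s}" .
    then obtain c where "act S (vtx j) u = scl c (act S x s)" using u by (auto simp: free.span_singleton)
    then show ?thesis using x sS by (intro bexI[of _ "scl c x"]) (auto simp: act_scl_left path_alg_scl)
  next
    case False
    have "?E j \<subseteq> und S" using j by (auto simp: act_in vtx_in)
    then obtain B where "finite B" "?E j \<subseteq> free.span B" using finite_dim_subset by blast
    then have "?E j \<subseteq> {0}" using dim[OF j] False by (intro free_dim_0) auto
    then show ?thesis using u sS by (intro bexI[of _ 0]) (auto simp: act_zero_left path_alg_zero)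
  qed
  have "\<exists>x\<in>path_alg n. u = act S x s" if u: "u \<in> und S" for u
  proof -
    have "\<forall>j. \<exists>x. j < n \<longrightarrow> x \<in> path_alg n \<and> act S (vtx j) u = act S x s"
      using comp[OF _ u] by blast
    then obtain x where x: "\<And>j. j < n \<Longrightarrow> x j \<in> path_alg n \<and> act S (vtx j) u = act S (x j) s"
      by (elim choice[THEN exE]) blast
    have "u = (\<Sum>j<n. act S (x j) s)" using vertex_decomp[OF u] x by simp
    also have "\<dots> = act S (\<Sum>j<n. x j) s" using x sS by (subst act_sum_left) auto
    finally show ?thesis using x path_alg_sum[of "{..<n}" x n] by (intro bexI) auto
  qed
  then show ?thesis by (rule that[OF sS(1) s(2) sS(2)])
qed

text \<open>Lift a generator \<open>s\<close> of $S = \Delta_i$ to a vector \<open>v\<close> of \<open>M\<close> at vertex \<open>i - 1\<close>. Extending \<open>h\<close> means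
  choosing the image \<open>l\<close> of \<open>v\<close>. Since $b_i s = 0$, the vector $b_i v$ comes from some \<open>k0\<close> in \<open>K\<close>, and the
  only condition on \<open>l\<close> is \<open>b\<^sub>i l = h(k0)\<close>, which can be met because $b_i$ is onto in a module
  generated at vertex 0. If \<open>i = n\<close> there is no condition.\<close>
lemma extend_along_standard:
  assumes n: "n > 1" and se: "short_exact n K f M g S" and S: "standard n i S" and i: "1 \<le> i" "i \<le> n"
    and E: "is_module n E" "a_injective n E" "eta n E = E" and h: "h \<in> Hom n K E"
  shows "\<exists>h'\<in>Hom n M E. \<forall>k\<in>und K. h' (f k) = h k"
proof -
  have m: "is_module n K" "is_module n M" "is_module n S" and f: "f \<in> Hom n K M" and g: "g \<in> Hom n M S"
    and inj: "inj_on f (und K)" and ker: "f ` und K = {v \<in> und M. g v = 0}" and surj: "g ` und M = und S"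
    using se by (auto simp: short_exact_def)
  interpret K: dmodule n K using m by unfold_locales
  interpret M: dmodule n M using m by unfold_locales
  interpret S: dmodule n S using m by unfold_locales
  interpret E: dmodule n E using E by unfold_locales
  obtain s where s: "s \<in> und S" "s \<noteq> 0" "act S (vtx (i - 1)) s = s"
    "\<And>u. u \<in> und S \<Longrightarrow> \<exists>x\<in>path_alg n. u = act S x s" using standard_cyclic[OF S i] by blast
  have i1: "i - 1 < n" using i by simp
  obtain m' where m': "m' \<in> und M" "g m' = s" using s(1) surj by (metis imageE)
  define v where "v = act M (vtx (i - 1)) m'"
  have v: "v \<in> und M" "act M (vtx (i - 1)) v = v" "g v = s"
    using m' i1 s(3) by (auto simp: v_def M.act_in vtx_in M.act_vtx_vtx hom_act[OF g])
  have fK: "f k \<in> und M" "g (f k) = 0" if "k \<in> und K" for k using that ker by auto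
  have f_inj: "k = k'" if "k \<in> und K" "k' \<in> und K" "f k = f k'" for k k'
    using inj that by (auto simp: inj_on_def)
  \<comment> \<open>For \<open>i = n\<close> the value 0 serves for both, and the last property holds vacuously.\<close>
  obtain l k0 where l: "l \<in> und E" "act E (vtx (i - 1)) l = l" and k0: "k0 \<in> und K"
    and b: "i < n \<Longrightarrow> act M (arr_b i) v = f k0 \<and> act E (arr_b i) l = h k0"
  proof (cases "i < n")
    case True
    have "g (act M (arr_b i) v) = 0"
      using S True i v(1,3) by (simp add: hom_act[OF g] arr_b_in standard_def s(1))
    then obtain k0 where k0: "k0 \<in> und K" "act M (arr_b i) v = f k0"
      using ker M.act_in[OF arr_b_in[OF i(1) True] v(1)] by blast
    have "f (act K (vtx i) k0) = act M (vtx i) (act M (arr_b i) v)"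
      using k0 True by (simp add: hom_act[OF f] vtx_in)
    also have "\<dots> = f k0" using k0(2) M.act_vtx_b[OF i(1) True True v(1)] by simp
    finally have "act K (vtx i) k0 = k0" by (rule f_inj[OF K.act_in[OF vtx_in[OF True] k0(1)] k0(1)])
    then have "act E (vtx i) (h k0) = h k0" using hom_act[OF h vtx_in[OF True] k0(1)] by simp
    then obtain l where "l \<in> und E" "act E (vtx (i - 1)) l = l" "act E (arr_b i) l = h k0"
      using b_surjective_at_vertex[OF E(1,3) i(1) True hom_in[OF h k0(1)]] by blast
    then show ?thesis using that k0 by blast
  next
    case False
    show ?thesis by (rule that[of 0 0]) (use False i1 in \<open>auto simp: E.zero_in K.zero_in E.act_zero vtx_in\<close>)
  qed
  \<comment> \<open>The relation between \<open>v\<close> and \<open>l\<close> that makes the extension well defined: modulo \<open>K\<close>, only the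
    direct descent from \<open>i - 1\<close> to 0 acts on \<open>v\<close>, and the contributions of \<open>K\<close> correspond under \<open>h\<close>.\<close>
  have claim: "\<exists>c. \<exists>k\<in>und K. act M (vtx 0) (act M z v) = scl c (down M (i - 1) v) + f k \<and>
      act E (vtx 0) (act E z l) = scl c (down E (i - 1) l) + h k" if z: "z \<in> path_alg n" for z
    using z
  proof (induction rule: path_alg_linear_induct)
    case zero
    show ?case using n v l
      by (intro exI[of _ 0] bexI[of _ 0])
        (auto simp: M.act_zero_left E.act_zero_left M.act_zero E.act_zero vtx_in hom_zero[OF f] hom_zero[OF h] K.zero_in)
  next
    case (add x y)
    then obtain c k c' k' where
      1: "k \<in> und K" "act M (vtx 0) (act M x v) = scl c (down M (i - 1) v) + f k"
        "act E (vtx 0) (act E x l) = scl c (down E (i - 1) l) + h k" and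
      2: "k' \<in> und K" "act M (vtx 0) (act M y v) = scl c' (down M (i - 1) v) + f k'"
        "act E (vtx 0) (act E y l) = scl c' (down E (i - 1) l) + h k'" by blast
    show ?case using 1 2 add n v l
      by (intro exI[of _ "c + c'"] bexI[of _ "k + k'"])
        (simp_all add: M.act_add_left E.act_add_left M.act_add E.act_add vtx_in M.act_in E.act_in
          hom_add[OF f] hom_add[OF h] K.add_in free.scale_left_distrib)
  next
    case (scl d x)
    then obtain c k where
      1: "k \<in> und K" "act M (vtx 0) (act M x v) = scl c (down M (i - 1) v) + f k"
        "act E (vtx 0) (act E x l) = scl c (down E (i - 1) l) + h k" by blast
    show ?case using 1 scl n v l
      by (intro exI[of _ "d * c"] bexI[of _ "scl d k"])
        (simp_all add: M.act_scl_left E.act_scl_left M.act_scl E.act_scl vtx_in M.act_in E.act_in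
          hom_scl[OF f] hom_scl[OF h] K.scl_in free.scale_right_distrib)
  next
    case (path i0 w j)
    let ?p = "single (i0, w) (1 :: complex)"
    have p: "?p \<in> path_alg n" using path by (rule single_in_path_alg)
    have zero: ?case if "act M (vtx 0) (act M ?p v) = 0" "act E (vtx 0) (act E ?p l) = 0"
      using that by (intro exI[of _ 0] bexI[of _ 0]) (auto simp: hom_zero[OF f] hom_zero[OF h] K.zero_in)
    show ?case
    proof (cases "j = 0 \<and> i0 = i - 1")
      case False
      have "act M (vtx 0) (act M ?p v) = 0"
        using False M.act_vtx_path[OF path _ v(1), of 0] M.act_path_vtx[OF path i1 v(1), of 1] v(2) n
          M.act_zero[OF vtx_in, of 0] by (auto split: if_splits)
      moreover have "act E (vtx 0) (act E ?p l) = 0"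
        using False E.act_vtx_path[OF path _ l(1), of 0] E.act_path_vtx[OF path i1 l(1), of 1] l(2) n
          E.act_zero[OF vtx_in, of 0] by (auto split: if_splits)
      ultimately show ?thesis by (rule zero)
    next
      case True
      define r where "r = length (filter (\<lambda>r. \<exists>k. r = Barr k) w)"
      have 1: "act M (vtx 0) (act M ?p v) = (loop M ^^ r) (down M (i - 1) v)"
        using M.down_path[OF n path v(1)] True by (simp add: r_def)
      have 2: "act E (vtx 0) (act E ?p l) = (loop E ^^ r) (down E (i - 1) l)"
        using E.down_path[OF n path l(1)] True by (simp add: r_def)
      show ?thesis
      proof (cases r)
        \<comment> \<open>A path without arrows $b_k$ is the direct descent.\<close>
        case 0
        then show ?thesis using 1 2
          by (intro exI[of _ 1] bexI[of _ 0]) (auto simp: hom_zero[OF f] hom_zero[OF h] K.zero_in)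
      next
        \<comment> \<open>One loop turns the descent of \<open>v\<close> into the descent of $b_iv = f(k_0)$, which lies in the image of \<open>K\<close>.\<close>
        case (Suc r')
        have pow: "(loop M ^^ r') (f k) = f ((loop K ^^ r') k)" "(loop E ^^ r') (h k) = h ((loop K ^^ r') k)"
          if "k \<in> und K" for k
          by (induction r') (use that n in \<open>auto simp: K.hom_loop[OF f] K.hom_loop[OF h] K.loop_pow_in\<close>)
        have z: "(loop M ^^ r') 0 = 0" "(loop E ^^ r') 0 = 0"
          by (induction r') (auto simp: M.loop_zero[OF n] E.loop_zero[OF n])
        have sM: "act M (vtx 0) (act M ?p v) = (loop M ^^ r') (loop M (down M (i - 1) v))"
          and sE: "act E (vtx 0) (act E ?p l) = (loop E ^^ r') (loop E (down E (i - 1) l))"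
          using 1 2 Suc by (simp_all only: funpow_Suc_right o_apply)
        show ?thesis
        proof (cases "i < n")
          case True
          have "loop M (down M (i - 1) v) = f (down K i k0)"
            using M.loop_down[OF n i1 v(1)] b True i K.hom_down[OF f True k0] by simp
          moreover have "loop E (down E (i - 1) l) = h (down K i k0)"
            using E.loop_down[OF n i1 l(1)] b True i K.hom_down[OF h True k0] by simp
          ultimately have "act M (vtx 0) (act M ?p v) = f ((loop K ^^ r') (down K i k0))"
            "act E (vtx 0) (act E ?p l) = h ((loop K ^^ r') (down K i k0))"
            using sM sE pow K.down_in[OF True k0] by simp_all
          then show ?thesis using K.loop_pow_in[OF n K.down_in[OF True k0]]
            by (intro exI[of _ 0] bexI[of _ "(loop K ^^ r') (down K i k0)"]) auto
        next
          case False
          then show ?thesis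
            using sM sE z M.loop_down[OF n i1 v(1)] E.loop_down[OF n i1 l(1)] i by (intro zero) auto
        qed
      qed
    qed
  qed
  \<comment> \<open>The graph of the extension.\<close>
  define R where "R = {(f k + act M x v, h k + act E x l) | k x. k \<in> und K \<and> x \<in> path_alg n}"
  have RI: "(f k + act M x v, h k + act E x l) \<in> R" if "k \<in> und K" "x \<in> path_alg n" for k x
    using that by (auto simp: R_def)
  have "\<exists>h'\<in>Hom n M E. \<forall>(u, w)\<in>R. h' u = w"
  proof (rule M.hom_of_graph[OF E(1)])
    show "R \<subseteq> und M \<times> und E"
      using v l by (auto simp: R_def fK hom_in[OF h] M.act_in E.act_in M.add_in E.add_in)
    show "\<exists>w. (u, w) \<in> R" if u: "u \<in> und M" for u
    proof -
      obtain x where x: "x \<in> path_alg n" "g u = act S x s" using s(4) hom_in[OF g u] by blast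
      have "u - act M x v \<in> {v \<in> und M. g v = 0}"
        using u x v by (simp add: M.diff_in M.act_in M.hom_diff[OF g] hom_act[OF g])
      then obtain k where k: "k \<in> und K" "u - act M x v = f k" using ker by blast
      then have "u = f k + act M x v" by (simp add: algebra_simps)
      then show ?thesis using RI[OF k(1) x(1)] by blast
    qed
    show "(u + u', w + w') \<in> R" if "(u, w) \<in> R" "(u', w') \<in> R" for u w u' w'
    proof -
      obtain k x k' x' where k: "k \<in> und K" "k' \<in> und K" and x: "x \<in> path_alg n" "x' \<in> path_alg n"
        and e: "u = f k + act M x v" "w = h k + act E x l" "u' = f k' + act M x' v" "w' = h k' + act E x' l"
        using \<open>(u, w) \<in> R\<close> \<open>(u', w') \<in> R\<close> unfolding R_def by blast
      have "u + u' = f (k + k') + act M (x + x') v" "w + w' = h (k + k') + act E (x + x') l"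
        using k x v l e by (simp_all add: hom_add[OF f] hom_add[OF h] M.act_add_left E.act_add_left)
      then show ?thesis using RI[OF K.add_in[OF k] path_alg_add[OF x]] by simp
    qed
    show "(scl c u, scl c w) \<in> R" if "(u, w) \<in> R" for c u w
    proof -
      obtain k x where k: "k \<in> und K" and x: "x \<in> path_alg n"
        and e: "u = f k + act M x v" "w = h k + act E x l"
        using \<open>(u, w) \<in> R\<close> unfolding R_def by blast
      have "scl c u = f (scl c k) + act M (scl c x) v" "scl c w = h (scl c k) + act E (scl c x) l"
        using k x v l e by (simp_all add: hom_scl[OF f] hom_scl[OF h] M.act_scl_left E.act_scl_left
          free.scale_right_distrib)
      then show ?thesis using RI[OF K.scl_in[OF k] path_alg_scl[OF x]] by simp
    qed
    show "(act M y u, act E y w) \<in> R" if y: "y \<in> path_alg n" and uw: "(u, w) \<in> R" for y u w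
    proof -
      obtain k x where k: "k \<in> und K" and x: "x \<in> path_alg n"
        and e: "u = f k + act M x v" "w = h k + act E x l"
        using uw unfolding R_def by blast
      have "act M y u = f (act K y k) + act M (y \<star> x) v" "act E y w = h (act K y k) + act E (y \<star> x) l"
        using k x v l e y by (simp_all add: hom_act[OF f] hom_act[OF h] M.act_mult E.act_mult
          M.act_add E.act_add fK hom_in[OF h] M.act_in E.act_in)
      then show ?thesis using RI[OF K.act_in[OF y k] pmult_in[OF y x]] by simp
    qed
    show "w = 0" if uw: "(0, w) \<in> R" for w
    proof -
      obtain k x where k: "k \<in> und K" and x: "x \<in> path_alg n"
        and e: "f k + act M x v = 0" "w = h k + act E x l"
        using uw unfolding R_def by (auto dest: sym)
      show ?thesis
      proof (rule E.zero_if_no_vertex0_part[OF E(2)])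
        show "w \<in> und E" using e k x l by (simp add: hom_in[OF h] E.act_in E.add_in)
        fix y assume y: "y \<in> path_alg n"
        have n0: "n > 0" using n by simp
        define k' where "k' = act K (vtx 0) (act K y k)"
        have k': "k' \<in> und K" using k y n0 by (simp add: k'_def K.act_in vtx_in)
        have yx: "y \<star> x \<in> path_alg n" using y x by (rule pmult_in)
        obtain c k'' where c: "k'' \<in> und K"
          "act M (vtx 0) (act M (y \<star> x) v) = scl c (down M (i - 1) v) + f k''"
          "act E (vtx 0) (act E (y \<star> x) l) = scl c (down E (i - 1) l) + h k''" using claim[OF yx] by blast
        have "act M (vtx 0) (act M y (f k + act M x v)) = f k' + act M (vtx 0) (act M (y \<star> x) v)"
          using k x y v n0 by (simp add: k'_def hom_act[OF f] K.act_in vtx_in M.act_add M.act_in fK M.act_mult)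
        then have eq0: "f k' + (scl c (down M (i - 1) v) + f k'') = 0"
          unfolding e(1) c(2) using y n0 by (simp add: M.act_zero vtx_in)
        \<comment> \<open>Modulo \<open>K\<close> only the multiple of the descent survives, and the descent of \<open>s\<close> in \<open>S\<close> is not 0; so
          the coefficient \<open>c\<close> vanishes and only the part coming from \<open>K\<close> is left.\<close>
        have "scl c (down S (i - 1) s) = g (scl c (down M (i - 1) v))"
          using M.hom_down[OF g i1 v(1)] v(3) hom_scl[OF g M.down_in[OF i1 v(1)]] by simp
        also have "\<dots> = g (f k' + (scl c (down M (i - 1) v) + f k''))"
          using k' c(1) i1 v(1) by (simp add: hom_add[OF g] fK M.add_in M.scl_in M.down_in)
        also have "\<dots> = 0" using eq0 hom_zero[OF g] by simp
        finally have c0: "c = 0"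
          using S.down_injective[OF standard_a_injective[OF n0 S] i1 s(1,3)] s(2) by auto
        have "f (k' + k'') = 0" using eq0 c0 k' c(1) by (simp add: hom_add[OF f])
        then have k0: "k' + k'' = 0"
          using k' c(1) hom_zero[OF f] by (intro f_inj[OF K.add_in K.zero_in]) simp_all
        have "act E (vtx 0) (act E y w) = h k' + act E (vtx 0) (act E (y \<star> x) l)"
          using k x y l n0 e(2)
          by (simp add: k'_def hom_act[OF h] hom_in[OF h] K.act_in vtx_in E.act_add E.act_in E.act_mult)
        also have "\<dots> = h (k' + k'')" using c c0 k' by (simp add: hom_add[OF h])
        finally show "act E (vtx 0) (act E y w) = 0" using k0 hom_zero[OF h] by simp
      qed
    qed
  qed
  then obtain h' where h': "h' \<in> Hom n M E" and "\<forall>(u, w)\<in>R. h' u = w" by blast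
  then have h'R: "h' u = w" if "(u, w) \<in> R" for u w using that by auto
  have "h' (f k) = h k" if "k \<in> und K" for k
    using h'R[OF RI[OF that path_alg_zero]] v l by (simp add: M.act_zero_left E.act_zero_left)
  then show ?thesis using h' by blast
qed

text \<open>Induction along the filtration of \<open>N\<close>: extend first to the preimage in \<open>M\<close> of the submodule of \<open>N\<close>,
  then along the standard quotient.\<close>
lemma extend_along_F_Delta:
  assumes n: "n > 1" and N: "N \<in> F_Delta n" and se: "short_exact n L f M g N"
    and E: "is_module n E" "a_injective n E" "eta n E = E" and h: "h \<in> Hom n L E"
  shows "\<exists>h'\<in>Hom n M E. \<forall>k\<in>und L. h' (f k) = h k"
  using N se h
proof (induction arbitrary: L f M g h rule: F_Delta.induct)
  case (zero N)
  have m: "is_module n L" "is_module n M" and f: "f \<in> Hom n L M" and g: "g \<in> Hom n M N"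
    and inj: "inj_on f (und L)" and ker: "f ` und L = {v \<in> und M. g v = 0}"
    using zero by (auto simp: short_exact_def)
  interpret L: dmodule n L using m by unfold_locales
  interpret M: dmodule n M using m by unfold_locales
  note h = zero.prems(2)
  have "\<exists>h'\<in>Hom n M E. \<forall>(u, w)\<in>(\<lambda>k. (f k, h k)) ` und L. h' u = w"
  proof (rule M.hom_of_graph[OF E(1)])
    show "(\<lambda>k. (f k, h k)) ` und L \<subseteq> und M \<times> und E" by (auto simp: hom_in[OF f] hom_in[OF h])
    show "\<exists>w. (u, w) \<in> (\<lambda>k. (f k, h k)) ` und L" if "u \<in> und M" for u
    proof -
      have "g u = 0" using hom_in[OF g that] zero by auto
      then have "u \<in> f ` und L" using ker that by simp
      then show ?thesis by auto
    qed
    fix u w assume uw: "(u, w) \<in> (\<lambda>k. (f k, h k)) ` und L"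
    then obtain k where k: "k \<in> und L" "u = f k" "w = h k" by auto
    show "(scl c u, scl c w) \<in> (\<lambda>k. (f k, h k)) ` und L" for c
      using k by (intro image_eqI[of _ _ "scl c k"]) (auto simp: hom_scl[OF f] hom_scl[OF h] L.scl_in)
    show "(act M x u, act E x w) \<in> (\<lambda>k. (f k, h k)) ` und L" if "x \<in> path_alg n" for x
      using k that by (intro image_eqI[of _ _ "act L x k"]) (auto simp: hom_act[OF f] hom_act[OF h] L.act_in)
    fix u' w' assume "(u', w') \<in> (\<lambda>k. (f k, h k)) ` und L"
    then obtain k' where k': "k' \<in> und L" "u' = f k'" "w' = h k'" by auto
    show "(u + u', w + w') \<in> (\<lambda>k. (f k, h k)) ` und L"
      using k k' by (intro image_eqI[of _ _ "k + k'"]) (auto simp: hom_add[OF f] hom_add[OF h] L.add_in)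
  next
    fix w assume "(0, w) \<in> (\<lambda>k. (f k, h k)) ` und L"
    then obtain k where k: "k \<in> und L" "f k = f 0" "w = h k" using hom_zero[OF f] by auto
    then have "k = 0" using inj L.zero_in by (auto simp: inj_on_def)
    then show "w = 0" using k hom_zero[OF h] by simp
  qed
  then show ?case by auto
next
  case (step N' i S f1 N g1)
  have m: "is_module n L" "is_module n M" "is_module n N" and f: "f \<in> Hom n L M" and g: "g \<in> Hom n M N"
    and inj: "inj_on f (und L)" and ker: "f ` und L = {v \<in> und M. g v = 0}" and surj: "g ` und M = und N"
    using step.prems by (auto simp: short_exact_def)
  have m1: "is_module n N'" "is_module n S" and f1: "f1 \<in> Hom n N' N" and g1: "g1 \<in> Hom n N S"
    and inj1: "inj_on f1 (und N')" and ker1: "f1 ` und N' = {v \<in> und N. g1 v = 0}" and surj1: "g1 ` und N = und S"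
    using step.hyps by (auto simp: short_exact_def)
  interpret L: dmodule n L using m by unfold_locales
  interpret M: dmodule n M using m by unfold_locales
  interpret N: dmodule n N using m by unfold_locales
  interpret N': dmodule n N' using m1 by unfold_locales
  note h = step.prems(2)
  have gg: "(\<lambda>v. g1 (g v)) \<in> Hom n M S" using N.hom_comp[OF g g1] .
  define U where "U = {v \<in> und M. g1 (g v) = 0}"
  have UM: "v \<in> und M" if "v \<in> U" for v using that by (simp add: U_def)
  have subU: "free.subspace U"
    unfolding free.subspace_def
    by (auto simp: U_def M.zero_in M.add_in M.scl_in hom_zero[OF gg] hom_add[OF gg] hom_scl[OF gg])
  have actU: "act M x v \<in> U" if "x \<in> path_alg n" "v \<in> U" for x v
  proof -
    interpret S: dmodule n S using m1 by unfold_locales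
    show ?thesis using that by (auto simp: U_def M.act_in hom_act[OF gg] S.act_zero)
  qed
  define M' where "M' = M\<lparr>und := U\<rparr>"
  have M': "is_module n M'" "und M' = U" "act M' = act M"
    using M.submodule[OF subU _ actU] UM by (auto simp: M'_def)
  interpret M': dmodule n M' using M' by unfold_locales
  have gU: "g v \<in> f1 ` und N'" if "v \<in> U" for v
    using that ker1 hom_in[OF g] by (auto simp: U_def)
  define g' where "g' v = (if v \<in> U then inv_into (und N') f1 (g v) else 0)" for v
  have g'v: "g' v \<in> und N'" "f1 (g' v) = g v" if "v \<in> U" for v
    using gU[OF that] that by (auto simp: g'_def inv_into_into f_inv_into_f)
  have eqI: "u = w" if "u \<in> und N'" "w \<in> und N'" "f1 u = f1 w" for u w
    using inj1 that by (auto simp: inj_on_def)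
  have g': "g' \<in> Hom n M' N'"
  proof (rule HomI)
    show "g' v = 0" if "v \<notin> und M'" for v using that M' by (simp add: g'_def)
    show "g' v \<in> und N'" if "v \<in> und M'" for v using that g'v M' by simp
    show "g' (v + w) = g' v + g' w" if "v \<in> und M'" "w \<in> und M'" for v w
      by (rule eqI) (use that M'.add_in M' UM in \<open>auto simp: g'v N'.add_in hom_add[OF f1] hom_add[OF g]\<close>)
    show "g' (scl c v) = scl c (g' v)" if "v \<in> und M'" for c v
      by (rule eqI) (use that M'.scl_in M' UM in \<open>auto simp: g'v N'.scl_in hom_scl[OF f1] hom_scl[OF g]\<close>)
    show "g' (act M' x v) = act N' x (g' v)" if "x \<in> path_alg n" "v \<in> und M'" for x v
      by (rule eqI) (use that actU M' UM in \<open>auto simp: g'v N'.act_in hom_act[OF f1] hom_act[OF g]\<close>)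
  qed
  have fU: "f k \<in> U" "g (f k) = 0" if "k \<in> und L" for k
  proof -
    show "g (f k) = 0" using that ker by auto
    then show "f k \<in> U" using that by (simp add: U_def hom_in[OF f] hom_zero[OF g1])
  qed
  have f': "f \<in> Hom n L M'"
    using f fU M' by (auto simp: Hom_def)
  have "short_exact n L f M' g' N'"
    unfolding short_exact_def
  proof (intro conjI m m1 M' f' g' inj)
    show "f ` und L = {v \<in> und M'. g' v = 0}"
    proof -
      have "g' v = 0 \<longleftrightarrow> g v = 0" if "v \<in> U" for v
        using g'v[OF that] hom_zero[OF f1] eqI[of "g' v" 0] N'.zero_in by auto
      then have "{v \<in> und M'. g' v = 0} = {v \<in> U. g v = 0}" using M' by auto
      also have "\<dots> = f ` und L" unfolding ker U_def using hom_zero[OF g1] by auto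
      finally show ?thesis by simp
    qed
    show "g' ` und M' = und N'"
    proof
      show "und N' \<subseteq> g' ` und M'"
      proof
        fix w assume w: "w \<in> und N'"
        then have "f1 w \<in> und N" "g1 (f1 w) = 0" using ker1 by auto
        then have "f1 w \<in> g ` und M" using surj by simp
        then obtain v where v: "v \<in> und M" "g v = f1 w" by auto
        then have vU: "v \<in> U" using \<open>g1 (f1 w) = 0\<close> by (simp add: U_def)
        have "g' v = w" using g'v(2)[OF vU] v(2) by (intro eqI[OF g'v(1)[OF vU] w]) simp
        then show "w \<in> g' ` und M'" using vU M' by auto
      qed
    qed (use g'v M' in auto)
  qed
  from step.IH[OF this h] obtain h1 where h1: "h1 \<in> Hom n M' E" "\<forall>k\<in>und L. h1 (f k) = h k" by blast
  define incl where "incl v = (if v \<in> U then v else 0)" for v :: vec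
  have incl: "incl \<in> Hom n M' M"
    by (rule HomI) (use M' UM actU M'.add_in M'.scl_in in \<open>auto simp: incl_def\<close>)
  have "short_exact n M' incl M (\<lambda>v. g1 (g v)) S"
    unfolding short_exact_def
  proof (intro conjI m m1 M' incl gg)
    show "inj_on incl (und M')" using M' by (auto simp: inj_on_def incl_def)
    show "incl ` und M' = {v \<in> und M. g1 (g v) = 0}" using M' by (auto simp: incl_def U_def image_iff)
    show "(\<lambda>v. g1 (g v)) ` und M = und S" using surj surj1 by (metis image_image)
  qed
  from extend_along_standard[OF n this step.hyps(4,2,3) E h1(1)]
  obtain h' where h': "h' \<in> Hom n M E" "\<forall>k\<in>und M'. h' (incl k) = h1 k" by blast
  have "h' (f k) = h k" if "k \<in> und L" for k
    using h'(2) h1(2) that fU(1)[OF that] M' by (auto simp: incl_def)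
  then show ?case using h'(1) by blast
qed

text \<open>Extending the identity of \<open>L\<close> to \<open>M\<close> gives a retraction \<open>r\<close>, and \<open>v \<mapsto> v - f (r v)\<close> depends only on the
  class of \<open>v\<close> modulo \<open>L\<close>.\<close>
lemma generated_submodule_splits:
  assumes n: "n > 1" and N: "N \<in> F_Delta n" and se: "short_exact n L f M g N"
    and L: "a_injective n L" "eta n L = L"
  shows "\<exists>s\<in>Hom n N M. \<forall>v\<in>und N. g (s v) = v"
proof -
  have m: "is_module n L" "is_module n M" "is_module n N" and f: "f \<in> Hom n L M" and g: "g \<in> Hom n M N"
    and inj: "inj_on f (und L)" and ker: "f ` und L = {v \<in> und M. g v = 0}" and surj: "g ` und M = und N"
    using se by (auto simp: short_exact_def)
  interpret L: dmodule n L using m by unfold_locales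
  interpret M: dmodule n M using m by unfold_locales
  interpret N: dmodule n N using m by unfold_locales
  obtain r where r: "r \<in> Hom n M L" "\<And>k. k \<in> und L \<Longrightarrow> r (f k) = k"
    using extend_along_F_Delta[OF n N se m(1) L L.hom_id] by auto
  have gf: "g (f k) = 0" if "k \<in> und L" for k using ker that by auto
  let ?R = "(\<lambda>v. (g v, v - f (r v))) ` und M"
  have in_M: "v - f (r v) \<in> und M" if "v \<in> und M" for v
    using that by (simp add: M.diff_in hom_in[OF f] hom_in[OF r(1)])
  have "\<exists>s\<in>Hom n N M. \<forall>(u, w)\<in>?R. s u = w"
  proof (rule N.hom_of_graph[OF m(2)])
    show "?R \<subseteq> und N \<times> und M" by (auto simp: hom_in[OF g] in_M)
    show "\<exists>w. (u, w) \<in> ?R" if "u \<in> und N" for u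
      using that unfolding surj[symmetric] by auto
    fix u w assume uw: "(u, w) \<in> ?R"
    then obtain v where v: "v \<in> und M" "u = g v" "w = v - f (r v)" by auto
    show "(scl c u, scl c w) \<in> ?R" for c
      using v by (intro image_eqI[of _ _ "scl c v"])
        (auto simp: hom_scl[OF g] hom_scl[OF f] hom_scl[OF r(1)] hom_in[OF r(1)] M.scl_in
          free.scale_right_diff_distrib)
    show "(act N x u, act M x w) \<in> ?R" if "x \<in> path_alg n" for x
      using v that by (intro image_eqI[of _ _ "act M x v"])
        (auto simp: hom_act[OF g] hom_act[OF f] hom_act[OF r(1)] hom_in[OF r(1)] hom_in[OF f] M.act_in M.act_diff)
    fix u' w' assume "(u', w') \<in> ?R"
    then obtain v' where v': "v' \<in> und M" "u' = g v'" "w' = v' - f (r v')" by auto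
    show "(u + u', w + w') \<in> ?R"
      using v v' by (intro image_eqI[of _ _ "v + v'"])
        (auto simp: hom_add[OF g] hom_add[OF f] hom_add[OF r(1)] hom_in[OF r(1)] M.add_in)
  next
    fix w assume "(0, w) \<in> ?R"
    then obtain v where v: "v \<in> und M" "g v = 0" "w = v - f (r v)" by auto
    then have "v \<in> f ` und L" using ker by simp
    then show "w = 0" using v r(2) by auto
  qed
  then obtain s where s: "s \<in> Hom n N M" "\<And>v. v \<in> und M \<Longrightarrow> s (g v) = v - f (r v)" by auto
  have "g (s u) = u" if "u \<in> und N" for u
  proof -
    obtain v where v: "v \<in> und M" "u = g v" using \<open>u \<in> und N\<close> surj by auto
    then show ?thesis using s(2)[OF v(1)] M.hom_diff[OF g v(1), of "f (r v)"]
      by (simp add: hom_in[OF f] hom_in[OF r(1)] gf)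
  qed
  then show ?thesis using s(1) by blast
qed

section \<open>Modules with injective arrows $a_j$ are filtered by standard modules\<close>

context dmodule
begin

text \<open>The quotient of \<open>M\<close> by the kernel of a linear map is realized on the image of that map, where the
  action is transported along chosen preimages.\<close>
lemma quotient_module:
  assumes add: "\<And>v w. v \<in> und M \<Longrightarrow> w \<in> und M \<Longrightarrow> g (v + w) = g v + g w"
    and scl: "\<And>c v. v \<in> und M \<Longrightarrow> g (scl c v) = scl c (g v)"
    and out: "\<And>v. v \<notin> und M \<Longrightarrow> g v = 0"
    and ker: "\<And>x v. x \<in> path_alg n \<Longrightarrow> v \<in> und M \<Longrightarrow> g v = 0 \<Longrightarrow> g (act M x v) = 0"
  obtains S where "is_module n S" "und S = g ` und M" "g \<in> Hom n M S"
proof -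
  define S where "S = \<lparr>und = g ` und M, act = (\<lambda>x w. g (act M x (inv_into (und M) g w)))\<rparr>"
  have uS: "und S = g ` und M" by (simp add: S_def)
  have aS: "act S x (g v) = g (act M x v)" if "x \<in> path_alg n" "v \<in> und M" for x v
  proof -
    define u where "u = inv_into (und M) g (g v)"
    have u: "u \<in> und M" "g u = g v"
      using that(2) unfolding u_def by (auto intro: inv_into_into f_inv_into_f)
    have g_diff: "g (a - b) = g a - g b" if "a \<in> und M" "b \<in> und M" for a b
      using add[OF diff_in[OF that] that(2)] by (simp add: algebra_simps)
    have "g (act M x (u - v)) = 0" using ker that u by (simp add: diff_in g_diff)
    moreover have "g (act M x (u - v)) = g (act M x u) - g (act M x v)"
      using that u by (simp add: act_diff act_in g_diff)
    ultimately have "g (act M x u) = g (act M x v)" by simp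
    then show ?thesis by (simp add: S_def u_def)
  qed
  have sub_S: "free.subspace (g ` und M)"
    unfolding free.subspace_def
  proof (intro conjI ballI allI)
    have "g 0 = 0" using scl[of 0 0] zero_in by simp
    then show "0 \<in> g ` und M" using zero_in by (metis imageI)
  next
    fix u w assume "u \<in> g ` und M" "w \<in> g ` und M"
    then obtain u' w' where "u' \<in> und M" "w' \<in> und M" "u = g u'" "w = g w'" by blast
    then show "u + w \<in> g ` und M" using add[of u' w'] add_in[of u' w'] by (metis imageI)
  next
    fix c u assume "u \<in> g ` und M"
    then obtain u' where "u' \<in> und M" "u = g u'" by blast
    then show "scl c u \<in> g ` und M" using scl[of u' c] scl_in[of u' c] by (metis imageI)
  qed
  have span_S: "\<exists>F. finite F \<and> free.span F = g ` und M"
  proof -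
    obtain B where B: "finite B" "free.span B = und M" using fin by blast
    have "free.span (g ` B) = g ` und M"
    proof
      have BM: "B \<subseteq> und M" using B free.span_superset by auto
      then show "free.span (g ` B) \<subseteq> g ` und M" by (intro free.span_minimal sub_S) auto
      have "free.subspace {v \<in> und M. g v \<in> free.span (g ` B)}"
        unfolding free.subspace_def
        using zero_in scl[of 0 0] by (auto simp: add_in scl_in add scl intro: free.span_add free.span_scale free.span_zero)
      moreover have "B \<subseteq> {v \<in> und M. g v \<in> free.span (g ` B)}" using BM by (auto intro: free.span_base)
      ultimately have "free.span B \<subseteq> {v \<in> und M. g v \<in> free.span (g ` B)}"
        by (intro free.span_minimal)
      then show "g ` und M \<subseteq> free.span (g ` B)" using B by auto
    qed
    then show ?thesis using B by blast
  qed
  have "is_module n S"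
    unfolding is_module_def uS
  proof (intro conjI sub_S span_S ballI allI)
    fix v assume "v \<in> g ` und M"
    then obtain v' where v: "v' \<in> und M" "v = g v'" by blast
    show "act S (path_one n) v = v" using v by (simp add: aS path_one_in act_one)
    show "act S r v = 0" if "r \<in> rel_ideal n" for r
    proof -
      have "inv_into (und M) g v \<in> und M" using v by (auto intro: inv_into_into)
      then have "act M r (inv_into (und M) g v) = 0" using act_rel_ideal that by blast
      then show ?thesis using scl[of 0 0] zero_in by (simp add: S_def)
    qed
    fix x assume x: "x \<in> path_alg n"
    show "act S x v \<in> g ` und M" using v x by (simp add: aS act_in)
    fix c
    show "act S (scl c x) v = scl c (act S x v)"
      using v x by (simp add: aS path_alg_scl act_scl_left scl act_in)
    show "act S x (scl c v) = scl c (act S x v)"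
      using v x by (simp add: aS act_scl scl_in act_in flip: scl)
  next
    fix x v w assume x: "x \<in> path_alg n" and "v \<in> g ` und M" "w \<in> g ` und M"
    then obtain v' w' where v: "v' \<in> und M" "v = g v'" "w' \<in> und M" "w = g w'" by blast
    show "act S x (v + w) = act S x v + act S x w"
      using v x by (simp add: aS act_add add_in act_in flip: add)
  next
    fix x y v assume x: "x \<in> path_alg n" "y \<in> path_alg n" and "v \<in> g ` und M"
    then obtain v' where v: "v' \<in> und M" "v = g v'" by blast
    show "act S (x + y) v = act S x v + act S y v"
      using v x by (simp add: aS path_alg_add act_add_left add act_in)
    show "act S (x \<star> y) v = act S x (act S y v)"
      using v x by (simp add: aS pmult_in act_mult act_in)
  qed
  moreover have "g \<in> Hom n M S"
    by (rule HomI) (auto simp: out add scl aS uS)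
  ultimately show ?thesis using that uS by blast
qed

lemma loop_image_subspace: "n > 1 \<Longrightarrow> free.subspace (loop M ` und M)"
  unfolding free.subspace_def
proof (intro conjI ballI allI)
  assume n: "n > 1"
  show "0 \<in> loop M ` und M" using loop_zero[OF n] zero_in by (metis imageI)
next
  fix u w assume n: "n > 1" and "u \<in> loop M ` und M" "w \<in> loop M ` und M"
  then obtain u' w' where u: "u' \<in> und M" "w' \<in> und M" "u = loop M u'" "w = loop M w'" by blast
  then show "u + w \<in> loop M ` und M" using loop_add[OF n u(1,2)] add_in[OF u(1,2)] by (metis imageI)
next
  fix c u assume n: "n > 1" and "u \<in> loop M ` und M"
  then obtain u' where u: "u' \<in> und M" "u = loop M u'" by blast
  then show "scl c u \<in> loop M ` und M" using loop_scl[OF n u(1)] scl_in[OF u(1)] by (metis imageI)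
qed

lemma loop_nilpotent:
  assumes "n > 1" "v \<in> und M" "j < n" "n \<le> j + k"
  shows "(loop M ^^ k) (down M j v) = 0"
  using assms(2-)
proof (induction k arbitrary: j v)
  case 0
  then show ?case by simp
next
  case (Suc k)
  have z: "(loop M ^^ k) 0 = 0" by (induction k) (auto simp: loop_zero[OF assms(1)])
  have "(loop M ^^ Suc k) (down M j v) = (loop M ^^ k) (loop M (down M j v))"
    by (simp only: funpow_Suc_right o_apply)
  also have "\<dots> = 0"
  proof (cases "Suc j < n")
    case True
    then show ?thesis
      using Suc.IH[of "act M (arr_b (Suc j)) v" "Suc j"] Suc.prems
      by (simp add: loop_down[OF assms(1)] act_in arr_b_in del: down.simps)
  next
    case False
    then show ?thesis using Suc.prems z by (simp add: loop_down[OF assms(1)])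
  qed
  finally show ?case .
qed

lemma down_factor:
  assumes "j \<le> i" "i < n" "v \<in> und M"
  shows "\<exists>w\<in>und M. down M i v = down M j w"
  using assms
proof (induction i arbitrary: v)
  case 0
  then show ?case by auto
next
  case (Suc i)
  show ?case
  proof (cases "j = Suc i")
    case False
    then have "\<exists>w\<in>und M. down M i (act M (arr_a (Suc i)) v) = down M j w"
      using Suc.prems by (intro Suc.IH) (auto simp: act_in arr_a_in)
    then show ?thesis by simp
  qed (use Suc.prems in auto)
qed

text \<open>A homomorphism from \<open>M\<close> to $\Delta_{i+1}$ is the same as a linear functional on the part of \<open>M\<close> at
  vertex 0 that vanishes on the image of the loop and on the descent of the part at vertex \<open>i + 1\<close>;
  it is onto if the functional does not vanish on the descent of the part at vertex \<open>i\<close>. Take for \<open>i\<close>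
  the largest vertex whose descent is not contained in the image of the loop. It exists because the
  loop is nilpotent, so that its image is a proper subspace at vertex 0.\<close>
lemma standard_quotient:
  assumes n: "n > 1" and inj: "a_injective n M" and nz: "und M \<noteq> {0}"
  obtains i S g where "1 \<le> i" "i \<le> n" "standard n i S" "g \<in> Hom n M S" "g ` und M = und S" "und S \<noteq> {0}"
proof -
  let ?W = "loop M ` und M"
  let ?P = "\<lambda>i. i < n \<and> (\<exists>v\<in>und M. down M i v \<notin> ?W)"
  have W_down: "loop M u \<in> ?W" if "u \<in> und M" for u using that by auto
  have "?P 0"
  proof (rule ccontr)
    assume "\<not> ?P 0"
    then have a: "\<exists>w\<in>und M. down M 0 v = loop M w" if "v \<in> und M" for v using n that by auto
    have "\<exists>w\<in>und M. down M 0 v = (loop M ^^ k) (down M 0 w)" if v: "v \<in> und M" for v k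
    proof (induction k)
      case 0
      then show ?case using v by auto
    next
      case (Suc k)
      then obtain w where w: "w \<in> und M" "down M 0 v = (loop M ^^ k) (down M 0 w)" by blast
      obtain u where u: "u \<in> und M" "down M 0 w = loop M u" using a[OF w(1)] by blast
      have "loop M u = loop M (down M 0 u)"
        using n u(1) by (simp add: loop_def act_b_vtx)
      then have "down M 0 v = (loop M ^^ Suc k) (down M 0 u)"
        using w u by (simp only: funpow_Suc_right o_apply)
      then show ?case using u(1) by blast
    qed
    note iter = this
    have 0: "act M (vtx 0) v = 0" if v: "v \<in> und M" for v
    proof -
      obtain w where "w \<in> und M" "down M 0 v = (loop M ^^ n) (down M 0 w)" using iter[OF v] by blast
      then show ?thesis using loop_nilpotent[OF n, of w 0 n] n by simp
    qed
    have "und M \<subseteq> {0}"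
      using zero_if_no_vertex0_part[OF inj] 0 act_in by blast
    then show False using nz zero_in by blast
  qed
  then obtain i where i: "?P i" "\<And>j. ?P j \<Longrightarrow> j \<le> i"
    using Nat.ex_has_greatest_nat[of ?P 0 n] by (metis (no_types, lifting) less_imp_le_nat)
  then obtain v0 where v0: "v0 \<in> und M" "down M i v0 \<notin> ?W" and iltn: "i < n" by blast
  have above: "down M (Suc i) v \<in> ?W" if "v \<in> und M" "Suc i < n" for v
    using i(2)[of "Suc i"] that by (metis Suc_n_not_le_n)
  \<comment> \<open>A functional that vanishes on the image of the loop and takes the value 1 on \<open>down M i v0\<close>.\<close>
  obtain B where B: "B \<subseteq> ?W" "free.independent B" "?W \<subseteq> free.span B"
    using free.maximal_independent_subset by blast
  have "free.span B \<subseteq> ?W" using B loop_image_subspace[OF n] by (intro free.span_minimal)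
  then have indep: "free.independent (insert (down M i v0) B)"
    using v0 B by (intro free.independent_insertI) auto
  obtain \<phi> where \<phi>: "Vector_Spaces.linear scl scl \<phi>"
    "\<And>x. x \<in> insert (down M i v0) B \<Longrightarrow>
      \<phi> x = (if x = down M i v0 then single (0::nat) 1 else 0)"
    using free_pair.linear_independent_extend[OF indep,
        of "\<lambda>x. if x = down M i v0 then single (0::nat) 1 else 0"] by blast
  interpret \<phi>: Vector_Spaces.linear scl scl \<phi> by (rule \<phi>(1))
  have \<phi>W: "\<phi> w = 0" if "w \<in> ?W" for w
  proof -
    have "free.subspace {u. \<phi> u = 0}"
      by (auto simp: free.subspace_def \<phi>.add \<phi>.scale \<phi>.zero)
    moreover have "B \<subseteq> {u. \<phi> u = 0}" using \<phi>(2) B(1) v0(2) by auto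
    ultimately have "free.span B \<subseteq> {u. \<phi> u = 0}" by (intro free.span_minimal)
    then show ?thesis using B(3) that by blast
  qed
  define \<psi> where "\<psi> u = lookup (\<phi> u) 0" for u
  have \<psi>: "\<psi> (u + w) = \<psi> u + \<psi> w" "\<psi> (scl c u) = c * \<psi> u" for u w c
    by (simp_all add: \<psi>_def \<phi>.add \<phi>.scale lookup_add lookup_scl)
  have \<psi>W: "\<psi> w = 0" if "w \<in> ?W" for w using \<phi>W[OF that] by (simp add: \<psi>_def)
  have \<psi>0: "\<psi> 0 = 0" by (simp add: \<psi>_def \<phi>.zero)
  have \<psi>v0: "\<psi> (down M i v0) = 1" using \<phi>(2)[of "down M i v0"] by (simp add: \<psi>_def)
  \<comment> \<open>Realize the standard module on the coordinates \<open>0, \<dots>, i\<close>, one for each of its vertices.\<close>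
  define g where "g v = (if v \<in> und M then \<Sum>j\<le>i. single j (\<psi> (down M j v)) else 0)" for v
  have lg: "lookup (g v) j = (if j \<le> i then \<psi> (down M j v) else 0)" if "v \<in> und M" for v j
    using that by (auto simp: g_def lookup_sum lookup_single when_def)
  have jn: "j < n" if "j \<le> i" for j using that iltn by simp
  have g_add: "g (v + w) = g v + g w" if "v \<in> und M" "w \<in> und M" for v w
    by (rule poly_mapping_eqI) (use that in \<open>simp add: lg add_in lookup_add down_add jn \<psi>\<close>)
  have g_scl: "g (scl c v) = scl c (g v)" if "v \<in> und M" for c v
    by (rule poly_mapping_eqI) (use that in \<open>simp add: lg scl_in lookup_scl down_scl jn \<psi>\<close>)
  have g_vtx: "lookup (g (act M (vtx k) v)) j = (if j = k then lookup (g v) k else 0)"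
    if "k < n" "v \<in> und M" for k v j
    using that by (auto simp: lg act_in vtx_in down_vtx jn \<psi>0)
  have g_a: "lookup (g (act M (arr_a k) v)) j = (if Suc j = k then lookup (g v) k else 0)"
    if "1 \<le> k" "k < n" "v \<in> und M" for k v j
  proof (cases "j \<le> i \<and> k = Suc j")
    case True
    then have "lookup (g (act M (arr_a k) v)) j = \<psi> (down M k v)"
      using that by (simp add: lg act_in arr_a_in down_a jn del: down.simps)
    moreover have "\<psi> (down M k v) = 0" if "\<not> k \<le> i"
      using that True above[OF \<open>v \<in> und M\<close>] \<psi>W \<open>k < n\<close> by (metis le_antisym not_less_eq_eq)
    ultimately show ?thesis using True that by (auto simp: lg simp del: down.simps)
  next
    case False
    then have "lookup (g (act M (arr_a k) v)) j = 0"
      using that by (auto simp: lg act_in arr_a_in down_a jn \<psi>0 simp del: down.simps)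
    then show ?thesis using False that by (auto simp: lg simp del: down.simps)
  qed
  have g_b: "g (act M (arr_b k) v) = 0" if "1 \<le> k" "k < n" "v \<in> und M" for k v
  proof (rule poly_mapping_eqI)
    fix j
    have "\<psi> (down M k (act M (arr_b k) v)) = 0"
    proof -
      have "loop M (down M (k - 1) v) = down M k (act M (arr_b k) v)"
        using that by (subst loop_down[OF n]) (auto simp del: down.simps)
      then have "down M k (act M (arr_b k) v) \<in> ?W" using W_down[OF down_in[of "k - 1" v]] that by simp
      then show ?thesis by (rule \<psi>W)
    qed
    then show "lookup (g (act M (arr_b k) v)) j = lookup 0 j"
      using that by (cases "j = k") (auto simp: lg act_in arr_b_in down_b_other jn \<psi>0 simp del: down.simps)
  qed
  have ker: "g (act M x v) = 0" if x: "x \<in> path_alg n" and v: "v \<in> und M" "g v = 0" for x v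
  proof -
    let ?U = "{v \<in> und M. g v = 0}"
    have "g 0 = 0" using g_scl[OF zero_in, of 0] by simp
    then have "free.subspace ?U"
      by (auto simp: free.subspace_def zero_in add_in scl_in g_add g_scl)
    then have "act M x v \<in> ?U"
    proof (rule closed_if_generators[OF _ _ _ _ _ x])
      show "act M (vtx k) u \<in> ?U" if "k < n" "u \<in> ?U" for k u
        using that by (auto simp: act_in vtx_in poly_mapping_eq_iff fun_eq_iff g_vtx)
      show "act M (arr_a k) u \<in> ?U" if "1 \<le> k" "k < n" "u \<in> ?U" for k u
        using that by (auto simp: act_in arr_a_in poly_mapping_eq_iff fun_eq_iff g_a)
      show "act M (arr_b k) u \<in> ?U" if "1 \<le> k" "k < n" "u \<in> ?U" for k u
        using that by (auto simp: act_in arr_b_in g_b)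
    qed (use v in auto)
    then show ?thesis by simp
  qed
  obtain S where S: "is_module n S" "und S = g ` und M" "g \<in> Hom n M S"
  proof -
    have "g v = 0" if "v \<notin> und M" for v using that by (simp add: g_def)
    then show ?thesis using quotient_module[OF g_add g_scl _ ker] that by blast
  qed
  interpret S: dmodule n S using S by unfold_locales
  have comp: "act S (vtx j) ` und S = coords (if j \<le> i then {j} else {})" if j: "j < n" for j
  proof
    show "act S (vtx j) ` und S \<subseteq> coords (if j \<le> i then {j} else {})"
    proof
      fix w assume "w \<in> act S (vtx j) ` und S"
      then obtain v where v: "v \<in> und M" "w = g (act M (vtx j) v)"
        using S j by (auto simp: hom_act[OF S(3)] vtx_in)
      show "w \<in> coords (if j \<le> i then {j} else {})"
      proof (cases "j \<le> i")
        case True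
        then show ?thesis using v j by (auto simp: coords_def in_keys_iff g_vtx split: if_splits)
      next
        case False
        then have "w = 0" using v j by (intro poly_mapping_eqI) (simp add: g_vtx lg)
        then show ?thesis by (simp add: coords_def)
      qed
    qed
    show "coords (if j \<le> i then {j} else {}) \<subseteq> act S (vtx j) ` und S"
    proof (cases "j \<le> i")
      case True
      show ?thesis
      proof
        fix w :: vec assume "w \<in> coords (if j \<le> i then {j} else {})"
        then have w: "lookup w k = (if k = j then lookup w j else 0)" for k
          using True by (auto simp: coords_def in_keys_iff subset_iff)
        obtain v1 where v1: "v1 \<in> und M" "down M i v0 = down M j v1"
          using down_factor[OF True iltn v0(1)] by blast
        let ?u = "scl (lookup w j) v1"
        have u: "?u \<in> und M" using v1 by (simp add: scl_in)
        have "w = g (act M (vtx j) ?u)"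
          by (rule poly_mapping_eqI)
            (subst w, use j u v1 True \<psi>v0 in \<open>auto simp: g_vtx lg down_scl \<psi>\<close>)
        also have "\<dots> = act S (vtx j) (g ?u)" using u j by (simp add: hom_act[OF S(3)] vtx_in)
        finally show "w \<in> act S (vtx j) ` und S" using u S(2) by blast
      qed
    next
      case False
      then have "coords (if j \<le> i then {j} else {}) = {0}" by (auto simp: coords_def)
      moreover have "0 \<in> act S (vtx j) ` und S"
        using S.act_zero[OF vtx_in[OF j]] S.zero_in by (metis imageI)
      ultimately show ?thesis by simp
    qed
  qed
  have a_S: "act S (arr_a j) w = single (j - 1) (lookup w j)"
    if j: "1 \<le> j" "j < n" and w: "w \<in> und S" for j w
  proof -
    obtain v where v: "v \<in> und M" "w = g v" using w S(2) by auto
    show ?thesis using v j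
      by (intro poly_mapping_eqI)
        (auto simp: hom_act[OF S(3), symmetric] arr_a_in g_a lookup_single when_def)
  qed
  have "standard n (Suc i) S"
    unfolding standard_def
  proof (intro conjI S(1) allI impI ballI)
    show "free.dim (act S (vtx j) ` und S) = (if j < Suc i then 1 else 0)" if "j < n" for j
      using comp[OF that] dim_coords[of "if j \<le> i then {j} else {}"] by auto
  next
    fix j assume j: "1 \<le> j \<and> j \<le> Suc i - 1"
    have jn': "j < n" "j - 1 < n" using j iltn by auto
    have c: "act S (vtx j) ` und S = coords {j}" "act S (vtx (j - 1)) ` und S = coords {j - 1}"
      using comp[OF jn'(1)] comp[OF jn'(2)] j by auto
    have sub: "coords {j} \<subseteq> und S" using c(1) jn' by (metis S.act_in image_subsetI vtx_in)
    have single: "w = single k (lookup w k)" if "w \<in> coords {k}" for w :: vec and k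
      using that sum_singles[of "{k}" w] by (simp add: coords_def)
    show "bij_betw (act S (arr_a j)) (act S (vtx j) ` und S) (act S (vtx (j - 1)) ` und S)"
      unfolding c
    proof (rule bij_betwI[where g = "\<lambda>w. single j (lookup w (j - 1))"])
      show "act S (arr_a j) \<in> coords {j} \<rightarrow> coords {j - 1}"
        using sub j jn' by (auto simp: a_S subset_iff) (auto simp: coords_def)
      show "(\<lambda>w. single j (lookup w (j - 1))) \<in> coords {j - 1} \<rightarrow> coords {j}"
        by (auto simp: coords_def)
      show "single j (lookup (act S (arr_a j) w) (j - 1)) = w"
        if "w \<in> coords {j}" for w
      proof -
        have "w \<in> und S" using that sub by blast
        then show ?thesis using single[OF that] j jn' by (simp add: a_S)
      qed
      show "act S (arr_a j) (single j (lookup w (j - 1))) = w"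
        if "w \<in> coords {j - 1}" for w
      proof -
        have "single j (lookup w (j - 1)) \<in> und S"
          by (rule subsetD[OF sub]) (simp add: coords_def)
        then show ?thesis using single[OF that] j jn' by (simp add: a_S)
      qed
    qed
  next
    fix j w assume "1 \<le> j \<and> j \<le> n - 1" and "w \<in> und S"
    then obtain v where v: "v \<in> und M" "w = g v" "1 \<le> j" "j < n" using S(2) n by auto
    then show "act S (arr_b j) w = 0"
      by (simp add: hom_act[OF S(3), symmetric] arr_b_in g_b)
  qed
  moreover have "und S \<noteq> {0}"
  proof
    assume "und S = {0}"
    then have "g v0 = 0" using S(2) v0(1) by auto
    then show False using lg[OF v0(1), of i] \<psi>v0 by simp
  qed
  ultimately show ?thesis using that[of "Suc i" S g] S iltn by auto
qed

end

text \<open>Submodules inherit the injectivity of the arrows $a_j$, so standard quotients can be split off one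
  by one until the module is exhausted.\<close>
lemma F_Delta_if_a_injective:
  assumes "n > 1" "is_module n M" "a_injective n M"
  shows "M \<in> F_Delta n"
  using assms(2,3)
proof (induction "free.dim (und M)" arbitrary: M rule: less_induct)
  case (less M)
  interpret dmodule n M using less by unfold_locales
  show ?case
  proof (cases "und M = {0}")
    case True
    then show ?thesis using less.prems by (intro F_Delta.zero)
  next
    case False
    obtain i S g where i: "1 \<le> i" "i \<le> n" and S: "standard n i S" and g: "g \<in> Hom n M S"
      and surj: "g ` und M = und S" and nz: "und S \<noteq> {0}"
      using standard_quotient[OF assms(1) less.prems(2) False] by blast
    interpret S: dmodule n S using S by unfold_locales (simp add: standard_def)
    define K where "K = {v \<in> und M. g v = 0}"
    have KM: "K \<subseteq> und M" by (auto simp: K_def)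
    have subK: "free.subspace K"
      by (auto simp: K_def free.subspace_def zero_in add_in scl_in hom_zero[OF g] hom_add[OF g] hom_scl[OF g])
    have actK: "act M x v \<in> K" if "x \<in> path_alg n" "v \<in> K" for x v
      using that by (auto simp: K_def act_in hom_act[OF g] S.act_zero)
    let ?N = "M\<lparr>und := K\<rparr>"
    have N: "is_module n ?N" by (rule submodule[OF subK KM actK])
    interpret N: dmodule n ?N using N by unfold_locales
    obtain B where B: "finite B" "free.span B = und M" using fin by blast
    have "free.dim (und M) = free.dim K + free.dim (g ` und M)"
      unfolding K_def
      by (rule free_pair.rank_nullity[OF sub _ B(1)]) (use B hom_add[OF g] hom_scl[OF g] in auto)
    moreover have "free.dim (g ` und M) \<noteq> 0"
    proof
      assume 0: "free.dim (g ` und M) = 0"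
      obtain B' where "finite B'" "und S \<subseteq> free.span B'" using S.finite_dim_subset by blast
      then have "und S \<subseteq> {0}" using 0 surj free_dim_0 by metis
      then show False using nz S.zero_in by blast
    qed
    ultimately have "free.dim (und ?N) < free.dim (und M)" by simp
    from less.hyps[OF this N a_injective_sub[OF less.prems(2) KM]] have "?N \<in> F_Delta n" .
    moreover have "short_exact n ?N (\<lambda>v. if v \<in> K then v else 0) M g S"
      unfolding short_exact_def
    proof (intro conjI N less.prems(1) S.module g surj)
      show "(\<lambda>v. if v \<in> K then v else 0) \<in> Hom n ?N M"
        by (rule HomI) (use KM actK N.add_in N.scl_in in auto)
      show "inj_on (\<lambda>v. if v \<in> K then v else 0) (und ?N)" by (auto simp: inj_on_def)
      show "(\<lambda>v. if v \<in> K then v else 0) ` und ?N = {v \<in> und M. g v = 0}" by (auto simp: K_def image_iff)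
    qed
    ultimately show ?thesis using F_Delta.step[OF _ i S] by blast
  qed
qed

section \<open>Dimensions of spaces of homomorphisms\<close>

lemma sum_apply: "(\<Sum>a\<in>A. f a) x = (\<Sum>a\<in>A. f a x)"
  by (induction A rule: infinite_finite_induct) auto

lemma fscl_apply: "fscl c f v = scl c (f v)"
  by (simp add: fscl_def)

context dmodule
begin

lemma subspace_basis:
  assumes "free.subspace U" "U \<subseteq> und M"
  obtains B where "B \<subseteq> U" "finite B" "free.independent B" "free.span B = U"
proof -
  obtain B where B: "B \<subseteq> U" "free.independent B" "U \<subseteq> free.span B"
    using free.maximal_independent_subset by blast
  obtain S where "finite S" "U \<subseteq> free.span S" using finite_dim_subset[OF assms(2)] by blast
  then have "finite B" using free.independent_span_bound[OF _ B(2)] B(1) by (meson subset_trans)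
  then show ?thesis using that[of B] B assms(1) by (simp add: free.span_subspace)
qed

end

lemma basis_expand:
  assumes "finite B" "free.independent B" "v \<in> free.span B"
  shows "v = (\<Sum>b\<in>B. scl (free.representation B v b) b)"
  using free.sum_representation_eq[OF assms(2,3,1)] by simp

lemma subspace_Hom:
  assumes "is_module n M" "is_module n N"
  shows "maps.subspace (Hom n M N)"
proof -
  interpret M: dmodule n M using assms by unfold_locales
  interpret N: dmodule n N using assms by unfold_locales
  show ?thesis
    unfolding maps.subspace_def
  proof (intro conjI ballI allI)
    show "0 \<in> Hom n M N" by (rule HomI) (auto simp: N.zero_in N.act_zero)
    show "f + g \<in> Hom n M N" if "f \<in> Hom n M N" "g \<in> Hom n M N" for f g
      by (rule HomI) (use that in \<open>auto simp: hom_out hom_in hom_add hom_scl hom_act N.add_in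
        N.act_add free.scale_right_distrib algebra_simps\<close>)
    show "fscl c f \<in> Hom n M N" if "f \<in> Hom n M N" for c f
      by (rule HomI) (use that in \<open>auto simp: fscl_apply hom_out hom_in hom_add hom_scl hom_act N.scl_in
        N.act_scl free.scale_right_distrib mult.commute\<close>)
  qed
qed

lemma Hom_finite_dim:
  assumes "is_module n M" "is_module n N"
  obtains S where "finite S" "Hom n M N \<subseteq> maps.span S"
proof -
  interpret M: dmodule n M using assms by unfold_locales
  interpret N: dmodule n N using assms by unfold_locales
  obtain B where B: "B \<subseteq> und M" "finite B" "free.independent B" "free.span B = und M"
    by (rule M.subspace_basis[OF M.sub subset_refl])
  obtain C where C: "C \<subseteq> und N" "finite C" "free.independent C" "free.span C = und N"
    by (rule N.subspace_basis[OF N.sub subset_refl])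
  define E where "E b c = (\<lambda>v. if v \<in> und M then scl (free.representation B v b) c else 0)" for b c :: vec
  have "f \<in> maps.span ((\<lambda>(b, c). E b c) ` (B \<times> C))" if f: "f \<in> Hom n M N" for f
  proof -
    have "f = (\<Sum>b\<in>B. \<Sum>c\<in>C. fscl (free.representation C (f b) c) (E b c))"
    proof (rule ext)
      fix v
      show "f v = (\<Sum>b\<in>B. \<Sum>c\<in>C. fscl (free.representation C (f b) c) (E b c)) v"
      proof (cases "v \<in> und M")
        case False
        then show ?thesis using f by (simp add: sum_apply fscl_apply E_def hom_out)
      next
        case True
        have "f v = f (\<Sum>b\<in>B. scl (free.representation B v b) b)"
          using basis_expand[OF B(2,3)] True B(4) by simp
        also have "\<dots> = (\<Sum>b\<in>B. f (scl (free.representation B v b) b))"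
          using B(1) by (intro M.hom_sum[OF f B(2)]) (auto intro: M.scl_in)
        also have "\<dots> = (\<Sum>b\<in>B. scl (free.representation B v b) (f b))"
          using B(1) by (intro sum.cong) (auto simp: hom_scl[OF f])
        also have "\<dots> = (\<Sum>b\<in>B. scl (free.representation B v b)
            (\<Sum>c\<in>C. scl (free.representation C (f b) c) c))"
          using B(1) C(4) hom_in[OF f] by (intro sum.cong refl arg_cong[of _ _ "scl _"] basis_expand[OF C(2,3)]) auto
        also have "\<dots> = (\<Sum>b\<in>B. \<Sum>c\<in>C. fscl (free.representation C (f b) c) (E b c)) v"
          using True by (simp add: sum_apply fscl_apply E_def free.scale_sum_right mult.commute)
        finally show ?thesis .
      qed
    qed
    also have "\<dots> \<in> maps.span ((\<lambda>(b, c). E b c) ` (B \<times> C))"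
      by (intro maps.span_sum maps.span_scale maps.span_base) auto
    finally show ?thesis .
  qed
  then show ?thesis using that[of "(\<lambda>(b, c). E b c) ` (B \<times> C)"] B(2) C(2) by blast
qed

text \<open>Rank and nullity are counted twice: for the restriction to \<open>M\<close>, and for the restriction to \<open>N\<close> of
  the homomorphisms that vanish on \<open>M\<close>.\<close>
lemma hom_dim_direct_sum2_left:
  assumes d: "direct_sum2 n Z M N" and P: "is_module n P"
  shows "hom_dim n Z P = hom_dim n M P + hom_dim n N P"
  using d
proof (rule direct_sum2E)
  fix i1 i2 p1 p2
  assume m: "is_module n Z" "is_module n M" "is_module n N"
    and h: "i1 \<in> Hom n M Z" "i2 \<in> Hom n N Z" "p1 \<in> Hom n Z M" "p2 \<in> Hom n Z N"
    and e: "\<And>v. v \<in> und M \<Longrightarrow> p1 (i1 v) = v" "\<And>v. v \<in> und M \<Longrightarrow> p2 (i1 v) = 0"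
      "\<And>v. v \<in> und N \<Longrightarrow> p2 (i2 v) = v" "\<And>v. v \<in> und N \<Longrightarrow> p1 (i2 v) = 0"
      "\<And>v. v \<in> und Z \<Longrightarrow> i1 (p1 v) + i2 (p2 v) = v"
  interpret Z: dmodule n Z using m by unfold_locales
  interpret M: dmodule n M using m by unfold_locales
  interpret N: dmodule n N using m by unfold_locales
  obtain S where S: "finite S" "Hom n Z P \<subseteq> maps.span S" using Hom_finite_dim[OF m(1) P] by blast
  define F1 where "F1 f = (\<lambda>v. f (i1 v))" for f :: "vec \<Rightarrow> vec"
  define F2 where "F2 f = (\<lambda>v. f (i2 v))" for f :: "vec \<Rightarrow> vec"
  let ?A = "{f \<in> Hom n Z P. F1 f = 0}"
  have lin: "F1 (f + g) = F1 f + F1 g" "F1 (fscl c f) = fscl c (F1 f)"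
     "F2 (f + g) = F2 f + F2 g" "F2 (fscl c f) = fscl c (F2 f)" for f g c
    by (auto simp: F1_def F2_def fscl_def)
  have 1: "maps.dim (Hom n Z P) = maps.dim ?A + maps.dim (F1 ` Hom n Z P)"
    by (rule maps_pair.rank_nullity[OF subspace_Hom[OF m(1) P] S(2,1)]) (auto simp: lin)
  have "F1 0 = 0" by (simp add: F1_def zero_fun_def)
  then have subA: "maps.subspace ?A"
    using subspace_Hom[OF m(1) P] by (auto simp: maps.subspace_def lin)
  have 2: "maps.dim ?A = maps.dim {f \<in> ?A. F2 f = 0} + maps.dim (F2 ` ?A)"
    by (rule maps_pair.rank_nullity[OF subA _ S(1)]) (use S(2) in \<open>auto simp: lin\<close>)
  have "f = 0" if f: "f \<in> Hom n Z P" "F1 f = 0" "F2 f = 0" for f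
  proof
    fix v
    show "f v = 0 v"
    proof (cases "v \<in> und Z")
      case True
      have "f v = f (i1 (p1 v) + i2 (p2 v))" using e(5)[OF True] by simp
      also have "\<dots> = F1 f (p1 v) + F2 f (p2 v)"
        using True by (simp add: F1_def F2_def hom_add[OF f(1)] hom_in[OF h(1)] hom_in[OF h(2)]
            hom_in[OF h(3)] hom_in[OF h(4)])
      finally show ?thesis using f by simp
    qed (simp add: hom_out[OF f(1)])
  qed
  then have "{f \<in> ?A. F2 f = 0} \<subseteq> {0}" by blast
  then have 3: "maps.dim {f \<in> ?A. F2 f = 0} = 0"
    using maps.dim_le_card[of "{f \<in> ?A. F2 f = 0}" "{}"] by simp
  have 4: "F1 ` Hom n Z P = Hom n M P"
  proof
    show "F1 ` Hom n Z P \<subseteq> Hom n M P" using Z.hom_comp[OF h(1)] by (auto simp: F1_def)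
    show "Hom n M P \<subseteq> F1 ` Hom n Z P"
    proof
      fix f assume f: "f \<in> Hom n M P"
      have "f = F1 (\<lambda>v. f (p1 v))"
        by (rule ext) (metis F1_def e(1) f hom_out h(1,3) hom_zero)
      then show "f \<in> F1 ` Hom n Z P" using M.hom_comp[OF h(3) f] by blast
    qed
  qed
  have 5: "F2 ` ?A = Hom n N P"
  proof
    show "F2 ` ?A \<subseteq> Hom n N P" using Z.hom_comp[OF h(2)] by (auto simp: F2_def)
    show "Hom n N P \<subseteq> F2 ` ?A"
    proof
      fix f assume f: "f \<in> Hom n N P"
      have "f = F2 (\<lambda>v. f (p2 v))"
        by (rule ext) (metis F2_def e(3) f hom_out h(2,4) hom_zero)
      moreover have "F1 (\<lambda>v. f (p2 v)) = 0"
      proof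
        fix v
        show "F1 (\<lambda>v. f (p2 v)) v = 0 v"
          using e(2)[of v] hom_out[OF h(1), of v] hom_zero[OF f] hom_zero[OF h(4)]
          by (cases "v \<in> und M") (auto simp: F1_def)
      qed
      ultimately show "f \<in> F2 ` ?A" using N.hom_comp[OF h(4) f] by blast
    qed
  qed
  show ?thesis using 1 2 3 4 5 by (simp add: hom_dim_def)
qed

lemma hom_dim_direct_sum2_right:
  assumes d: "direct_sum2 n Z M N" and P: "is_module n P"
  shows "hom_dim n P Z = hom_dim n P M + hom_dim n P N"
  using d
proof (rule direct_sum2E)
  fix i1 i2 p1 p2
  assume m: "is_module n Z" "is_module n M" "is_module n N"
    and h: "i1 \<in> Hom n M Z" "i2 \<in> Hom n N Z" "p1 \<in> Hom n Z M" "p2 \<in> Hom n Z N"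
    and e: "\<And>v. v \<in> und M \<Longrightarrow> p1 (i1 v) = v" "\<And>v. v \<in> und M \<Longrightarrow> p2 (i1 v) = 0"
      "\<And>v. v \<in> und N \<Longrightarrow> p2 (i2 v) = v" "\<And>v. v \<in> und N \<Longrightarrow> p1 (i2 v) = 0"
      "\<And>v. v \<in> und Z \<Longrightarrow> i1 (p1 v) + i2 (p2 v) = v"
  interpret Z: dmodule n Z using m by unfold_locales
  interpret M: dmodule n M using m by unfold_locales
  interpret N: dmodule n N using m by unfold_locales
  obtain S where S: "finite S" "Hom n P Z \<subseteq> maps.span S" using Hom_finite_dim[OF P m(1)] by blast
  define F1 where "F1 f = (\<lambda>v. p1 (f v))" for f :: "vec \<Rightarrow> vec"
  define F2 where "F2 f = (\<lambda>v. p2 (f v))" for f :: "vec \<Rightarrow> vec"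
  let ?A = "{f \<in> Hom n P Z. F1 f = 0}"
  have val: "f v \<in> und Z" if "f \<in> Hom n P Z" for f v
    using that Z.zero_in by (cases "v \<in> und P") (auto simp: hom_in hom_out)
  have lin_add: "F1 (f + g) = F1 f + F1 g" "F2 (f + g) = F2 f + F2 g"
    if "f \<in> Hom n P Z" "g \<in> Hom n P Z" for f g
    using val[OF that(1)] val[OF that(2)]
    by (auto simp: F1_def F2_def fun_eq_iff hom_add[OF h(3)] hom_add[OF h(4)])
  have lin_scl: "F1 (fscl c f) = fscl c (F1 f)" "F2 (fscl c f) = fscl c (F2 f)"
    if "f \<in> Hom n P Z" for f c
    using val[OF that(1)]
    by (auto simp: F1_def F2_def fscl_def fun_eq_iff hom_scl[OF h(3)] hom_scl[OF h(4)])
  have 1: "maps.dim (Hom n P Z) = maps.dim ?A + maps.dim (F1 ` Hom n P Z)"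
    by (rule maps_pair.rank_nullity[OF subspace_Hom[OF P m(1)] S(2,1)]) (auto simp: lin_add lin_scl)
  have "F1 0 = 0" using hom_zero[OF h(3)] by (simp add: F1_def zero_fun_def)
  then have subA: "maps.subspace ?A"
    using subspace_Hom[OF P m(1)] by (auto simp: maps.subspace_def lin_add lin_scl)
  have 2: "maps.dim ?A = maps.dim {f \<in> ?A. F2 f = 0} + maps.dim (F2 ` ?A)"
    by (rule maps_pair.rank_nullity[OF subA _ S(1)]) (use S(2) in \<open>auto simp: lin_add lin_scl\<close>)
  have "f = 0" if f: "f \<in> Hom n P Z" "F1 f = 0" "F2 f = 0" for f
  proof
    fix v
    have "f v = i1 (F1 f v) + i2 (F2 f v)" using e(5)[OF val[OF f(1)]] by (simp add: F1_def F2_def)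
    then show "f v = 0 v" using f hom_zero[OF h(1)] hom_zero[OF h(2)] by simp
  qed
  then have "{f \<in> ?A. F2 f = 0} \<subseteq> {0}" by blast
  then have 3: "maps.dim {f \<in> ?A. F2 f = 0} = 0"
    using maps.dim_le_card[of "{f \<in> ?A. F2 f = 0}" "{}"] by simp
  have 4: "F1 ` Hom n P Z = Hom n P M"
  proof
    show "F1 ` Hom n P Z \<subseteq> Hom n P M" using Z.hom_comp[OF _ h(3)] by (auto simp: F1_def)
    show "Hom n P M \<subseteq> F1 ` Hom n P Z"
    proof
      fix f assume f: "f \<in> Hom n P M"
      have fv: "f v \<in> und M" for v
        using f M.zero_in by (cases "v \<in> und P") (auto simp: hom_in hom_out)
      have "f = F1 (\<lambda>v. i1 (f v))" using e(1)[OF fv] by (simp add: F1_def)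
      then show "f \<in> F1 ` Hom n P Z" using M.hom_comp[OF f h(1)] by blast
    qed
  qed
  have 5: "F2 ` ?A = Hom n P N"
  proof
    show "F2 ` ?A \<subseteq> Hom n P N" using Z.hom_comp[OF _ h(4)] by (auto simp: F2_def)
    show "Hom n P N \<subseteq> F2 ` ?A"
    proof
      fix f assume f: "f \<in> Hom n P N"
      have fv: "f v \<in> und N" for v
        using f N.zero_in by (cases "v \<in> und P") (auto simp: hom_in hom_out)
      have "f = F2 (\<lambda>v. i2 (f v))" using e(3)[OF fv] by (simp add: F2_def)
      moreover have "F1 (\<lambda>v. i2 (f v)) = 0" using e(4)[OF fv] by (simp add: F1_def zero_fun_def)
      ultimately show "f \<in> F2 ` ?A" using N.hom_comp[OF f h(2)] by blast
    qed
  qed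
  show ?thesis using 1 2 3 4 5 by (simp add: hom_dim_def)
qed

section \<open>Symmetry of the dimensions for modules generated at vertex 0\<close>

definition vertex0 :: "dmod \<Rightarrow> vec set"
  where "vertex0 M = {v \<in> und M. act M (vtx 0) v = v}"

context dmodule
begin

lemma vertex0_subspace: "n > 0 \<Longrightarrow> free.subspace (vertex0 M)"
  unfolding free.subspace_def vertex0_def
  by (auto simp: zero_in add_in scl_in act_zero act_add act_scl vtx_in)

lemma vertex0_sub: "vertex0 M \<subseteq> und M"
  by (auto simp: vertex0_def)

lemma loop_vertex0: "n > 1 \<Longrightarrow> v \<in> und M \<Longrightarrow> loop M v \<in> vertex0 M"
  by (simp add: vertex0_def loop_in loop_range)

lemma act_vtx0_vertex0: "n > 0 \<Longrightarrow> v \<in> und M \<Longrightarrow> act M (vtx 0) v \<in> vertex0 M"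
  by (simp add: vertex0_def act_in vtx_in act_vtx_vtx)

end

lemma hom_vertex0: "f \<in> Hom n M N \<Longrightarrow> n > 0 \<Longrightarrow> v \<in> vertex0 M \<Longrightarrow> f v \<in> vertex0 N"
  unfolding vertex0_def using hom_act[of f n M N "vtx 0" v] hom_in[of f n M N v]
  by (auto simp: vtx_in)

text \<open>The graph of the only homomorphism that can extend \<open>f\<close> from vertex 0 to the module generated there.\<close>
inductive_set generated_graph :: "nat \<Rightarrow> dmod \<Rightarrow> dmod \<Rightarrow> (vec \<Rightarrow> vec) \<Rightarrow> (vec \<times> vec) set"
  for n M N f where
  base: "x \<in> path_alg n \<Longrightarrow> v \<in> vertex0 M \<Longrightarrow> (act M x v, act N x (f v)) \<in> generated_graph n M N f"
| add: "(u, w) \<in> generated_graph n M N f \<Longrightarrow> (u', w') \<in> generated_graph n M N f \<Longrightarrow>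
    (u + u', w + w') \<in> generated_graph n M N f"

text \<open>If \<open>\<Sum> x\<^sub>i v\<^sub>i = 0\<close> with all $v_i$ at vertex 0, then \<open>w = \<Sum> x\<^sub>i f(v\<^sub>i)\<close> satisfies
  \<open>e\<^sub>0 y w = f(e\<^sub>0 y \<Sum> x\<^sub>i v\<^sub>i) = 0\<close> for all \<open>y\<close>, since $e_0De_0$ acts through powers of the loop and \<open>f\<close>
  commutes with the loop. As the arrows $a_j$ are injective on \<open>N\<close>, this forces \<open>w = 0\<close>.\<close>
lemma extend_from_vertex0:
  assumes n: "n > 1" and M: "is_module n M" "eta n M = M" and N: "is_module n N" "a_injective n N"
    and f: "\<And>v. v \<in> vertex0 M \<Longrightarrow> f v \<in> vertex0 N"
    and f_add: "\<And>v w. v \<in> vertex0 M \<Longrightarrow> w \<in> vertex0 M \<Longrightarrow> f (v + w) = f v + f w"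
    and f_scl: "\<And>c v. v \<in> vertex0 M \<Longrightarrow> f (scl c v) = scl c (f v)"
    and f_loop: "\<And>v. v \<in> vertex0 M \<Longrightarrow> f (loop M v) = loop N (f v)"
  shows "\<exists>h\<in>Hom n M N. \<forall>v\<in>vertex0 M. h v = f v"
proof -
  interpret M: dmodule n M using M by unfold_locales
  interpret N: dmodule n N using N by unfold_locales
  have n0: "n > 0" using n by simp
  note v0 = M.vertex0_subspace[OF n0]
  have fN: "f v \<in> und N" "act N (vtx 0) (f v) = f v" if "v \<in> vertex0 M" for v
    using f[OF that] by (auto simp: vertex0_def)
  have vM: "v \<in> und M" "act M (vtx 0) v = v" if "v \<in> vertex0 M" for v
    using that by (auto simp: vertex0_def)
  have f0: "f 0 = 0" using f_scl[OF free.subspace_0[OF v0], of 0] by simp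
  have e0: "act M (vtx 0) u \<in> vertex0 M" if "u \<in> und M" for u using M.act_vtx0_vertex0[OF n0 that] .
  have comm: "act N (vtx 0) (act N z (f v)) = f (act M (vtx 0) (act M z v))"
    if z: "z \<in> path_alg n" and v: "v \<in> vertex0 M" for z v
    using z
  proof (induction rule: path_alg_linear_induct)
    case zero
    show ?case using v n0
      by (simp add: M.act_zero_left N.act_zero_left M.act_zero N.act_zero vtx_in fN(1) vM(1) f0)
  next
    case (add x y)
    show ?case using add v n0
      by (simp add: M.act_add_left N.act_add_left M.act_add N.act_add vtx_in fN(1) vM(1) M.act_in N.act_in f_add e0)
  next
    case (scl c x)
    show ?case using scl v n0
      by (simp add: M.act_scl_left N.act_scl_left M.act_scl N.act_scl vtx_in fN(1) vM(1) M.act_in N.act_in f_scl e0)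
  next
    case (path i w j)
    let ?p = "single (i, w) (1 :: complex)"
    show ?case
    proof (cases "i = 0 \<and> j = 0")
      case True
      have pow: "(loop M ^^ k) v \<in> vertex0 M \<and> (loop N ^^ k) (f v) = f ((loop M ^^ k) v)" for k
        by (induction k) (use v n in \<open>auto simp: f_loop vM(1) intro!: M.loop_vertex0\<close>)
      show ?thesis
        using M.down_path[OF n path vM(1)[OF v]] N.down_path[OF n path fN(1)[OF v]] True pow vM(2)[OF v] fN(2)[OF v]
        by simp
    next
      case False
      have "act M (vtx 0) (act M ?p v) = 0"
        using False M.act_vtx_path[OF path n0 vM(1)[OF v]] M.act_path_vtx[OF path n0 vM(1)[OF v], of 1] vM(2)[OF v]
          M.act_zero[OF vtx_in[OF n0]] by (auto split: if_splits)
      moreover have "act N (vtx 0) (act N ?p (f v)) = 0"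
        using False N.act_vtx_path[OF path n0 fN(1)[OF v]] N.act_path_vtx[OF path n0 fN(1)[OF v], of 1] fN(2)[OF v]
          N.act_zero[OF vtx_in[OF n0]] by (auto split: if_splits)
      ultimately show ?thesis using f0 by simp
    qed
  qed
  let ?R = "generated_graph n M N f"
  have sub: "u \<in> und M \<and> w \<in> und N" if "(u, w) \<in> ?R" for u w
    using that by induction (auto simp: M.act_in N.act_in M.add_in N.add_in vM(1) fN(1))
  have "\<exists>h\<in>Hom n M N. \<forall>(u, w)\<in>?R. h u = w"
  proof (rule M.hom_of_graph[OF N(1)])
    show "?R \<subseteq> und M \<times> und N" using sub by auto
    show "\<exists>w. (u, w) \<in> ?R" if "u \<in> und M" for u
    proof -
      have "u \<in> und (eta n M)" using that M by simp
      with n0 show ?thesis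
      proof (induction rule: M.eta_induct)
        case zero
        show ?case using generated_graph.base[OF path_alg_zero free.subspace_0[OF v0], where N = N and f = f]
          M.zero_in by (auto simp: M.act_zero_left)
      next
        case (add u w)
        then show ?case by (blast intro: generated_graph.add)
      next
        case (gen x w)
        then show ?case using generated_graph.base[OF gen(1) e0[OF gen(2)]] by blast
      qed
    qed
    show "(u + u', w + w') \<in> ?R" if "(u, w) \<in> ?R" "(u', w') \<in> ?R" for u w u' w'
      using that by (rule generated_graph.add)
    show "(scl c u, scl c w) \<in> ?R" if "(u, w) \<in> ?R" for c u w
      using that
    proof induction
      case (base x v)
      then show ?case using generated_graph.base[OF path_alg_scl[OF base(1), of c] base(2), where N = N and f = f]
        by (simp add: M.act_scl_left N.act_scl_left vM(1) fN(1))
    next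
      case (add u w u' w')
      then show ?case by (simp add: free.scale_right_distrib generated_graph.add)
    qed
    show "(act M y u, act N y w) \<in> ?R" if y: "y \<in> path_alg n" and uw: "(u, w) \<in> ?R" for y u w
      using uw
    proof induction
      case (base x v)
      then show ?case using generated_graph.base[OF pmult_in[OF y base(1)] base(2), where N = N and f = f] y
        by (simp add: M.act_mult N.act_mult vM(1) fN(1))
    next
      case (add u w u' w')
      then show ?case using sub[OF add(1)] sub[OF add(2)] y by (simp add: M.act_add N.act_add generated_graph.add)
    qed
    have key: "act N (vtx 0) (act N y w) = f (act M (vtx 0) (act M y u))"
      if y: "y \<in> path_alg n" and uw: "(u, w) \<in> ?R" for y u w
      using uw
    proof induction
      case (base x v)
      then show ?case using comm[OF pmult_in[OF y base(1)] base(2)] y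
        by (simp add: M.act_mult N.act_mult vM(1) fN(1))
    next
      case (add u w u' w')
      then show ?case using sub[OF add(1)] sub[OF add(2)] y n0
        by (simp add: M.act_add N.act_add M.act_in N.act_in vtx_in f_add e0)
    qed
    show "w = 0" if "(0, w) \<in> ?R" for w
      by (rule N.zero_if_no_vertex0_part[OF N(2)])
        (use sub[OF that] key[OF _ that] n0 f0 in \<open>auto simp: M.act_zero vtx_in\<close>)
  qed
  then obtain h where h: "h \<in> Hom n M N" "\<forall>(u, w)\<in>?R. h u = w" by blast
  have "h v = f v" if v: "v \<in> vertex0 M" for v
    using bspec[OF h(2) generated_graph.base[OF vtx_in[OF n0] v]] vM(2)[OF v] fN(2)[OF v] by simp
  then show ?thesis using h(1) by blast
qed

abbreviation loop_matrix :: "dmod \<Rightarrow> vec set \<Rightarrow> vec \<Rightarrow> vec \<Rightarrow> complex"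
  where "loop_matrix M B b c \<equiv> free.representation B (loop M c) b"

text \<open>The system of equations saying that a matrix with entries indexed by \<open>(c', b')\<close> describes a linear
  map that commutes with the loops, one equation for each pair \<open>(b, c)\<close>. The order of the indices
  is chosen such that exchanging the two modules transposes the system up to sign.\<close>
definition intertwiner_matrix ::
  "dmod \<Rightarrow> vec set \<Rightarrow> dmod \<Rightarrow> vec set \<Rightarrow> vec \<times> vec \<Rightarrow> vec \<times> vec \<Rightarrow> complex"
  where "intertwiner_matrix M B N C = (\<lambda>(b, c) (c', b').
    (if b = b' then loop_matrix N C c c' else 0) - (if c = c' then loop_matrix M B b' b else 0))"

lemma intertwiner_sum:
  assumes "finite B" "finite C" "b \<in> B" "c \<in> C"
  shows "(\<Sum>j\<in>C \<times> B. intertwiner_matrix M B N C (b, c) j * x j) =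
    (\<Sum>c'\<in>C. loop_matrix N C c c' * x (c', b)) - (\<Sum>b'\<in>B. loop_matrix M B b' b * x (c, b'))"
proof -
  have "(\<Sum>j\<in>C \<times> B. intertwiner_matrix M B N C (b, c) j * x j) =
      (\<Sum>c'\<in>C. \<Sum>b'\<in>B. intertwiner_matrix M B N C (b, c) (c', b') * x (c', b'))"
    by (simp add: sum.cartesian_product case_prod_beta)
  also have "\<dots> = (\<Sum>c'\<in>C. \<Sum>b'\<in>B. (if b = b' then loop_matrix N C c c' * x (c', b') else 0) -
      (if c = c' then loop_matrix M B b' b * x (c', b') else 0))"
    by (intro sum.cong refl) (simp add: intertwiner_matrix_def left_diff_distrib)
  also have "\<dots> =
      (\<Sum>c'\<in>C. \<Sum>b'\<in>B. (if b = b' then loop_matrix N C c c' * x (c', b') else 0)) -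
      (\<Sum>c'\<in>C. \<Sum>b'\<in>B. (if c = c' then loop_matrix M B b' b * x (c', b') else 0))"
    by (simp only: sum_subtractf)
  also have "(\<Sum>c'\<in>C. \<Sum>b'\<in>B. (if b = b' then loop_matrix N C c c' * x (c', b') else 0)) =
      (\<Sum>c'\<in>C. loop_matrix N C c c' * x (c', b))"
    using assms by (intro sum.cong) (auto simp: sum.delta)
  also have "(\<Sum>c'\<in>C. \<Sum>b'\<in>B. (if c = c' then loop_matrix M B b' b * x (c', b') else 0)) =
      (\<Sum>b'\<in>B. loop_matrix M B b' b * x (c, b'))"
    using assms by (subst sum.swap, intro sum.cong) (auto simp: sum.delta)
  finally show ?thesis .
qed

text \<open>A homomorphism is determined by its restriction to vertex 0, because \<open>M\<close> is generated there, and
  every linear map at vertex 0 that commutes with the loops extends.\<close>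
lemma hom_dim_eq_nullity:
  assumes n: "n > 1" and M: "is_module n M" "eta n M = M" and N: "is_module n N" "a_injective n N"
    and B: "finite B" "free.independent B" "free.span B = vertex0 M"
    and C: "finite C" "free.independent C" "free.span C = vertex0 N"
  shows "hom_dim n M N = int (free.dim (null_space (B \<times> C) (C \<times> B) (intertwiner_matrix M B N C)))"
proof -
  interpret M: dmodule n M using M by unfold_locales
  interpret N: dmodule n N using N by unfold_locales
  have n0: "n > 0" using n by simp
  have BV: "b \<in> vertex0 M" "b \<in> und M" if "b \<in> B" for b
    using that B(3) free.span_superset M.vertex0_sub by blast+
  have CV: "c \<in> vertex0 N" "c \<in> und N" if "c \<in> C" for c
    using that C(3) free.span_superset N.vertex0_sub by blast+
  \<comment> \<open>The matrix of the restriction to vertex 0.\<close>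
  define F where "F f = (\<Sum>j\<in>C \<times> B. single j (free.representation C (f (snd j)) (fst j)))"
    for f :: "vec \<Rightarrow> vec"
  have lF: "lookup (F f) (c, b) = (if c \<in> C \<and> b \<in> B then free.representation C (f b) c else 0)"
    for f b c
    using B(1) C(1) by (simp add: F_def lookup_sum lookup_single when_def)
  have fB: "f b \<in> free.span C" if "f \<in> Hom n M N" "b \<in> B" for f b
    using hom_vertex0[OF that(1) n0 BV(1)[OF that(2)]] C(3) by simp
  obtain S where S: "finite S" "Hom n M N \<subseteq> maps.span S" using Hom_finite_dim[OF M(1) N(1)] by blast
  have "maps.dim (Hom n M N) = maps.dim {f \<in> Hom n M N. F f = 0} + free.dim (F ` Hom n M N)"
  proof (rule maps_free.rank_nullity[OF subspace_Hom[OF M(1) N(1)] S(2,1)])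
    show "F (f + g) = F f + F g" if "f \<in> Hom n M N" "g \<in> Hom n M N" for f g
    proof (rule poly_mapping_eqI)
      fix j :: "vec \<times> vec"
      show "lookup (F (f + g)) j = lookup (F f + F g) j"
        by (cases j) (use that in \<open>simp add: lF lookup_add free.representation_add[OF C(2)] fB\<close>)
    qed
    show "F (fscl k f) = scl k (F f)" if "f \<in> Hom n M N" for k f
    proof (rule poly_mapping_eqI)
      fix j :: "vec \<times> vec"
      show "lookup (F (fscl k f)) j = lookup (scl k (F f)) j"
        by (cases j) (use that in \<open>simp add: lF lookup_scl fscl_apply free.representation_scale[OF C(2)] fB\<close>)
    qed
  qed
  moreover have "{f \<in> Hom n M N. F f = 0} \<subseteq> {0}"
  proof safe
    fix f assume f: "f \<in> Hom n M N" "F f = 0"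
    have "f b = 0" if "b \<in> B" for b
    proof -
      have "free.representation C (f b) c = 0" if "c \<in> C" for c
        using f(2) lF[of f c b] \<open>b \<in> B\<close> that by simp
      then show ?thesis using basis_expand[OF C(1,2) fB[OF f(1) that]] by simp
    qed
    then have "B \<subseteq> {v \<in> und M. f v = 0}" using BV by auto
    moreover have "free.subspace {v \<in> und M. f v = 0}"
      by (auto simp: free.subspace_def M.zero_in M.add_in M.scl_in hom_zero[OF f(1)] hom_add[OF f(1)] hom_scl[OF f(1)])
    ultimately have "free.span B \<subseteq> {v \<in> und M. f v = 0}" by (rule free.span_minimal)
    then have v0: "f v = 0" if "v \<in> vertex0 M" for v
      using B(3) that by blast
    show "f = 0"
    proof
      fix v
      show "f v = 0 v"
      proof (cases "v \<in> und M")
        case True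
        then have "v \<in> und (eta n M)" using M by simp
        with n0 have "f v = 0"
        proof (induction rule: M.eta_induct)
          case (gen x w)
          then show ?case using v0[OF M.act_vtx0_vertex0[OF n0 gen(2)]] n0
            by (simp add: hom_act[OF f(1)] M.act_in vtx_in N.act_zero)
        qed (auto simp: hom_zero[OF f(1)] hom_add[OF f(1)])
        then show ?thesis by simp
      qed (simp add: hom_out[OF f(1)])
    qed
  qed
  then have "maps.dim {f \<in> Hom n M N. F f = 0} = 0"
    using maps.dim_le_card[of "{f \<in> Hom n M N. F f = 0}" "{}"] by simp
  moreover have "F ` Hom n M N = null_space (B \<times> C) (C \<times> B) (intertwiner_matrix M B N C)"
  proof (intro equalityI subsetI)
    fix z assume "z \<in> F ` Hom n M N"
    then obtain f where f: "f \<in> Hom n M N" and z: "z = F f" by blast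
    have "(\<Sum>j\<in>C \<times> B. intertwiner_matrix M B N C (b, c) j * lookup (F f) j) = 0"
      if b: "b \<in> B" and c: "c \<in> C" for b c
    proof -
      let ?x = "\<lambda>c b. free.representation C (f b) c"
      have lspan: "loop N v \<in> free.span C" if "v \<in> und N" for v
        using N.loop_vertex0[OF n that] C(3) by simp
      have "f b = (\<Sum>c'\<in>C. scl (?x c' b) c')" using basis_expand[OF C(1,2) fB[OF f b]] .
      then have "loop N (f b) = loop N (\<Sum>c'\<in>C. scl (?x c' b) c')" by (rule arg_cong)
      also have "\<dots> = (\<Sum>c'\<in>C. scl (?x c' b) (loop N c'))"
        using CV N.loop_sum[OF C(1) n, of "\<lambda>c'. scl (?x c' b) c'"] N.scl_in N.loop_scl[OF n] by simp
      finally have 1: "free.representation C (loop N (f b)) c = (\<Sum>c'\<in>C. loop_matrix N C c c' * ?x c' b)"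
        using CV lspan by (simp add: free.representation_sum[OF C(2)] free.representation_scale[OF C(2)]
          free.span_scale mult.commute)
      have "loop M b = (\<Sum>b'\<in>B. scl (loop_matrix M B b' b) b')"
        using M.loop_vertex0[OF n BV(2)[OF b]] B(3) by (intro basis_expand[OF B(1,2)]) simp
      then have "f (loop M b) = f (\<Sum>b'\<in>B. scl (loop_matrix M B b' b) b')" by (rule arg_cong)
      also have "\<dots> = (\<Sum>b'\<in>B. scl (loop_matrix M B b' b) (f b'))"
        using BV M.hom_sum[OF f B(1), of "\<lambda>b'. scl (loop_matrix M B b' b) b'"] M.scl_in hom_scl[OF f] by simp
      finally have 2: "free.representation C (f (loop M b)) c = (\<Sum>b'\<in>B. loop_matrix M B b' b * ?x c b')"
        using fB[OF f] by (simp add: free.representation_sum[OF C(2)] free.representation_scale[OF C(2)]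
          free.span_scale)
      have "loop N (f b) = f (loop M b)" using M.hom_loop[OF f n BV(2)[OF b]] by simp
      then show ?thesis
        unfolding intertwiner_sum[OF B(1) C(1) b c] using 1 2 b c by (simp add: lF)
    qed
    moreover have "F f \<in> coords (C \<times> B)" by (auto simp: coords_def in_keys_iff lF split: if_splits)
    ultimately show "z \<in> null_space (B \<times> C) (C \<times> B) (intertwiner_matrix M B N C)"
      unfolding z null_space_def by blast
  next
    fix x assume x: "x \<in> null_space (B \<times> C) (C \<times> B) (intertwiner_matrix M B N C)"
    define y where "y b = (\<Sum>c\<in>C. scl (lookup x (c, b)) c)" for b
    have yV: "y b \<in> vertex0 N" for b
      unfolding y_def C(3)[symmetric] by (intro free.span_sum free.span_scale free.span_base)
    define f where "f v = (\<Sum>b\<in>B. scl (free.representation B v b) (y b))" for v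
    have fV: "f v \<in> vertex0 N" for v
      unfolding f_def using yV N.vertex0_subspace[OF n0]
      by (intro free.subspace_sum free.subspace_scale) auto
    have f_add: "f (v + w) = f v + f w" if "v \<in> vertex0 M" "w \<in> vertex0 M" for v w
      using that B(3) by (simp add: f_def free.representation_add[OF B(2)] free.scale_left_distrib sum.distrib)
    have f_scl: "f (scl k v) = scl k (f v)" if "v \<in> vertex0 M" for k v
      using that B(3) by (simp add: f_def free.representation_scale[OF B(2)] free.scale_sum_right)
    have fb: "f b = y b" if "b \<in> B" for b
      using that B(1) by (simp add: f_def free.representation_basis[OF B(2)] if_distrib[of "\<lambda>k. scl k _"] cong: if_cong)
    have f_loop_B: "f (loop M b) = loop N (y b)" if b: "b \<in> B" for b
    proof -
      have "f (loop M b) = (\<Sum>b'\<in>B. \<Sum>c\<in>C. scl (loop_matrix M B b' b * lookup x (c, b')) c)"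
        by (simp add: f_def y_def free.scale_sum_right)
      also have "\<dots> = (\<Sum>c\<in>C. scl (\<Sum>b'\<in>B. loop_matrix M B b' b * lookup x (c, b')) c)"
        by (subst sum.swap) (simp add: free.scale_sum_left)
      also have "\<dots> = (\<Sum>c\<in>C. scl (\<Sum>c'\<in>C. loop_matrix N C c c' * lookup x (c', b)) c)"
      proof (rule sum.cong[OF refl])
        fix c assume c: "c \<in> C"
        have "(\<Sum>j\<in>C \<times> B. intertwiner_matrix M B N C (b, c) j * lookup x j) = 0"
          using x b c by (auto simp: null_space_def)
        then show "scl (\<Sum>b'\<in>B. loop_matrix M B b' b * lookup x (c, b')) c =
            scl (\<Sum>c'\<in>C. loop_matrix N C c c' * lookup x (c', b)) c"
          unfolding intertwiner_sum[OF B(1) C(1) b c] by simp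
      qed
      also have "\<dots> = (\<Sum>c'\<in>C. scl (lookup x (c', b)) (\<Sum>c\<in>C. scl (loop_matrix N C c c') c))"
        unfolding free.scale_sum_left free.scale_sum_right
        by (subst sum.swap) (simp add: mult.commute)
      also have "\<dots> = (\<Sum>c'\<in>C. scl (lookup x (c', b)) (loop N c'))"
        using N.loop_vertex0[OF n CV(2)] C(3)
        by (intro sum.cong refl arg_cong[of _ _ "scl _"] basis_expand[OF C(1,2), symmetric]) auto
      also have "\<dots> = loop N (y b)"
        unfolding y_def
        using CV N.loop_sum[OF C(1) n, of "\<lambda>c'. scl (lookup x (c', b)) c'"] N.scl_in N.loop_scl[OF n]
        by simp
      finally show ?thesis .
    qed
    have f_loop: "f (loop M v) = loop N (f v)" if v: "v \<in> vertex0 M" for v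
    proof -
      have fN: "f v \<in> und N" for v using fV N.vertex0_sub by blast
      have sub0: "free.subspace {v \<in> vertex0 M. f (loop M v) = loop N (f v)}"
        unfolding free.subspace_def
      proof safe
        have "f 0 = 0" using f_scl[OF free.subspace_0[OF M.vertex0_subspace[OF n0]], of 0] by simp
        then show "f (loop M 0) = loop N (f 0)" by (simp add: M.loop_zero[OF n] N.loop_zero[OF n])
        show "0 \<in> vertex0 M" using free.subspace_0[OF M.vertex0_subspace[OF n0]] .
        fix u assume u: "u \<in> vertex0 M" "f (loop M u) = loop N (f u)"
        have uM: "u \<in> und M" using u M.vertex0_sub by blast
        show "scl k u \<in> vertex0 M" for k using free.subspace_scale[OF M.vertex0_subspace[OF n0] u(1)] .
        show "f (loop M (scl k u)) = loop N (f (scl k u))" for k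
          using u uM by (simp add: M.loop_scl[OF n] f_scl M.loop_vertex0[OF n] N.loop_scl[OF n] fN)
        fix w assume w: "w \<in> vertex0 M" "f (loop M w) = loop N (f w)"
        have wM: "w \<in> und M" using w M.vertex0_sub by blast
        show "u + w \<in> vertex0 M" using free.subspace_add[OF M.vertex0_subspace[OF n0] u(1) w(1)] .
        show "f (loop M (u + w)) = loop N (f (u + w))"
          using u uM w wM by (simp add: M.loop_add[OF n] f_add M.loop_vertex0[OF n] N.loop_add[OF n] fN)
      qed
      have "B \<subseteq> {v \<in> vertex0 M. f (loop M v) = loop N (f v)}" using BV f_loop_B fb by auto
      then have "free.span B \<subseteq> {v \<in> vertex0 M. f (loop M v) = loop N (f v)}"
        using sub0 by (rule free.span_minimal)
      then show ?thesis using v B(3) by auto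
    qed
    obtain h where h: "h \<in> Hom n M N" "\<forall>v\<in>vertex0 M. h v = f v"
      using extend_from_vertex0[OF n M N fV f_add f_scl f_loop] by blast
    have "F h = x"
    proof (rule poly_mapping_eqI)
      fix j :: "vec \<times> vec"
      obtain c b where j: "j = (c, b)" by (cases j)
      show "lookup (F h) j = lookup x j"
      proof (cases "c \<in> C \<and> b \<in> B")
        case True
        then have "h b = y b" using h(2) BV fb by simp
        then have "lookup (F h) j = free.representation C (y b) c" using True j by (simp add: lF)
        also have "\<dots> = (\<Sum>c'\<in>C. lookup x (c', b) * free.representation C c' c)"
          unfolding y_def
          by (simp add: free.representation_sum[OF C(2)] free.representation_scale[OF C(2)]
            free.span_scale free.span_base)
        also have "\<dots> = (\<Sum>c'\<in>C. if c' = c then lookup x (c', b) else 0)"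
          by (intro sum.cong) (auto simp: free.representation_basis[OF C(2)])
        also have "\<dots> = lookup x j" using True C(1) j by (simp add: sum.delta)
        finally show ?thesis .
      next
        case False
        then have "j \<notin> Poly_Mapping.keys x" using x j by (auto simp: null_space_def coords_def)
        then show ?thesis using False j by (auto simp: lF in_keys_iff)
      qed
    qed
    then show "x \<in> F ` Hom n M N" using h(1) by blast
  qed
  ultimately show ?thesis by (simp add: hom_dim_def)
qed

lemma hom_dim_commute:
  assumes n: "n > 1" and M: "is_module n M" "a_injective n M" "eta n M = M"
    and N: "is_module n N" "a_injective n N" "eta n N = N"
  shows "hom_dim n M N = hom_dim n N M"
proof -
  interpret M: dmodule n M using M by unfold_locales
  interpret N: dmodule n N using N by unfold_locales
  have n0: "n > 0" using n by simp
  obtain B where B: "finite B" "free.independent B" "free.span B = vertex0 M"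
    by (rule M.subspace_basis[OF M.vertex0_subspace[OF n0] M.vertex0_sub])
  obtain C where C: "finite C" "free.independent C" "free.span C = vertex0 N"
    by (rule N.subspace_basis[OF N.vertex0_subspace[OF n0] N.vertex0_sub])
  have neg: "intertwiner_matrix M B N C i j = - intertwiner_matrix N C M B j i" for i j
    by (cases i; cases j) (auto simp: intertwiner_matrix_def)
  have "free.dim (null_space (B \<times> C) (C \<times> B) (intertwiner_matrix M B N C)) =
      free.dim (null_space (C \<times> B) (B \<times> C) (\<lambda>j i. intertwiner_matrix M B N C i j))"
    by (rule nullity_transpose) (use B(1) C(1) in \<open>auto simp: card_cartesian_product\<close>)
  also have "null_space (C \<times> B) (B \<times> C) (\<lambda>j i. intertwiner_matrix M B N C i j) =
      null_space (C \<times> B) (B \<times> C) (intertwiner_matrix N C M B)"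
    unfolding null_space_def neg by (simp add: sum_negf)
  finally show ?thesis
    using hom_dim_eq_nullity[OF n M(1,3) N(1,2) B C] hom_dim_eq_nullity[OF n N(1,3) M(1,2) C B] by simp
qed

section \<open>Bilinear forms on the split Grothendieck group\<close>

text \<open>The additive extension of \<open>f\<close> to the free Abelian group.\<close>
definition lin :: "('a \<Rightarrow> int) \<Rightarrow> ('a \<Rightarrow>\<^sub>0 int) \<Rightarrow> int"
  where "lin f p = (\<Sum>M\<in>Poly_Mapping.keys p. lookup p M * f M)"

lemma lin_eq: "finite K \<Longrightarrow> Poly_Mapping.keys p \<subseteq> K \<Longrightarrow> lin f p = (\<Sum>M\<in>K. lookup p M * f M)"
  unfolding lin_def by (rule sum.mono_neutral_left) (auto simp: in_keys_iff)

lemma lin_add: "lin f (p + q) = lin f p + lin f q"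
  using lin_eq[of "Poly_Mapping.keys p \<union> Poly_Mapping.keys q" p f]
    lin_eq[of "Poly_Mapping.keys p \<union> Poly_Mapping.keys q" q f]
    lin_eq[of "Poly_Mapping.keys p \<union> Poly_Mapping.keys q" "p + q" f] Poly_Mapping.keys_add[of p q]
  by (simp add: lookup_add distrib_right sum.distrib)

lemma lin_zero: "lin f 0 = 0"
  by (simp add: lin_def)

lemma lin_minus: "lin f (- p) = - lin f p"
  using lin_add[of f p "- p"] by (simp add: lin_zero)

lemma lin_diff: "lin f (p - q) = lin f p - lin f q"
  using lin_add[of f p "- q"] by (simp add: lin_minus)

lemma lin_frag_of: "lin f (frag_of M) = f M"
  by (simp add: lin_def)

lemma lin_cong: "(\<And>M. M \<in> Poly_Mapping.keys p \<Longrightarrow> f M = g M) \<Longrightarrow> lin f p = lin g p"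
  by (simp add: lin_def)

lemma lin_fun_diff: "lin (\<lambda>M. f M - g M) p = lin f p - lin g p"
  by (simp add: lin_def right_diff_distrib sum_subtractf)

lemma lin_fun_0: "lin (\<lambda>M. 0) p = 0"
  by (simp add: lin_def)

lemma lin_swap: "lin (\<lambda>M. lin (\<lambda>N. \<beta> M N) q) p = lin (\<lambda>N. lin (\<lambda>M. \<beta> M N) p) q"
  unfolding lin_def sum_distrib_left by (subst sum.swap) (simp add: mult.left_commute)

lemma additive_vanishes_on_split_rels:
  assumes "h \<in> split_rels n T"
    and "\<And>Z M N. in_add n T Z \<Longrightarrow> in_add n T M \<Longrightarrow> in_add n T N \<Longrightarrow> direct_sum2 n Z M N \<Longrightarrow> f Z = f M + f N"
  shows "lin f h = 0"
  using assms(1) unfolding split_rels_def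
proof (induction rule: generate.induct)
  case one
  then show ?case by (simp add: add_free_def lin_zero)
next
  case (incl h)
  then show ?case using assms(2) by (auto simp: lin_diff lin_frag_of)
next
  case (inv h)
  then obtain Z M N where h: "h = frag_of Z - frag_of M - frag_of N"
    "in_add n T Z" "in_add n T M" "in_add n T N" "direct_sum2 n Z M N" by blast
  have "h \<in> carrier (add_free n T)"
    using h Poly_Mapping.keys_diff[of "frag_of Z - frag_of M" "frag_of N"] Poly_Mapping.keys_diff[of "frag_of Z" "frag_of M"]
    by (auto simp: add_free_def)
  then have "inv\<^bsub>add_free n T\<^esub> h = - h" by (simp add: add_free_def)
  then show ?case using h assms(2)[OF h(2-5)] by (simp add: lin_minus lin_diff lin_frag_of)
next
  case (eng h1 h2)
  then show ?case by (simp add: add_free_def lin_add)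
qed

lemma split_rels_normal: "split_rels n T \<lhd> add_free n T"
proof -
  interpret comm_group "add_free n T" unfolding add_free_def by (rule abelian_free_Abelian_group)
  have "x \<in> carrier (add_free n T)"
    if x: "x \<in> {frag_of Z - frag_of M - frag_of N | Z M N.
        in_add n T Z \<and> in_add n T M \<and> in_add n T N \<and> direct_sum2 n Z M N}" for x
  proof -
    obtain Z M N where h: "x = frag_of Z - frag_of M - frag_of N"
      "in_add n T Z" "in_add n T M" "in_add n T N" using x by blast
    then show ?thesis
      using Poly_Mapping.keys_diff[of "frag_of Z - frag_of M" "frag_of N"] Poly_Mapping.keys_diff[of "frag_of Z" "frag_of M"]
      by (auto simp: add_free_def)
  qed
  then show ?thesis unfolding split_rels_def
    by (intro subgroup_imp_normal generate_is_subgroup) blast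
qed

text \<open>The class of an arbitrary element of the free Abelian group; \<open>K_obj\<close> is the case of a generator.\<close>
definition K_class :: "nat \<Rightarrow> dmod \<Rightarrow> (dmod \<Rightarrow>\<^sub>0 int) \<Rightarrow> (dmod \<Rightarrow>\<^sub>0 int) set"
  where "K_class n T p = split_rels n T #>\<^bsub>add_free n T\<^esub> p"

lemma K_diff_class:
  assumes "p \<in> carrier (add_free n T)" "q \<in> carrier (add_free n T)"
  shows "K_diff n T (K_class n T p) (K_class n T q) = K_class n T (p - q)"
proof -
  interpret normal "split_rels n T" "add_free n T" by (rule split_rels_normal)
  have "K_class n T q \<in> carrier (K_add n T)"
    using assms(2) by (auto simp: K_add_def K_class_def FactGroup_def RCOSETS_def)
  then have "inv\<^bsub>K_add n T\<^esub> (K_class n T q) = K_class n T (inv\<^bsub>add_free n T\<^esub> q)"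
    using inv_FactGroup rcos_inv[OF assms(2)] by (simp add: K_add_def K_class_def)
  moreover have "inv\<^bsub>add_free n T\<^esub> q = - q" using assms(2) by (simp add: add_free_def)
  moreover have "- q \<in> carrier (add_free n T)" using assms(2) by (simp add: add_free_def)
  ultimately show ?thesis
    using rcos_sum[OF assms(1)] by (simp add: K_diff_def K_add_def K_class_def) (simp add: add_free_def)
qed

text \<open>Additivity on direct sums, in both arguments, is what makes a function of two objects descend to
  the Grothendieck group.\<close>
definition additive_form :: "nat \<Rightarrow> dmod \<Rightarrow> (dmod \<Rightarrow> dmod \<Rightarrow> int) \<Rightarrow> bool"
  where "additive_form n T \<beta> \<longleftrightarrow> (\<forall>Z M N A. in_add n T Z \<longrightarrow> in_add n T M \<longrightarrow> in_add n T N \<longrightarrow>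
    direct_sum2 n Z M N \<longrightarrow> in_add n T A \<longrightarrow> \<beta> Z A = \<beta> M A + \<beta> N A \<and> \<beta> A Z = \<beta> A M + \<beta> A N)"

definition form :: "(dmod \<Rightarrow> dmod \<Rightarrow> int) \<Rightarrow> (dmod \<Rightarrow>\<^sub>0 int) \<Rightarrow> (dmod \<Rightarrow>\<^sub>0 int) \<Rightarrow> int"
  where "form \<beta> p q = lin (\<lambda>M. lin (\<beta> M) q) p"

lemma form_diff_left: "form \<beta> (p - p') q = form \<beta> p q - form \<beta> p' q"
  by (simp add: form_def lin_diff)

lemma form_diff_right: "form \<beta> p (q - q') = form \<beta> p q - form \<beta> p q'"
  by (simp add: form_def lin_diff lin_fun_diff)

text \<open>By additivity the bilinear extension vanishes on the relations, so its value does not depend on the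
  representatives and the set in the definition of \<open>bilinear_ext\<close> has a single element.\<close>
lemma bilinear_ext_class:
  assumes \<beta>: "additive_form n T \<beta>" and p: "p \<in> carrier (add_free n T)" and q: "q \<in> carrier (add_free n T)"
  shows "bilinear_ext \<beta> (K_class n T p) (K_class n T q) = form \<beta> p q"
proof -
  interpret normal "split_rels n T" "add_free n T" by (rule split_rels_normal)
  let ?H = "split_rels n T"
  have add: "in_add n T A" if "A \<in> Poly_Mapping.keys r" "r \<in> carrier (add_free n T)" for A r
    using that by (auto simp: add_free_def)
  have H: "h \<in> carrier (add_free n T)" if "h \<in> ?H" for h using that subset by blast
  have left: "form \<beta> h r = 0" if h: "h \<in> ?H" and r: "r \<in> carrier (add_free n T)" for h r
  proof -
    have "lin (\<lambda>M. \<beta> M A) h = 0" if "A \<in> Poly_Mapping.keys r" for A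
      by (rule additive_vanishes_on_split_rels[OF h])
        (use \<beta> add[OF that r] in \<open>auto simp: additive_form_def\<close>)
    then have "lin (\<lambda>N. lin (\<lambda>M. \<beta> M N) h) r = lin (\<lambda>N. 0) r" by (rule lin_cong)
    then show ?thesis unfolding form_def by (subst lin_swap) (simp add: lin_fun_0)
  qed
  have right: "form \<beta> r h = 0" if h: "h \<in> ?H" and r: "r \<in> carrier (add_free n T)" for h r
  proof -
    have "lin (\<beta> A) h = 0" if "A \<in> Poly_Mapping.keys r" for A
      by (rule additive_vanishes_on_split_rels[OF h])
        (use \<beta> add[OF that r] in \<open>auto simp: additive_form_def\<close>)
    then have "lin (\<lambda>A. lin (\<beta> A) h) r = lin (\<lambda>N. 0) r" by (rule lin_cong)
    then show ?thesis by (simp add: form_def lin_fun_0)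
  qed
  have mem: "z \<in> K_class n T r \<longleftrightarrow> (\<exists>h\<in>?H. z = h + r)" for z r
    by (auto simp: K_class_def r_coset_def add_free_def)
  have const: "form \<beta> (h + p) (h' + q) = form \<beta> p q" if "h \<in> ?H" "h' \<in> ?H" for h h'
  proof -
    have "form \<beta> (h + p) (h' + q) = form \<beta> h (h' + q) + form \<beta> p (h' + q)"
      using form_diff_left[of \<beta> "h + p" p "h' + q"] by simp
    also have "\<dots> = form \<beta> h (h' + q) + form \<beta> p h' + form \<beta> p q"
      using form_diff_right[of \<beta> p "h' + q" q] by simp
    also have "h' + q \<in> carrier (add_free n T)"
      using H[OF that(2)] q Poly_Mapping.keys_add[of h' q] by (auto simp: add_free_def)
    then have "form \<beta> h (h' + q) + form \<beta> p h' + form \<beta> p q = form \<beta> p q"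
      using left[OF that(1)] right[OF that(2) p] by simp
    finally show ?thesis .
  qed
  have 0: "0 \<in> ?H"
    using subgroup.one_closed[OF normal_imp_subgroup[OF split_rels_normal]] by (simp add: add_free_def)
  have form_sum: "(\<Sum>M\<in>Poly_Mapping.keys a. \<Sum>N\<in>Poly_Mapping.keys b.
      lookup a M * lookup b N * \<beta> M N) = form \<beta> a b" for a b
    by (simp add: form_def lin_def sum_distrib_left mult.assoc)
  have "{form \<beta> a b | a b. a \<in> K_class n T p \<and> b \<in> K_class n T q} = {form \<beta> p q}"
    unfolding mem using const 0 by (auto, metis add_0)
  then show ?thesis unfolding bilinear_ext_def form_sum by simp
qed

lemma additive_L: "additive_form n T (\<lambda>M N. hom_dim n M N - hom_dim n N M)"
  unfolding additive_form_def
  by (auto simp: hom_dim_direct_sum2_left hom_dim_direct_sum2_right in_add_module)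

lemma additive_Lad:
  assumes "n > 0"
  shows "additive_form n T (\<lambda>M N. hom_dim n M (eta n N) - hom_dim n N (eta n M))"
  unfolding additive_form_def
proof (intro allI impI)
  fix Z M N A
  assume a: "in_add n T Z" "in_add n T M" "in_add n T N" "direct_sum2 n Z M N" "in_add n T A"
  have A: "is_module n A" using a by (rule_tac in_add_module)
  have eA: "is_module n (eta n A)" using A assms by (intro dmodule.eta_module dmodule.intro)
  show "hom_dim n Z (eta n A) - hom_dim n A (eta n Z) =
      hom_dim n M (eta n A) - hom_dim n A (eta n M) + (hom_dim n N (eta n A) - hom_dim n A (eta n N)) \<and>
      hom_dim n A (eta n Z) - hom_dim n Z (eta n A) =
      hom_dim n A (eta n M) - hom_dim n M (eta n A) + (hom_dim n A (eta n N) - hom_dim n N (eta n A))"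
    using hom_dim_direct_sum2_left[OF a(4) eA] hom_dim_direct_sum2_right[OF eta_direct_sum2[OF assms a(4)] A]
    by simp
qed

section \<open>Conflations and cluster tilting objects\<close>

lemma F_DeltaJ_props:
  assumes n: "n > 1" and X: "X \<in> F_DeltaJ n J"
  shows "is_module n X" "is_module n (eta n X)" "a_injective n (eta n X)" "eta n (eta n X) = eta n X"
    "eta n X \<in> F_Delta n" "eta n X \<in> F_DeltaJ n J"
proof -
  have XF: "X \<in> F_Delta n" and TJ: "in_add_TJ n J (eta n X)" using X by (auto simp: F_DeltaJ_def)
  show m: "is_module n X" using XF by (rule F_Delta_module)
  interpret dmodule n X using m by unfold_locales
  show em: "is_module n (eta n X)" using n by (intro eta_module) simp
  show inj: "a_injective n (eta n X)"
    unfolding eta_def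
    by (rule a_injective_sub[OF F_Delta_a_injective[OF XF]]) (use n eta_sub in \<open>auto simp: eta_def\<close>)
  show ee: "eta n (eta n X) = eta n X" using n by (intro eta_eta) simp
  show F: "eta n X \<in> F_Delta n" using F_Delta_if_a_injective[OF n em inj] .
  show "eta n X \<in> F_DeltaJ n J" using F TJ ee by (simp add: F_DeltaJ_def)
qed

text \<open>Every conflation from \<open>\<eta> X\<close> to \<open>T\<close> splits already as a sequence of modules, so \<open>ext\<^sup>1(T, \<eta> X) = 0\<close>
  and the maximality of \<open>T\<close> applies.\<close>
lemma eta_in_add_cluster_tilting:
  assumes n: "n > 1" and T: "cluster_tilting n J T" and X: "X \<in> F_DeltaJ n J"
  shows "in_add n T (eta n X)"
proof -
  note P = F_DeltaJ_props[OF n X]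
  have "ext1_zero n J T (eta n X)"
    unfolding ext1_zero_def
  proof (intro allI impI)
    fix f M g assume c: "conflation n J (eta n X) f M g T"
    then show "\<exists>s\<in>Hom n T M. \<forall>v\<in>und T. g (s v) = v"
      using generated_submodule_splits[OF n _ _ P(3,4)] by (auto simp: conflation_def F_DeltaJ_def)
  qed
  then show ?thesis using T P(6) by (auto simp: cluster_tilting_def)
qed

text \<open>A conflation stays exact under \<open>\<eta>\<close>, and then it starts with a module generated at vertex 0.\<close>
lemma conflation_eta_splits:
  assumes n: "n > 1" and c: "conflation n J L f M g N"
  shows "direct_sum2 n (eta n M) (eta n L) (eta n N)"
proof -
  have L: "L \<in> F_DeltaJ n J" and N: "N \<in> F_DeltaJ n J"
    and se: "short_exact n (eta n L) (eta_map n L f) (eta n M) (eta_map n M g) (eta n N)"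
    using c by (auto simp: conflation_def)
  note PL = F_DeltaJ_props[OF n L] and PN = F_DeltaJ_props[OF n N]
  obtain s where "s \<in> Hom n (eta n N) (eta n M)" "\<forall>v\<in>und (eta n N). eta_map n M g (s v) = v"
    using generated_submodule_splits[OF n PN(5) se PL(3,4)] by blast
  then show ?thesis using short_exact_split[OF se] by blast
qed

text \<open>Elements \<open>p\<close>, \<open>q\<close>, \<open>u\<close>, \<open>w\<close> of the free Abelian group represent \<open>[X]\<close>, \<open>[Y]\<close>, \<open>[\<eta> X]\<close> and \<open>[\<eta> Y]\<close>;
  \<open>\<beta>\<close> and \<open>\<alpha>\<close> are the functions of two objects behind \<open>L\<close> and \<open>L\<^sup>a\<^sup>d\<close>.\<close>
theorem proposition13p7:
  fixes n :: nat and J :: "nat set" and T X Y :: dmod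
    and x y :: "(dmod \<Rightarrow>\<^sub>0 int) set"
  assumes "n > 1" and "J \<subseteq> {1..n - 1}" and "cluster_tilting n J T"
    and "X \<in> F_DeltaJ n J" and "Y \<in> F_DeltaJ n J"
    and "has_class n J T X x" and "has_class n J T Y y"
  shows "L_form n x y - L_form n (pi_class n T X x) (pi_class n T Y y) = Lad_form n x y \<and>
    (in_add_TJ n J Y \<longrightarrow>
      L_form n x y = Lad_form n x y \<and> Lad_form n x y = L_form n (pi_class n T X x) y)"
proof -
  note n = assms(1)
  have n0: "n > 0" using n by simp
  let ?C = "carrier (add_free n T)"
  define h where "h M N = hom_dim n M (eta n N)" for M N
  define \<beta> where "\<beta> M N = hom_dim n M N - hom_dim n N M" for M N
  define \<alpha> where "\<alpha> M N = h M N - h N M" for M N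
  have forms: "L_form n (K_class n T a) (K_class n T b) = form \<beta> a b"
      "Lad_form n (K_class n T a) (K_class n T b) = form \<alpha> a b" if "a \<in> ?C" "b \<in> ?C" for a b
    using bilinear_ext_class[OF additive_L that] bilinear_ext_class[OF additive_Lad[OF n0] that]
    by (simp_all add: L_form_def Lad_form_def \<beta>_def[abs_def] \<alpha>_def[abs_def] h_def)
  note PX = F_DeltaJ_props[OF n assms(4)] and PY = F_DeltaJ_props[OF n assms(5)]
  have addX: "in_add n T (eta n X)" and addY: "in_add n T (eta n Y)"
    using eta_in_add_cluster_tilting[OF n assms(3)] assms(4,5) by auto
  obtain X2 fX X1 gX where X12: "in_add n T X1" "in_add n T X2" and cX: "conflation n J X2 fX X1 gX X"
    and x: "x = K_diff n T (K_obj n T X1) (K_obj n T X2)"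
    using assms(6) unfolding has_class_def by blast
  obtain Y2 fY Y1 gY where Y12: "in_add n T Y1" "in_add n T Y2" and cY: "conflation n J Y2 fY Y1 gY Y"
    and approx: "\<And>N k. in_add n T N \<Longrightarrow> k \<in> Hom n N Y \<Longrightarrow> \<exists>l\<in>Hom n N Y1. \<forall>v\<in>und N. gY (l v) = k v"
    and y: "y = K_diff n T (K_obj n T Y1) (K_obj n T Y2)"
    using assms(7) unfolding has_class_def by blast
  define p q u w where "p = frag_of X1 - frag_of X2" and "q = frag_of Y1 - frag_of Y2"
    and "u = frag_of (eta n X)" and "w = frag_of (eta n Y)"
  have frag_C: "frag_of M \<in> ?C" if "in_add n T M" for M using that by (simp add: add_free_def)
  have diff_C: "a - b \<in> ?C" if "a \<in> ?C" "b \<in> ?C" for a b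
    using that Poly_Mapping.keys_diff[of a b] by (auto simp: add_free_def)
  have C: "p \<in> ?C" "q \<in> ?C" "u \<in> ?C" "w \<in> ?C"
    using X12 Y12 addX addY by (auto simp: p_def q_def u_def w_def intro!: frag_C diff_C)
  have K: "K_obj n T M = K_class n T (frag_of M)" for M by (simp add: K_obj_def K_class_def)
  have xK: "x = K_class n T p" and yK: "y = K_class n T q"
    using X12 Y12 by (simp_all add: x y K K_diff_class frag_C p_def q_def)
  have pi: "pi_class n T X x = K_class n T (p - u)" "pi_class n T Y y = K_class n T (q - w)"
    unfolding pi_class_def xK yK K u_def w_def using C addX addY by (simp_all add: K_diff_class frag_C)
  have keys: "is_module n M" if "M \<in> Poly_Mapping.keys a" "a \<in> ?C" for M a
    using that in_add_module by (auto simp: add_free_def)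
  \<comment> \<open>Homomorphisms out of \<open>\<eta> Z\<close> take values in \<open>\<eta> A\<close>.\<close>
  have \<beta>\<alpha>: "\<beta> A (eta n Z) = \<alpha> A (eta n Z)" "\<beta> (eta n Z) A = \<alpha> (eta n Z) A"
    if "is_module n A" "Z \<in> F_DeltaJ n J" for A Z
    using hom_dim_eta_right[OF n0 _ _ that(1)] F_DeltaJ_props[OF n that(2)]
    by (auto simp: \<beta>_def \<alpha>_def h_def)
  have bw: "form \<beta> a w = form \<alpha> a w" and bu: "form \<beta> u a = form \<alpha> u a" if "a \<in> ?C" for a
    using \<beta>\<alpha> keys[OF _ that] assms(4,5)
    by (auto simp: form_def w_def u_def lin_frag_of intro!: lin_cong)
  \<comment> \<open>The sequence obtained by applying \<open>\<eta>\<close> splits and \<open>\<eta>\<close> is idempotent, so \<open>h(_, [\<pi> N]) = 0\<close>.\<close>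
  have h0: "form h a (frag_of M - frag_of L - frag_of (eta n N)) = 0"
    if c: "conflation n J L f M g N" and a: "a \<in> ?C" for a L f M g N
  proof -
    have N: "N \<in> F_DeltaJ n J" using c by (simp add: conflation_def)
    have "h A M - h A L - h A (eta n N) = 0" if "A \<in> Poly_Mapping.keys a" for A
      using hom_dim_direct_sum2_right[OF conflation_eta_splits[OF n c] keys[OF that a]]
        F_DeltaJ_props(4)[OF n N] by (simp add: h_def)
    then have "form h a (frag_of M - frag_of L - frag_of (eta n N)) = lin (\<lambda>A. 0) a"
      unfolding form_def by (intro lin_cong) (simp add: lin_diff lin_frag_of)
    then show ?thesis by (simp add: lin_fun_0)
  qed
  have \<alpha>h: "form \<alpha> a b = form h a b - form h b a" for a b
  proof -
    have "form \<alpha> a b = lin (\<lambda>M. lin (h M) b) a - lin (\<lambda>M. lin (\<lambda>N. h N M) b) a"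
      unfolding form_def \<alpha>_def by (simp add: lin_fun_diff)
    then show ?thesis unfolding form_def by (subst (asm) (2) lin_swap)
  qed
  have "form \<alpha> (p - u) (q - w) = 0"
    unfolding \<alpha>h using h0[OF cY diff_C[OF C(1,3)]] h0[OF cX diff_C[OF C(2,4)]]
    by (simp add: p_def q_def u_def w_def)
  then have 1: "form \<beta> p q - form \<beta> (p - u) (q - w) = form \<alpha> p q"
    using bw[OF C(1)] bw[OF C(3)] bu[OF C(2)] by (simp add: form_diff_left form_diff_right)
  have 2: "form \<beta> p q = form \<alpha> p q \<and> form \<alpha> p q = form \<beta> (p - u) q" if "in_add_TJ n J Y"
  proof -
    have eY: "eta n Y = Y" using eta_in_add_TJ[OF n0 that] .
    then have inY: "in_add n T Y" using addY by simp
    have mY: "is_module n Y" using PY(1) .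
    have seY: "short_exact n Y2 fY Y1 gY Y" using cY by (simp add: conflation_def)
    \<comment> \<open>The identity of \<open>Y\<close> factors through the approximation.\<close>
    obtain l where "l \<in> Hom n Y Y1" "\<forall>v\<in>und Y. gY (l v) = v"
      using approx[OF inY dmodule.hom_id[OF dmodule.intro[OF mY]]] by auto
    then have ds: "direct_sum2 n Y1 Y2 Y" using short_exact_split[OF seY] by blast
    have q: "form \<gamma> a q = form \<gamma> a w" if \<gamma>: "additive_form n T \<gamma>" and a: "a \<in> ?C" for \<gamma> a
    proof -
      have "\<gamma> A Y1 = \<gamma> A Y2 + \<gamma> A Y" if "A \<in> Poly_Mapping.keys a" for A
        using \<gamma> a that Y12 inY ds by (auto simp: additive_form_def add_free_def)
      then show ?thesis
        unfolding form_def by (intro lin_cong) (simp add: q_def w_def eY lin_diff lin_frag_of)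
    qed
    have q\<beta>: "form \<beta> a q = form \<beta> a w" and q\<alpha>: "form \<alpha> a q = form \<alpha> a w" if "a \<in> ?C" for a
      using q[OF additive_L that] q[OF additive_Lad[OF n0] that]
      by (simp_all add: \<beta>_def[abs_def] \<alpha>_def[abs_def] h_def)
    have "form \<beta> u w = 0"
      using hom_dim_commute[OF n PX(2-4) PY(2-4)] by (simp add: form_def u_def w_def lin_frag_of \<beta>_def)
    then show ?thesis
      using q\<beta>[OF C(1)] q\<alpha>[OF C(1)] q\<beta>[OF C(3)] bw[OF C(1)] by (simp add: form_diff_left)
  qed
  show ?thesis
    unfolding pi unfolding xK yK using 1 2 C by (simp add: forms diff_C)
qed

end
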